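(* Let $A$ be a $\sigma$-finite von Neumann algebra, consider any $k_1,\dots,k_n\in A$, and let $W_2$ be the associated Wasserstein distance on the set $\mathfrak{F}(A)$ of faithful normal states on $A$. Then $$W_2(\mu,\xi)\leq W_2(\mu,\nu)+W_2(\nu,\xi)$$ for all $\mu,\nu,\xi\in\mathfrak{F}(A)$.
   Context: Inner products are linear in the second variable. $\mathfrak{F}(A)$ denotes the set of faithful normal states on the von Neumann algebra $A$. Take $A$ in standard form on a Hilbert space $G$; each $\mu\in\mathfrak{F}(A)$ is represented by a cyclic and separating vector $\Lambda_\mu\in G$ for $A$, i.e. $\mu(a)=\langle\Lambda_\mu,a\Lambda_\mu\rangle$ for $a\in A$. On the commutant $A'$ one defines the state $\mu'(a')=\langle\Lambda_\mu,a'\Lambda_\mu\rangle$. Let $\sigma^\mu$ denote the modular group of $A$ associated with $\mu$. Transport plans: for $\mu,\nu\in\mathfrak{F}(A)$, a transport plan from $\mu$ to $\nu$ is a state $\omega$ on the algebraic tensor product $A\odot A'$ with $\omega(a\otimes 1)=\mu(a)$ and $\omega(1\otimes a')=\nu'(a')$ for all $a\in A$, $a'\in A'$; $T(\mu,\nu)$ is the set of these. For a unital completely positive map $\beta:A\to A$ with $\nu\circ\beta=\nu$, its dual $\beta':A'\to A'$ is defined by $\langle\Lambda_\nu,b\beta'(b')\Lambda_\nu\rangle=\langle\Lambda_\nu,\beta(b)b'\Lambda_\nu\rangle$ for all $b\in A$, $b'\in A'$. The set $T_\sigma(\mu,\nu)$ of modular transport plans consists of those $\omega\in T(\mu,\nu)$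 with $\omega(\sigma_t^\mu(a)\otimes b')=\omega(a\otimes(\sigma_t^\nu)'(b'))$ for all $a\in A$, $b'\in A'$, $t\in\mathbb{R}$. Cost: for $\omega\in T(\mu,\nu)$ let $(H_\omega,\pi_\omega,\Omega)$ be a cyclic representation of $(A\odot A',\omega)$, i.e. $\Omega$ is cyclic and $\omega=\langle\Omega,\pi_\omega(\cdot)\Omega\rangle_\omega$; $\|\cdot\|_\omega$ is the norm of $H_\omega$. Put $\pi_\mu^\omega(a)=\pi_\omega(a\otimes1)|_{H_\mu^\omega}$ for $a\in A$, where $H_\mu^\omega=\overline{\pi_\omega(A\otimes1)\Omega}$. Let $H_\nu^\omega=\overline{\pi_\omega(1\otimes A')\Omega}$, let $u_\nu:G\to H_\nu^\omega$ be the unitary determined by $u_\nu a'\Lambda_\nu=\pi_\omega(1\otimes a')\Omega$ for $a'\in A'$, and put $\pi_\nu^\omega(b)=u_\nu bu_\nu^*$ for $b\in A$. Given $k_1,\dots,k_n\in A$, the cost of $\omega$ is $I(\omega)=\sum_{l=1}^n\|\pi_\mu^\omega(k_l)\Omega-\pi_\nu^\omega(k_l)\Omega\|_\omega^2$. The Wasserstein distance associated to $k_1,\dots,k_n$ is $W_2(\mu,\nu)=\inf_{\omega\in T_\sigma(\mu,\nu)}I(\omega)^{1/2}$ for $\mu,\nu\in\mathfrak{F}(A)$. *)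

theory Defs
  imports "HOL-Analysis.Analysis" "HOL-Library.Function_Algebras"
begin

section \<open>Complex vector spaces and complex Hilbert spaces\<close>

class scaleC =
  fixes scaleC :: "complex \<Rightarrow> 'a \<Rightarrow> 'a"  (infixr \<open>*\<^sub>C\<close> 75)

class complex_vector = ab_group_add + scaleC +
  assumes scaleC_add_right: "c *\<^sub>C (x + y) = c *\<^sub>C x + c *\<^sub>C y"
    and scaleC_add_left: "(c + d) *\<^sub>C x = c *\<^sub>C x + d *\<^sub>C x"
    and scaleC_scaleC: "c *\<^sub>C d *\<^sub>C x = (c * d) *\<^sub>C x"
    and scaleC_one: "1 *\<^sub>C x = x"

global_interpretation complex_vector: vector_space "scaleC :: complex \<Rightarrow> 'a \<Rightarrow> 'a::complex_vector"
  defines csubspace_raw_def: csubspace = complex_vector.subspace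
    and cspan_raw_def: cspan = complex_vector.span
  by unfold_locales (rule scaleC_add_right scaleC_add_left scaleC_scaleC scaleC_one)+

instantiation complex :: complex_vector
begin
definition scaleC_complex :: "complex \<Rightarrow> complex \<Rightarrow> complex" where
  "scaleC_complex = (*)"
instance by standard (simp_all add: scaleC_complex_def algebra_simps)
end

instantiation "fun" :: (type, complex_vector) complex_vector
begin
definition scaleC_fun :: "complex \<Rightarrow> ('a \<Rightarrow> 'b) \<Rightarrow> 'a \<Rightarrow> 'b" where
  "scaleC_fun c f = (\<lambda>x. c *\<^sub>C f x)"
instance
  by standard
    (simp_all add: scaleC_fun_def fun_eq_iff scaleC_add_right scaleC_add_left scaleC_scaleC scaleC_one)
end

text \<open>Inner products are linear in the second variable.  The norm, metric and topology are those of
  the underlying real Hilbert space, whose inner product is the real part of the complex one.\<close>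

class complex_hilbert_space = real_inner + complete_space + complex_vector +
  fixes cinner :: "'a \<Rightarrow> 'a \<Rightarrow> complex"
  assumes scaleR_scaleC: "r *\<^sub>R x = complex_of_real r *\<^sub>C x"
    and cinner_commute: "cinner y x = cnj (cinner x y)"
    and cinner_add_right: "cinner x (y + z) = cinner x y + cinner x z"
    and cinner_scaleC_right: "cinner x (c *\<^sub>C y) = c * cinner x y"
    and inner_eq_Re_cinner: "inner x y = Re (cinner x y)"


section \<open>Operators and von Neumann algebras\<close>

type_synonym 'g op = "'g \<Rightarrow> 'g"

definition bounded_clinear :: "'g::complex_hilbert_space op \<Rightarrow> bool" where
  "bounded_clinear a \<longleftrightarrow> bounded_linear a \<and> Vector_Spaces.linear scaleC scaleC a"

definition cadjoint :: "'g::complex_hilbert_space op \<Rightarrow> 'g op" where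
  "cadjoint a = (THE b. \<forall>x y. cinner (a x) y = cinner x (b y))"

definition projection :: "'g::complex_hilbert_space op \<Rightarrow> bool" where
  "projection p \<longleftrightarrow> bounded_clinear p \<and> p \<circ> p = p \<and> cadjoint p = p"

definition op_le :: "'g::complex_hilbert_space op \<Rightarrow> 'g op \<Rightarrow> bool" where
  "op_le a b \<longleftrightarrow> (\<forall>x. cinner x ((b - a) x) \<in> \<real>\<^sub>\<ge>\<^sub>0)"

definition commutant :: "'g::complex_hilbert_space op set \<Rightarrow> 'g op set" where
  "commutant A = {b. bounded_clinear b \<and> (\<forall>a\<in>A. a \<circ> b = b \<circ> a)}"

definition von_neumann_algebra :: "'g::complex_hilbert_space op set \<Rightarrow> bool" where
  "von_neumann_algebra A \<longleftrightarrow>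
     (\<forall>a\<in>A. bounded_clinear a \<and> cadjoint a \<in> A) \<and> commutant (commutant A) = A"

definition sigma_finite_algebra :: "'g::complex_hilbert_space op set \<Rightarrow> bool" where
  "sigma_finite_algebra A \<longleftrightarrow>
     (\<forall>F. F \<subseteq> {p \<in> A. projection p \<and> p \<noteq> 0} \<and> (\<forall>p\<in>F. \<forall>q\<in>F. p \<noteq> q \<longrightarrow> p \<circ> q = 0)
        \<longrightarrow> countable F)"

text \<open>Haagerup's standard form: \<open>J\<close> is an antiunitary involution and \<open>P\<close> a self-dual cone.\<close>

definition standard_form ::
    "'g::complex_hilbert_space op set \<Rightarrow> 'g op \<Rightarrow> 'g set \<Rightarrow> bool" where
  "standard_form A J P \<longleftrightarrow>
     (\<forall>x y. J (x + y) = J x + J y) \<and> (\<forall>c x. J (c *\<^sub>C x) = cnj c *\<^sub>C J x) \<and>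
     (\<forall>x y. cinner (J x) (J y) = cinner y x) \<and> (\<forall>x. J (J x) = x) \<and>
     P = {x. \<forall>y\<in>P. cinner x y \<in> \<real>\<^sub>\<ge>\<^sub>0} \<and>
     (\<lambda>a. J \<circ> a \<circ> J) ` A = commutant A \<and>
     (\<forall>c \<in> A \<inter> commutant A. J \<circ> c \<circ> J = cadjoint c) \<and>
     (\<forall>x\<in>P. J x = x) \<and>
     (\<forall>a\<in>A. \<forall>x\<in>P. a (J (a (J x))) \<in> P)"


section \<open>Faithful normal states\<close>

text \<open>A functional on \<open>A\<close> is a function on all maps whose values outside \<open>A\<close> are never used.\<close>

definition state_on :: "'g::complex_hilbert_space op set \<Rightarrow> ('g op \<Rightarrow> complex) \<Rightarrow> bool" where
  "state_on A \<mu> \<longleftrightarrow>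
     (\<forall>a\<in>A. \<forall>b\<in>A. \<mu> (a + b) = \<mu> a + \<mu> b) \<and> (\<forall>c. \<forall>a\<in>A. \<mu> (c *\<^sub>C a) = c * \<mu> a) \<and>
     \<mu> id = 1 \<and> (\<forall>a\<in>A. \<mu> (cadjoint a \<circ> a) \<in> \<real>\<^sub>\<ge>\<^sub>0)"

text \<open>Normality: suprema of bounded increasing nets of positive elements (equivalently, of upward
  directed sets) are preserved.\<close>

definition normal_on :: "'g::complex_hilbert_space op set \<Rightarrow> ('g op \<Rightarrow> complex) \<Rightarrow> bool" where
  "normal_on A \<mu> \<longleftrightarrow>
     (\<forall>D s. D \<noteq> {} \<and> D \<subseteq> {a \<in> A. op_le 0 a} \<and>
        (\<forall>a\<in>D. \<forall>b\<in>D. \<exists>c\<in>D. op_le a c \<and> op_le b c) \<and>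
        s \<in> A \<and> (\<forall>a\<in>D. op_le a s) \<and> (\<forall>b\<in>A. (\<forall>a\<in>D. op_le a b) \<longrightarrow> op_le s b)
        \<longrightarrow> bdd_above ((\<lambda>a. Re (\<mu> a)) ` D) \<and> Re (\<mu> s) = (SUP a\<in>D. Re (\<mu> a)))"

definition faithful_normal_states ::
    "'g::complex_hilbert_space op set \<Rightarrow> ('g op \<Rightarrow> complex) set"  (\<open>\<FF>\<close>) where
  "\<FF> A = {\<mu>. state_on A \<mu> \<and> normal_on A \<mu> \<and> (\<forall>a\<in>A. \<mu> (cadjoint a \<circ> a) = 0 \<longrightarrow> a = 0)}"

text \<open>Separating means: injectivity of \<open>a \<mapsto> a \<Lambda>\<close> on \<open>A\<close>.\<close>

definition cyclic_separating :: "'g::complex_hilbert_space op set \<Rightarrow> 'g \<Rightarrow> bool" where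
  "cyclic_separating A \<Lambda> \<longleftrightarrow>
     closure ((\<lambda>a. a \<Lambda>) ` A) = UNIV \<and> (\<forall>a\<in>A. a \<Lambda> = 0 \<longrightarrow> a = 0)"


section \<open>The modular group\<close>

text \<open>Unbounded operators are represented by their graphs.  \<open>tomita_operator A \<Lambda>\<close> is the closure \<open>S\<close>
  of \<open>a \<Lambda> \<mapsto> a\<^sup>* \<Lambda>\<close>, and \<open>modular_operator A \<Lambda>\<close> is \<open>\<Delta> = S\<^sup>* S\<close>.\<close>

definition tomita_operator :: "'g::complex_hilbert_space op set \<Rightarrow> 'g \<Rightarrow> ('g \<times> 'g) set" where
  "tomita_operator A \<Lambda> = closure {(a \<Lambda>, cadjoint a \<Lambda>) |a. a \<in> A}"

definition antilinear_adjoint :: "('g::complex_hilbert_space \<times> 'g) set \<Rightarrow> ('g \<times> 'g) set" where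
  "antilinear_adjoint S = {(x, z). \<forall>(u, v)\<in>S. cinner z u = cinner v x}"

definition modular_operator :: "'g::complex_hilbert_space op set \<Rightarrow> 'g \<Rightarrow> ('g \<times> 'g) set" where
  "modular_operator A \<Lambda> = tomita_operator A \<Lambda> O antilinear_adjoint (tomita_operator A \<Lambda>)"

definition projection_valued_measure :: "(real set \<Rightarrow> 'g::complex_hilbert_space op) \<Rightarrow> bool" where
  "projection_valued_measure E \<longleftrightarrow>
     (\<forall>B \<in> sets borel. projection (E B)) \<and> E UNIV = id \<and>
     (\<forall>B \<in> sets borel. \<forall>C \<in> sets borel. E (B \<inter> C) = E B \<circ> E C) \<and>
     (\<forall>F x. range F \<subseteq> sets borel \<and> disjoint_family F \<longrightarrow>
        (\<lambda>n::nat. E (F n) x) sums E (\<Union>n. F n) x)"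

definition spectral_measure ::
    "(real set \<Rightarrow> 'g::complex_hilbert_space op) \<Rightarrow> 'g \<Rightarrow> real measure" where
  "spectral_measure E x = measure_of UNIV (sets borel) (\<lambda>B. ennreal (Re (cinner x (E B x))))"

text \<open>\<open>D = \<integral> s dE(s)\<close>.  Both this and the definition of \<open>D\<^sup>i\<^sup>t\<close> below only mention the quadratic forms;
  as \<open>D\<close> and \<open>D\<^sup>i\<^sup>t\<close> are linear, these determine the operators by polarization.\<close>

definition spectral_resolution ::
    "('g::complex_hilbert_space \<times> 'g) set \<Rightarrow> (real set \<Rightarrow> 'g op) \<Rightarrow> bool" where
  "spectral_resolution D E \<longleftrightarrow>
     csubspace (Domain D) \<and> single_valued D \<and>
     (\<forall>(x, y)\<in>D. \<forall>(x', y')\<in>D. \<forall>c. (x + c *\<^sub>C x', y + c *\<^sub>C y') \<in> D) \<and>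
     projection_valued_measure E \<and>
     Domain D = {x. integrable (spectral_measure E x) (\<lambda>s. s\<^sup>2)} \<and>
     (\<forall>(x, y)\<in>D. cinner x y = complex_of_real (\<integral>s. s \<partial>spectral_measure E x))"

text \<open>\<open>U t = D\<^sup>i\<^sup>t\<close> for positive injective self-adjoint \<open>D\<close>; its spectral measures are concentrated on
  \<open>{0<..}\<close>, so the values of \<open>ln\<close> elsewhere are irrelevant.\<close>

definition imaginary_powers ::
    "('g::complex_hilbert_space \<times> 'g) set \<Rightarrow> (real \<Rightarrow> 'g op) \<Rightarrow> bool" where
  "imaginary_powers D U \<longleftrightarrow>
     (\<exists>E. spectral_resolution D E \<and>
        (\<forall>t. bounded_clinear (U t) \<and>
           (\<forall>x. cinner x (U t x) = (\<integral>s. cis (t * ln s) \<partial>spectral_measure E x))))"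

text \<open>\<open>\<sigma>\<close> is the modular group of \<open>A\<close> for the state given by the cyclic and separating vector \<open>\<Lambda>\<close>: the
  maps \<open>\<sigma>\<^sub>t(a) = \<Delta>\<^sup>i\<^sup>t a \<Delta>\<^sup>-\<^sup>i\<^sup>t\<close> of \<open>A\<close> into itself.  By the Tomita--Takesaki theorem such a \<open>\<sigma>\<close> exists and
  is unique on \<open>A\<close>.\<close>

definition is_modular_group ::
    "'g::complex_hilbert_space op set \<Rightarrow> 'g \<Rightarrow> (real \<Rightarrow> 'g op \<Rightarrow> 'g op) \<Rightarrow> bool" where
  "is_modular_group A \<Lambda> \<sigma> \<longleftrightarrow>
     (\<exists>U. imaginary_powers (modular_operator A \<Lambda>) U \<and>
        (\<forall>t. \<forall>a\<in>A. \<sigma> t a = U t \<circ> a \<circ> U (- t) \<and> \<sigma> t a \<in> A))"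


section \<open>Transport plans\<close>

text \<open>By the universal property of the algebraic tensor product, a linear functional \<open>\<omega>\<close> on \<open>A \<odot> B\<close> is
  the same as a bilinear functional on \<open>A \<times> B\<close>; \<open>\<omega> a b\<close> stands for the value at the elementary tensor of
  \<open>a\<close> and \<open>b\<close>.  The positivity condition says \<open>\<omega>(x\<^sup>* x) \<ge> 0\<close> for \<open>x\<close> the sum of the elementary tensors of
  \<open>f i\<close> and \<open>g i\<close>, \<open>i < N\<close>.\<close>

definition tensor_state ::
    "'g::complex_hilbert_space op set \<Rightarrow> 'g op set \<Rightarrow> ('g op \<Rightarrow> 'g op \<Rightarrow> complex) \<Rightarrow> bool" where
  "tensor_state A B \<omega> \<longleftrightarrow>
     (\<forall>a\<in>A. \<forall>a'\<in>A. \<forall>b\<in>B. \<omega> (a + a') b = \<omega> a b + \<omega> a' b) \<and>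
     (\<forall>a\<in>A. \<forall>b\<in>B. \<forall>b'\<in>B. \<omega> a (b + b') = \<omega> a b + \<omega> a b') \<and>
     (\<forall>c. \<forall>a\<in>A. \<forall>b\<in>B. \<omega> (c *\<^sub>C a) b = c * \<omega> a b \<and> \<omega> a (c *\<^sub>C b) = c * \<omega> a b) \<and>
     \<omega> id id = 1 \<and>
     (\<forall>N f g. (\<forall>i<N. f i \<in> A \<and> g i \<in> B) \<longrightarrow>
        (\<Sum>i<N. \<Sum>j<(N::nat). \<omega> (cadjoint (f i) \<circ> f j) (cadjoint (g i) \<circ> g j)) \<in> \<real>\<^sub>\<ge>\<^sub>0)"

definition commutant_state :: "'g::complex_hilbert_space \<Rightarrow> 'g op \<Rightarrow> complex" where
  "commutant_state \<Lambda> a' = cinner \<Lambda> (a' \<Lambda>)"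

text \<open>From here on \<open>\<Lambda> \<mu>\<close> and \<open>\<sigma> \<mu>\<close> are the chosen vector representing \<open>\<mu>\<close> and the modular group for \<open>\<mu>\<close>.\<close>

definition transport_plans ::
    "'g::complex_hilbert_space op set \<Rightarrow> (('g op \<Rightarrow> complex) \<Rightarrow> 'g) \<Rightarrow>
     ('g op \<Rightarrow> complex) \<Rightarrow> ('g op \<Rightarrow> complex) \<Rightarrow> ('g op \<Rightarrow> 'g op \<Rightarrow> complex) set" where
  "transport_plans A \<Lambda> \<mu> \<nu> =
     {\<omega>. tensor_state A (commutant A) \<omega> \<and> (\<forall>a\<in>A. \<omega> a id = \<mu> a) \<and>
         (\<forall>a'\<in>commutant A. \<omega> id a' = commutant_state (\<Lambda> \<nu>) a')}"

definition dual_map ::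
    "'g::complex_hilbert_space op set \<Rightarrow> 'g \<Rightarrow> ('g op \<Rightarrow> 'g op) \<Rightarrow> 'g op \<Rightarrow> 'g op" where
  "dual_map A \<Lambda> \<beta> b' =
     (THE c'. c' \<in> commutant A \<and> (\<forall>b\<in>A. cinner \<Lambda> (b (c' \<Lambda>)) = cinner \<Lambda> (\<beta> b (b' \<Lambda>))))"

definition modular_transport_plans ::
    "'g::complex_hilbert_space op set \<Rightarrow> (('g op \<Rightarrow> complex) \<Rightarrow> 'g) \<Rightarrow>
     (('g op \<Rightarrow> complex) \<Rightarrow> real \<Rightarrow> 'g op \<Rightarrow> 'g op) \<Rightarrow>
     ('g op \<Rightarrow> complex) \<Rightarrow> ('g op \<Rightarrow> complex) \<Rightarrow> ('g op \<Rightarrow> 'g op \<Rightarrow> complex) set" where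
  "modular_transport_plans A \<Lambda> \<sigma> \<mu> \<nu> =
     {\<omega> \<in> transport_plans A \<Lambda> \<mu> \<nu>.
        \<forall>a\<in>A. \<forall>b'\<in>commutant A. \<forall>t. \<omega> (\<sigma> \<mu> t a) b' = \<omega> a (dual_map A (\<Lambda> \<nu>) (\<sigma> \<nu> t) b')}"


section \<open>Cyclic representations and the cost\<close>

text \<open>Vectors of the representation space are functions \<open>A \<times> A' \<rightarrow> \<complex>\<close>; the space is a linear subspace with an
  inner product of its own.  This is no restriction on cyclic representations: for any
  \<open>(H, \<pi>, \<Omega>)\<close> the map sending \<open>v\<close> to \<open>(a, a') \<mapsto> \<langle>\<pi>(a \<otimes> a') \<Omega>, v\<rangle>\<close> is linear, and injective by cyclicity,
  so it carries \<open>H\<close> onto such a space.\<close>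

type_synonym 'g rep_vec = "'g op \<times> 'g op \<Rightarrow> complex"

record 'g tensor_rep =
  rep_space :: "'g rep_vec set"
  rep_inner :: "'g rep_vec \<Rightarrow> 'g rep_vec \<Rightarrow> complex"
  rep_act :: "'g op \<Rightarrow> 'g op \<Rightarrow> 'g rep_vec \<Rightarrow> 'g rep_vec"
  rep_cyc :: "'g rep_vec"

definition rep_norm :: "'g tensor_rep \<Rightarrow> 'g rep_vec \<Rightarrow> real" where
  "rep_norm R v = sqrt (Re (rep_inner R v v))"

definition hilbert_rep_space :: "'g tensor_rep \<Rightarrow> bool" where
  "hilbert_rep_space R \<longleftrightarrow>
     csubspace (rep_space R) \<and>
     (\<forall>u\<in>rep_space R. \<forall>v\<in>rep_space R. \<forall>w\<in>rep_space R.
        rep_inner R u (v + w) = rep_inner R u v + rep_inner R u w) \<and>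
     (\<forall>c. \<forall>u\<in>rep_space R. \<forall>v\<in>rep_space R. rep_inner R u (c *\<^sub>C v) = c * rep_inner R u v) \<and>
     (\<forall>u\<in>rep_space R. \<forall>v\<in>rep_space R. rep_inner R v u = cnj (rep_inner R u v)) \<and>
     (\<forall>v\<in>rep_space R. rep_inner R v v \<in> \<real>\<^sub>\<ge>\<^sub>0) \<and>
     (\<forall>v\<in>rep_space R. rep_inner R v v = 0 \<longrightarrow> v = 0) \<and>
     (\<forall>X::nat \<Rightarrow> _. range X \<subseteq> rep_space R \<and>
        (\<forall>e>0. \<exists>M. \<forall>m\<ge>M. \<forall>n\<ge>M. rep_norm R (X m - X n) < e) \<longrightarrow>
        (\<exists>v\<in>rep_space R. (\<lambda>n. rep_norm R (X n - v)) \<longlonglongrightarrow> 0))"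

definition rep_closure :: "'g tensor_rep \<Rightarrow> 'g rep_vec set \<Rightarrow> 'g rep_vec set" where
  "rep_closure R S =
     {v \<in> rep_space R. \<exists>X::nat \<Rightarrow> _. range X \<subseteq> S \<and> (\<lambda>n. rep_norm R (X n - v)) \<longlonglongrightarrow> 0}"

text \<open>\<open>rep_act R a b\<close> is the operator of the elementary tensor of \<open>a\<close> and \<open>b\<close>; the representation
  of \<open>A \<odot> B\<close> is its linear extension, hence the span in the cyclicity condition.\<close>

definition cyclic_representation ::
    "'g::complex_hilbert_space op set \<Rightarrow> 'g op set \<Rightarrow> ('g op \<Rightarrow> 'g op \<Rightarrow> complex) \<Rightarrow>
     'g tensor_rep \<Rightarrow> bool" where
  "cyclic_representation A B \<omega> R \<longleftrightarrow>
     hilbert_rep_space R \<and>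
     (\<forall>a\<in>A. \<forall>b\<in>B.
        (\<forall>v\<in>rep_space R. rep_act R a b v \<in> rep_space R) \<and>
        (\<forall>v\<in>rep_space R. \<forall>w\<in>rep_space R. rep_act R a b (v + w) = rep_act R a b v + rep_act R a b w) \<and>
        (\<forall>c. \<forall>v\<in>rep_space R. rep_act R a b (c *\<^sub>C v) = c *\<^sub>C rep_act R a b v) \<and>
        (\<exists>K. \<forall>v\<in>rep_space R. rep_norm R (rep_act R a b v) \<le> K * rep_norm R v)) \<and>
     (\<forall>v\<in>rep_space R.
        (\<forall>a\<in>A. \<forall>a'\<in>A. \<forall>b\<in>B. rep_act R (a + a') b v = rep_act R a b v + rep_act R a' b v) \<and>
        (\<forall>a\<in>A. \<forall>b\<in>B. \<forall>b'\<in>B. rep_act R a (b + b') v = rep_act R a b v + rep_act R a b' v) \<and>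
        (\<forall>c. \<forall>a\<in>A. \<forall>b\<in>B. rep_act R (c *\<^sub>C a) b v = c *\<^sub>C rep_act R a b v \<and>
                           rep_act R a (c *\<^sub>C b) v = c *\<^sub>C rep_act R a b v) \<and>
        rep_act R id id v = v \<and>
        (\<forall>a\<in>A. \<forall>a'\<in>A. \<forall>b\<in>B. \<forall>b'\<in>B.
           rep_act R (a \<circ> a') (b \<circ> b') v = rep_act R a b (rep_act R a' b' v)) \<and>
        (\<forall>w\<in>rep_space R. \<forall>a\<in>A. \<forall>b\<in>B.
           rep_inner R (rep_act R a b v) w = rep_inner R v (rep_act R (cadjoint a) (cadjoint b) w))) \<and>
     rep_cyc R \<in> rep_space R \<and>
     rep_closure R (cspan {rep_act R a b (rep_cyc R) |a b. a \<in> A \<and> b \<in> B}) = rep_space R \<and>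
     (\<forall>a\<in>A. \<forall>b\<in>B. \<omega> a b = rep_inner R (rep_cyc R) (rep_act R a b (rep_cyc R)))"

definition H_left :: "'g::complex_hilbert_space op set \<Rightarrow> 'g tensor_rep \<Rightarrow> 'g rep_vec set" where
  "H_left A R = rep_closure R {rep_act R a id (rep_cyc R) |a. a \<in> A}"

definition H_right :: "'g::complex_hilbert_space op set \<Rightarrow> 'g tensor_rep \<Rightarrow> 'g rep_vec set" where
  "H_right A R = rep_closure R {rep_act R id a' (rep_cyc R) |a'. a' \<in> commutant A}"

definition pi_left ::
    "'g::complex_hilbert_space op set \<Rightarrow> 'g tensor_rep \<Rightarrow> 'g op \<Rightarrow> 'g rep_vec \<Rightarrow> 'g rep_vec" where
  "pi_left A R a = restrict (rep_act R a id) (H_left A R)"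

definition u_right ::
    "'g::complex_hilbert_space op set \<Rightarrow> 'g \<Rightarrow> 'g tensor_rep \<Rightarrow> 'g \<Rightarrow> 'g rep_vec" where
  "u_right A \<Lambda> R =
     (THE u. bij_betw u UNIV (H_right A R) \<and> Vector_Spaces.linear scaleC scaleC u \<and>
        (\<forall>x y. rep_inner R (u x) (u y) = cinner x y) \<and>
        (\<forall>a'\<in>commutant A. u (a' \<Lambda>) = rep_act R id a' (rep_cyc R)))"

text \<open>The adjoint of the unitary \<open>u\<close> from \<open>G\<close> onto \<open>H_right A R\<close> is its inverse.\<close>

definition pi_right ::
    "'g::complex_hilbert_space op set \<Rightarrow> 'g \<Rightarrow> 'g tensor_rep \<Rightarrow> 'g op \<Rightarrow> 'g rep_vec \<Rightarrow> 'g rep_vec" where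
  "pi_right A \<Lambda> R b =
     restrict (u_right A \<Lambda> R \<circ> b \<circ> inv_into UNIV (u_right A \<Lambda> R)) (H_right A R)"

text \<open>The cost does not depend on which cyclic representation is chosen.\<close>

definition transport_cost ::
    "'g::complex_hilbert_space op set \<Rightarrow> 'g \<Rightarrow> nat \<Rightarrow> (nat \<Rightarrow> 'g op) \<Rightarrow>
     ('g op \<Rightarrow> 'g op \<Rightarrow> complex) \<Rightarrow> real" where
  "transport_cost A \<Lambda> n k \<omega> =
     (let R = (SOME R. cyclic_representation A (commutant A) \<omega> R) in
      \<Sum>l=1..n. (rep_norm R (pi_left A R (k l) (rep_cyc R) - pi_right A \<Lambda> R (k l) (rep_cyc R)))\<^sup>2)"

definition W2 ::
    "'g::complex_hilbert_space op set \<Rightarrow> (('g op \<Rightarrow> complex) \<Rightarrow> 'g) \<Rightarrow>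
     (('g op \<Rightarrow> complex) \<Rightarrow> real \<Rightarrow> 'g op \<Rightarrow> 'g op) \<Rightarrow> nat \<Rightarrow> (nat \<Rightarrow> 'g op) \<Rightarrow>
     ('g op \<Rightarrow> complex) \<Rightarrow> ('g op \<Rightarrow> complex) \<Rightarrow> real" where
  "W2 A \<Lambda> \<sigma> n k \<mu> \<nu> =
     (INF \<omega>\<in>modular_transport_plans A \<Lambda> \<sigma> \<mu> \<nu>. sqrt (transport_cost A (\<Lambda> \<nu>) n k \<omega>))"

end

theory Submission
  imports Defs
begin

text \<open>A transport plan \<open>\<omega>\<close> from \<open>\<mu>\<close> to \<open>\<nu>\<close> is the same as a unital completely positive map \<open>E\<^sub>\<omega>\<close> of \<open>A\<close> with
  \<open>\<omega>(a \<otimes> b') = \<langle>\<Lambda>\<^sub>\<nu>, E\<^sub>\<omega>(a) b' \<Lambda>\<^sub>\<nu>\<rangle>\<close>, and dually as a map \<open>E'\<^sub>\<omega>\<close> of \<open>A'\<close>.  Plans \<open>\<omega>\<close> from \<open>\<mu>\<close> to \<open>\<nu>\<close> and \<open>\<phi>\<close> from \<open>\<nu>\<close> to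
  \<open>\<xi>\<close> are composed by \<open>\<chi>(a \<otimes> b') = \<langle>\<Lambda>\<^sub>\<nu>, E\<^sub>\<omega>(a) E'\<^sub>\<phi>(b') \<Lambda>\<^sub>\<nu>\<rangle>\<close>, so that \<open>E\<^sub>\<chi> = E\<^sub>\<phi> E\<^sub>\<omega>\<close>; positivity of \<open>\<chi>\<close> is
  a Schur product argument for commuting positive matrices over \<open>A\<close> and \<open>A'\<close>.  The cost is
  \<open>I(\<omega>) = \<Sum>\<^sub>l \<parallel>k\<^sub>l \<Lambda>\<^sub>\<mu>\<parallel>\<^sup>2 + \<parallel>k\<^sub>l \<Lambda>\<^sub>\<nu>\<parallel>\<^sup>2 - 2 Re \<langle>E\<^sub>\<omega>(k\<^sub>l) \<Lambda>\<^sub>\<nu>, k\<^sub>l \<Lambda>\<^sub>\<nu>\<rangle>\<close>, and since \<open>E\<^sub>\<omega>\<close> and \<open>E\<^sub>\<phi>\<close> induce contractions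
  between the \<open>L\<^sup>2\<close>-spaces, \<open>I(\<chi>)\<^sup>1\<^sup>/\<^sup>2 \<le> I(\<omega>)\<^sup>1\<^sup>/\<^sup>2 + I(\<phi>)\<^sup>1\<^sup>/\<^sup>2\<close> is the triangle inequality in an enlarged Hilbert
  space.  Finally \<open>\<chi>\<close> is modular because \<open>E\<^sub>\<omega>\<close> intertwines the modular groups.\<close>

text \<open>The cost is computed in a representation taken from a choice operator. Hence a cyclic
  representation must be constructed, as a space of functions on pairs of operators, and the cost
  must be found in an arbitrary one: both marginal spaces are known there up to unitary equivalence,
  and the coupling enters only through the product of the left vector of \<open>k\<^sub>l\<close>
  with the right one. Square roots of strictly positive elements come from a fixed point argument;
  they give both the boundedness of the representation and the Cholesky step behind the Schur
  product. A bounded form on the dense subspace \<open>A' \<Lambda>\<close> that is compatible with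
  \<open>A'\<close> comes from an element of \<open>A\<close>; this is how
  \<open>E\<^sub>\<omega>\<close> arises. Of \<open>\<Delta>\<^sup>i\<^sup>t\<close> one uses that
  it is unitary with inverse \<open>\<Delta>\<^sup>-\<^sup>i\<^sup>t\<close> and fixes the vector of
  the state, the latter because the spectral measure of a fixed vector of \<open>\<Delta>\<close>
  sits at 1. This makes the dual of the modular group an explicit conjugation. As the infima are
  real, a plan between any two states is needed as well; the product state is one.\<close>

section \<open>Complex Hilbert spaces\<close>

lemma cinner_add_left: "cinner (x + y) z = cinner x z + cinner y z"
  for x :: "'g::complex_hilbert_space"
  by (metis cinner_commute cinner_add_right complex_cnj_add)

lemma cinner_scaleC_left: "cinner (c *\<^sub>C x) y = cnj c * cinner x y"
  for x :: "'g::complex_hilbert_space"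
  by (metis cinner_commute cinner_scaleC_right complex_cnj_mult)

lemma cinner_scaleR_right: "cinner x (r *\<^sub>R y) = r *\<^sub>R cinner x y"
  for x :: "'g::complex_hilbert_space"
  by (simp add: scaleR_scaleC cinner_scaleC_right scaleR_conv_of_real)

lemma cinner_scaleR_left: "cinner (r *\<^sub>R x) y = r *\<^sub>R cinner x y"
  for x :: "'g::complex_hilbert_space"
  by (simp add: scaleR_scaleC cinner_scaleC_left scaleR_conv_of_real)

lemma cinner_self: "cinner x x = complex_of_real ((norm x)\<^sup>2)"
  for x :: "'g::complex_hilbert_space"
proof -
  have "cnj (cinner x x) = cinner x x" by (metis cinner_commute)
  then have "Im (cinner x x) = 0" by (metis Reals_cnj_iff complex_is_Real_iff)
  moreover have "Re (cinner x x) = (norm x)\<^sup>2"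
    by (simp add: power2_norm_eq_inner inner_eq_Re_cinner)
  ultimately show ?thesis by (simp add: complex_eq_iff)
qed

lemma norm_scaleC: "norm (c *\<^sub>C x) = cmod c * norm x"
  for x :: "'g::complex_hilbert_space"
proof -
  have "complex_of_real ((norm (c *\<^sub>C x))\<^sup>2) = cnj c * c * cinner x x"
    unfolding cinner_self[symmetric] by (simp add: cinner_scaleC_left cinner_scaleC_right)
  also have "\<dots> = complex_of_real ((cmod c * norm x)\<^sup>2)"
    using complex_norm_square[of c] by (simp add: cinner_self power_mult_distrib)
  finally have "complex_of_real ((norm (c *\<^sub>C x))\<^sup>2) = complex_of_real ((cmod c * norm x)\<^sup>2)" .
  then have "(norm (c *\<^sub>C x))\<^sup>2 = (cmod c * norm x)\<^sup>2" using of_real_eq_iff by blast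
  then show ?thesis by (metis power2_eq_imp_eq norm_ge_zero mult_nonneg_nonneg)
qed

text \<open>Rotating \<open>y\<close> by a unimodular \<open>u\<close> that turns the product into
  its modulus reduces the bound to the Cauchy-Schwarz inequality of the underlying real inner
  product.\<close>

lemma cmod_cinner_le: "cmod (cinner x y) \<le> norm x * norm y"
  for x :: "'g::complex_hilbert_space"
proof -
  obtain u where u: "cmod u = 1" "u * cinner x y = of_real (cmod (cinner x y))"
  proof (cases "cinner x y = 0")
    case True
    then show ?thesis using that[of 1] by simp
  next
    case False
    have "cnj (cinner x y) / of_real (cmod (cinner x y)) * cinner x y = of_real (cmod (cinner x y))"
      using False complex_norm_square[of "cinner x y"]
      by (simp add: field_simps power2_eq_square)
    moreover have "cmod (cnj (cinner x y) / of_real (cmod (cinner x y))) = 1"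
      using False by (simp add: norm_divide)
    ultimately show ?thesis using that by blast
  qed
  have "cmod (cinner x y) = inner x (u *\<^sub>C y)"
    by (simp add: inner_eq_Re_cinner cinner_scaleC_right u)
  also have "\<dots> \<le> norm x * norm (u *\<^sub>C y)" by (rule norm_cauchy_schwarz)
  finally show ?thesis by (simp add: norm_scaleC u)
qed

lemma bounded_bilinear_cinner:
  "bounded_bilinear (cinner :: 'g::complex_hilbert_space \<Rightarrow> 'g \<Rightarrow> complex)"
  by standard (auto simp: cinner_add_left cinner_add_right cinner_scaleR_left cinner_scaleR_right
      intro!: exI[of _ 1] cmod_cinner_le)

lemmas tendsto_cinner = bounded_bilinear.tendsto[OF bounded_bilinear_cinner]
lemmas continuous_on_cinner = bounded_bilinear.continuous_on[OF bounded_bilinear_cinner]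
lemmas cinner_zero_left [simp] = bounded_bilinear.zero_left[OF bounded_bilinear_cinner]
lemmas cinner_zero_right [simp] = bounded_bilinear.zero_right[OF bounded_bilinear_cinner]
lemmas cinner_diff_left = bounded_bilinear.diff_left[OF bounded_bilinear_cinner]
lemmas cinner_diff_right = bounded_bilinear.diff_right[OF bounded_bilinear_cinner]
lemmas cinner_sum_left = bounded_bilinear.sum_left[OF bounded_bilinear_cinner]
lemmas cinner_sum_right = bounded_bilinear.sum_right[OF bounded_bilinear_cinner]

section \<open>Vectors determined by their products, and the Riesz representation\<close>

lemma cinner_eqI: "x = y" if "\<And>z. cinner x z = cinner y z"
  for x y :: "'g::complex_hilbert_space"
proof -
  have "cinner (x - y) (x - y) = 0" using that by (simp add: cinner_diff_left)
  then show ?thesis by (simp add: cinner_self)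
qed

lemma cinner_dense_eqI:
  fixes x y :: "'g::complex_hilbert_space"
  assumes "closure D = UNIV" and "\<And>d. d \<in> D \<Longrightarrow> cinner x d = cinner y d"
  shows "x = y"
proof (rule cinner_eqI)
  fix z
  obtain s where s: "\<forall>n. s n \<in> D" "s \<longlonglongrightarrow> z"
    using assms(1) closure_sequential[of z D] by auto
  have "(\<lambda>n. cinner x (s n)) \<longlonglongrightarrow> cinner x z" "(\<lambda>n. cinner y (s n)) \<longlonglongrightarrow> cinner y z"
    using s(2) by (auto intro: tendsto_cinner)
  then show "cinner x z = cinner y z"
    using s(1) assms(2) LIMSEQ_unique by simp
qed

lemma csubspace_scaleR: "csubspace D \<Longrightarrow> x \<in> D \<Longrightarrow> r *\<^sub>R x \<in> D"
  for x :: "'g::complex_hilbert_space"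
  by (simp add: scaleR_scaleC complex_vector.subspace_scale)


text \<open>The representing vector minimizes \<open>\<parallel>x\<parallel>\<^sup>2 - 2 Re f(x)\<close> over the closure of \<open>D\<close>.\<close>

lemma riesz_on_subspace:
  fixes f :: "'g::complex_hilbert_space \<Rightarrow> complex"
  assumes D: "csubspace D"
    and add: "\<And>x y. x \<in> D \<Longrightarrow> y \<in> D \<Longrightarrow> f (x + y) = f x + f y"
    and scale: "\<And>c x. x \<in> D \<Longrightarrow> f (c *\<^sub>C x) = c * f x"
    and bound: "\<And>x. x \<in> D \<Longrightarrow> cmod (f x) \<le> C * norm x" and "0 \<le> C"
  shows "\<exists>y\<in>closure D. norm y \<le> C \<and> (\<forall>d\<in>D. cinner y d = f d)"
proof -
  define q where "q x = (norm x)\<^sup>2 - 2 * Re (f x)" for x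
  have low: "q x \<ge> - (C\<^sup>2)" if "x \<in> D" for x
  proof -
    have "Re (f x) \<le> C * norm x" using bound[OF that] complex_Re_le_cmod[of "f x"] by linarith
    moreover have "0 \<le> (norm x - C)\<^sup>2" by simp
    ultimately show ?thesis by (simp add: q_def power2_diff algebra_simps)
  qed
  have zero: "0 \<in> D" using D by (rule complex_vector.subspace_0)
  define m where "m = Inf (q ` D)"
  have bdd: "bdd_below (q ` D)" using low by (auto simp: bdd_below_def)
  have m_le: "m \<le> q x" if "x \<in> D" for x
    unfolding m_def using bdd that by (simp add: cInf_lower)
  have "\<exists>x\<in>D. q x < m + inverse (real (Suc n))" for n
  proof -
    have "Inf (q ` D) < m + inverse (real (Suc n))" by (simp add: m_def)
    then show ?thesis using cInf_less_iff[of "q ` D"] bdd zero by blast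
  qed
  then obtain s where s: "s n \<in> D" "q (s n) < m + inverse (real (Suc n))" for n by metis
  have fR: "f (r *\<^sub>R x) = r *\<^sub>R f x" if "x \<in> D" for r x
    by (simp add: scaleR_scaleC scale that scaleR_conv_of_real)
  \<comment> \<open>The midpoint of \<open>x\<close> and \<open>y\<close> competes in the
    minimization, so the parallelogram law bounds their distance by their excess over
    \<open>m\<close>; a minimizing sequence is therefore Cauchy.\<close>
  have par: "(norm (x - y))\<^sup>2 \<le> 2 * (q x - m) + 2 * (q y - m)" if "x \<in> D" "y \<in> D" for x y
  proof -
    have xy: "x + y \<in> D" using D that by (rule complex_vector.subspace_add)
    have "m \<le> q ((1/2) *\<^sub>R (x + y))" using m_le D csubspace_scaleR xy by blast
    also have "\<dots> = (norm (x + y))\<^sup>2 / 4 - Re (f x) - Re (f y)"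
      using fR[OF xy, of "1/2"] add[OF that]
      unfolding q_def norm_scaleR by (simp add: power_divide add_divide_distrib)
    finally have "m \<le> (norm (x + y))\<^sup>2 / 4 - Re (f x) - Re (f y)" .
    moreover have "(norm (x + y))\<^sup>2 + (norm (x - y))\<^sup>2 = 2 * (norm x)\<^sup>2 + 2 * (norm y)\<^sup>2"
      by (simp add: power2_norm_eq_inner inner_add inner_diff inner_commute)
    ultimately show ?thesis by (simp add: q_def)
  qed
  have "Cauchy s"
  proof (rule CauchyI)
    fix e :: real assume e: "0 < e"
    obtain N where N: "inverse (real (Suc N)) < e\<^sup>2 / 4"
      using reals_Archimedean[of "e\<^sup>2 / 4"] e by auto
    have "norm (s i - s j) < e" if "i \<ge> N" "j \<ge> N" for i j
    proof -
      have "inverse (real (Suc i)) \<le> inverse (real (Suc N))"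
        "inverse (real (Suc j)) \<le> inverse (real (Suc N))"
        using that by (auto simp: field_simps)
      then have "(norm (s i - s j))\<^sup>2 < e\<^sup>2"
        using par[OF s(1)[of i] s(1)[of j]] s(2)[of i] s(2)[of j] N by argo
      then show ?thesis using e power2_less_imp_less by fastforce
    qed
    then show "\<exists>M. \<forall>m\<ge>M. \<forall>n\<ge>M. norm (s m - s n) < e" by blast
  qed
  then obtain y where y: "s \<longlonglongrightarrow> y" using Cauchy_convergent_iff convergent_def by blast
  have ycl: "y \<in> closure D" using y s(1) closure_sequential by blast
  have Re_eq: "Re (cinner y d) = Re (f d)" if d: "d \<in> D" for d
  proof -
    define b where "b = Re (cinner y d) - Re (f d)"
    \<comment> \<open>First variation: the competitors \<open>s n + t *\<^sub>R d\<close> give in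
      the limit a quadratic in \<open>t\<close> without constant term that is nonnegative
      everywhere.\<close>
    have ge: "0 \<le> 2 * t * b + t\<^sup>2 * (norm d)\<^sup>2" for t
    proof -
      have "m \<le> q (s n + t *\<^sub>R d)" for n
        using m_le s(1) d D by (simp add: complex_vector.subspace_add csubspace_scaleR)
      moreover have "q (s n + t *\<^sub>R d) = q (s n) + 2 * t * (inner (s n) d - Re (f d)) + t\<^sup>2 * (norm d)\<^sup>2" for n
        using add[OF s(1)[of n] csubspace_scaleR[OF D d, of t]] fR[OF d]
        unfolding q_def power2_norm_eq_inner
        by (simp add: inner_add inner_commute power2_eq_square algebra_simps)
      ultimately have "0 \<le> inverse (real (Suc n)) + 2 * t * (inner (s n) d - Re (f d)) + t\<^sup>2 * (norm d)\<^sup>2" for n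
        using s(2)[of n] by (smt (verit))
      moreover have "(\<lambda>n. inverse (real (Suc n)) + 2 * t * (inner (s n) d - Re (f d)) + t\<^sup>2 * (norm d)\<^sup>2)
          \<longlonglongrightarrow> 0 + 2 * t * (inner y d - Re (f d)) + t\<^sup>2 * (norm d)\<^sup>2"
        by (intro tendsto_intros y LIMSEQ_inverse_real_of_nat)
      ultimately have "0 \<le> 0 + 2 * t * (inner y d - Re (f d)) + t\<^sup>2 * (norm d)\<^sup>2"
        by (intro LIMSEQ_le_const) auto
      then show ?thesis by (simp add: b_def inner_eq_Re_cinner)
    qed
    have "b = 0"
    proof (rule ccontr)
      assume b: "b \<noteq> 0"
      \<comment> \<open>At \<open>t = - b / K\<close> the quadratic is at most
        \<open>- (b\<^sup>2 / K)\<close>; the summand 1 keeps \<open>K\<close> positive when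
        \<open>d = 0\<close>.\<close>
      define K where "K = (norm d)\<^sup>2 + 1"
      have K: "K > 0" by (simp add: K_def add_nonneg_pos)
      have "0 \<le> 2 * (- b / K) * b + (- b / K)\<^sup>2 * (norm d)\<^sup>2" by (rule ge)
      also have "\<dots> \<le> 2 * (- b / K) * b + (- b / K)\<^sup>2 * K"
        by (intro add_left_mono mult_left_mono) (auto simp: K_def)
      also have "\<dots> = - (b\<^sup>2 / K)" using K by (simp add: power2_eq_square field_simps)
      finally show False using b K by (simp add: divide_le_0_iff)
    qed
    then show ?thesis by (simp add: b_def)
  qed
  have eq: "cinner y d = f d" if d: "d \<in> D" for d
  proof (rule complex_eqI)
    show "Re (cinner y d) = Re (f d)" by (rule Re_eq[OF d])
    have "\<i> *\<^sub>C d \<in> D" using D d by (rule complex_vector.subspace_scale)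
    then show "Im (cinner y d) = Im (f d)"
      using Re_eq[of "\<i> *\<^sub>C d"] by (simp add: cinner_scaleC_right scale d)
  qed
  have "norm y \<le> C"
  proof -
    have "cmod (cinner y (s n)) \<le> C * norm (s n)" for n using eq bound s(1) by simp
    moreover have "(\<lambda>n. cmod (cinner y (s n))) \<longlonglongrightarrow> cmod (cinner y y)"
      "(\<lambda>n. C * norm (s n)) \<longlonglongrightarrow> C * norm y"
      by (intro tendsto_intros tendsto_cinner y)+
    ultimately have "cmod (cinner y y) \<le> C * norm y" by (intro LIMSEQ_le) auto
    then have "norm y * norm y \<le> C * norm y"
      by (simp add: cinner_self power2_eq_square norm_mult)
    then show ?thesis using \<open>0 \<le> C\<close> by (cases "norm y = 0") auto
  qed
  with ycl eq show ?thesis by blast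
qed

section \<open>Bounded complex linear operators and their adjoints\<close>

lemma bounded_clinearI:
  fixes a :: "'g::complex_hilbert_space op"
  assumes "\<And>x y. a (x + y) = a x + a y" and "\<And>c x. a (c *\<^sub>C x) = c *\<^sub>C a x"
    and "\<And>x. norm (a x) \<le> K * norm x"
  shows "bounded_clinear a"
  unfolding bounded_clinear_def
proof
  show "bounded_linear a"
    using assms by (intro bounded_linear_intro[where K = K]) (auto simp: scaleR_scaleC mult.commute)
  show "Vector_Spaces.linear scaleC scaleC a"
    using assms by unfold_locales auto
qed

lemma
  assumes "bounded_clinear a"
  shows bounded_clinear_bounded_linear: "bounded_linear a"
    and bounded_clinear_add: "a (x + y) = a x + a y"
    and bounded_clinear_scaleC: "a (c *\<^sub>C x) = c *\<^sub>C a x"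
    and bounded_clinear_zero: "a 0 = 0"
    and bounded_clinear_diff: "a (x - y) = a x - a y"
  using assms unfolding bounded_clinear_def
  by (auto simp: linear_0 linear_add linear_diff bounded_linear.linear
      vector_space_pair.linear_scale module_hom.scale Vector_Spaces.linear_def)

lemma bounded_clinear_bound:
  assumes "bounded_clinear a"
  obtains K where "K > 0" "\<And>x. norm (a x) \<le> K * norm x"
  using bounded_linear.pos_bounded[OF bounded_clinear_bounded_linear[OF assms]]
  by (metis mult.commute)

lemma bounded_clinear_tendsto:
  "bounded_clinear a \<Longrightarrow> (f \<longlongrightarrow> x) F \<Longrightarrow> ((\<lambda>n. a (f n)) \<longlongrightarrow> a x) F"
  by (rule bounded_linear.tendsto[OF bounded_clinear_bounded_linear])

lemma bounded_clinear_id: "bounded_clinear id"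
  by (rule bounded_clinearI[where K = 1]) auto

lemma bounded_clinear_comp:
  assumes "bounded_clinear a" "bounded_clinear b"
  shows "bounded_clinear (a \<circ> b)"
proof -
  obtain K where K: "K > 0" "\<And>x. norm (a x) \<le> K * norm x" using bounded_clinear_bound[OF assms(1)] by metis
  obtain L where L: "L > 0" "\<And>x. norm (b x) \<le> L * norm x" using bounded_clinear_bound[OF assms(2)] by metis
  have "norm (a (b x)) \<le> K * L * norm x" for x
    using K(2)[of "b x"] mult_left_mono[OF L(2)[of x] less_imp_le[OF K(1)]]
    unfolding mult.assoc by linarith
  then show ?thesis
    by (intro bounded_clinearI[where K = "K * L"])
      (use assms in \<open>auto simp: bounded_clinear_add bounded_clinear_scaleC\<close>)
qed

lemma bounded_clinear_plus:
  assumes "bounded_clinear a" "bounded_clinear b"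
  shows "bounded_clinear (a + b)"
proof -
  obtain K where K: "K > 0" "\<And>x. norm (a x) \<le> K * norm x" using bounded_clinear_bound[OF assms(1)] by metis
  obtain L where L: "L > 0" "\<And>x. norm (b x) \<le> L * norm x" using bounded_clinear_bound[OF assms(2)] by metis
  have "norm (a x + b x) \<le> (K + L) * norm x" for x
    using norm_triangle_ineq[of "a x" "b x"] K(2)[of x] L(2)[of x] by (simp add: distrib_right)
  then show ?thesis
    by (intro bounded_clinearI[where K = "K + L"])
      (use assms in \<open>auto simp: bounded_clinear_add bounded_clinear_scaleC scaleC_add_right\<close>)
qed

lemma bounded_clinear_scale:
  assumes "bounded_clinear a"
  shows "bounded_clinear (c *\<^sub>C a)"
proof -
  obtain K where K: "K > 0" "\<And>x. norm (a x) \<le> K * norm x" using bounded_clinear_bound[OF assms] by metis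
  have "cmod c * norm (a x) \<le> cmod c * K * norm x" for x
    using mult_left_mono[OF K(2)[of x], of "cmod c"] by (simp add: mult.assoc)
  then show ?thesis
    by (intro bounded_clinearI[where K = "cmod c * K"])
      (use assms in \<open>auto simp: bounded_clinear_add bounded_clinear_scaleC scaleC_add_right
          scaleC_scaleC scaleC_fun_def norm_scaleC mult.commute\<close>)
qed

text \<open>\<open>cadjoint\<close> is a definite description, so an adjoint has to be produced
  first. Riesz supplies, for each \<open>y\<close>, the vector that represents
  \<open>x \<mapsto> cinner y (a x)\<close>, with a bound proportional to
  \<open>norm y\<close>.\<close>

lemma cadjoint_exists:
  fixes a :: "'g::complex_hilbert_space op"
  assumes a: "bounded_clinear a"
  obtains b where "bounded_clinear b" "\<And>x y. cinner (a x) y = cinner x (b y)"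
proof -
  obtain K where K: "K > 0" "\<And>x. norm (a x) \<le> K * norm x" using bounded_clinear_bound[OF a] by metis
  have "\<exists>z. norm z \<le> K * norm y \<and> (\<forall>x. cinner z x = cinner y (a x))" for y
  proof -
    have "cmod (cinner y (a x)) \<le> K * norm y * norm x" for x
    proof -
      have "cmod (cinner y (a x)) \<le> norm y * norm (a x)" by (rule cmod_cinner_le)
      also have "\<dots> \<le> norm y * (K * norm x)" by (intro mult_left_mono K) simp
      finally show ?thesis by (simp add: mult_ac)
    qed
    then have "\<exists>z\<in>closure UNIV. norm z \<le> K * norm y \<and> (\<forall>x\<in>UNIV. cinner z x = cinner y (a x))"
      using K(1) by (intro riesz_on_subspace)
        (auto simp: bounded_clinear_add[OF a] bounded_clinear_scaleC[OF a] cinner_add_right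
          cinner_scaleC_right complex_vector.subspace_UNIV)
    then show ?thesis by simp
  qed
  then obtain b where b: "norm (b y) \<le> K * norm y" "cinner (b y) x = cinner y (a x)" for x y
    using choice[of "\<lambda>y z. norm z \<le> K * norm y \<and> (\<forall>x. cinner z x = cinner y (a x))"] by blast
  have "bounded_clinear b"
  proof (rule bounded_clinearI[where K = K])
    show "b (x + y) = b x + b y" for x y
      by (rule cinner_eqI) (simp add: b(2) cinner_add_left)
    show "b (c *\<^sub>C x) = c *\<^sub>C b x" for c x
      by (rule cinner_eqI) (simp add: b(2) cinner_scaleC_left)
  qed (rule b(1))
  moreover have "cinner (a x) y = cinner x (b y)" for x y
    using b(2)[of y x] by (metis cinner_commute)
  ultimately show ?thesis using that by blast
qed

lemma cadjoint_unique:
  fixes a :: "'g::complex_hilbert_space op"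
  assumes "\<And>x y. cinner (a x) y = cinner x (b y)"
  shows "cadjoint a = b"
  unfolding cadjoint_def
proof (rule the_equality)
  show "\<forall>x y. cinner (a x) y = cinner x (b y)" using assms by blast
  fix b' assume "\<forall>x y. cinner (a x) y = cinner x (b' y)"
  then have "cinner (b' y) x = cinner (b y) x" for x y
    using assms by (metis cinner_commute)
  then show "b' = b" by (intro ext cinner_eqI)
qed

lemma
  assumes "bounded_clinear a"
  shows cadjoint_right: "cinner (a x) y = cinner x (cadjoint a y)"
    and bounded_clinear_cadjoint: "bounded_clinear (cadjoint a)"
  using cadjoint_exists[OF assms] cadjoint_unique by metis+

lemma cadjoint_left: "bounded_clinear a \<Longrightarrow> cinner (cadjoint a x) y = cinner x (a y)"
  by (metis cinner_commute cadjoint_right)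

lemma cadjoint_cadjoint: "bounded_clinear a \<Longrightarrow> cadjoint (cadjoint a) = a"
  by (rule cadjoint_unique) (simp add: cadjoint_left)

lemma cadjoint_id [simp]: "cadjoint id = id"
  by (rule cadjoint_unique) simp

lemma cadjoint_comp:
  "bounded_clinear a \<Longrightarrow> bounded_clinear b \<Longrightarrow> cadjoint (a \<circ> b) = cadjoint b \<circ> cadjoint a"
  by (rule cadjoint_unique) (simp add: cadjoint_right)

lemma cadjoint_plus:
  "bounded_clinear a \<Longrightarrow> bounded_clinear b \<Longrightarrow> cadjoint (a + b) = cadjoint a + cadjoint b"
  by (rule cadjoint_unique) (simp add: cadjoint_right cinner_add_left cinner_add_right)

lemma cadjoint_scaleC:
  "bounded_clinear a \<Longrightarrow> cadjoint (c *\<^sub>C a) = cnj c *\<^sub>C cadjoint a"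
  by (rule cadjoint_unique)
    (simp add: scaleC_fun_def cadjoint_right cinner_scaleC_left cinner_scaleC_right)

section \<open>Von Neumann algebras\<close>

lemma vna_bounded_clinear: "von_neumann_algebra A \<Longrightarrow> a \<in> A \<Longrightarrow> bounded_clinear a"
  by (simp add: von_neumann_algebra_def)

lemma vna_cadjoint: "von_neumann_algebra A \<Longrightarrow> a \<in> A \<Longrightarrow> cadjoint a \<in> A"
  by (simp add: von_neumann_algebra_def)

lemma vna_bicommutant: "von_neumann_algebra A \<Longrightarrow> commutant (commutant A) = A"
  by (simp add: von_neumann_algebra_def)

lemma commutant_commute: "a \<in> A \<Longrightarrow> b \<in> commutant A \<Longrightarrow> a (b x) = b (a x)"
  by (auto simp: commutant_def fun_eq_iff)

lemma commutantI:
  "bounded_clinear b \<Longrightarrow> (\<And>a x. a \<in> A \<Longrightarrow> a (b x) = b (a x)) \<Longrightarrow> b \<in> commutant A"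
  by (auto simp: commutant_def fun_eq_iff)

lemma commutant_bounded_clinear: "b \<in> commutant A \<Longrightarrow> bounded_clinear b"
  by (simp add: commutant_def)

lemma von_neumann_algebra_commutant:
  assumes "von_neumann_algebra A"
  shows "von_neumann_algebra (commutant A)"
proof -
  have "cadjoint b \<in> commutant A" if b: "b \<in> commutant A" for b
  proof (rule commutantI)
    show bc: "bounded_clinear (cadjoint b)"
      using b by (simp add: bounded_clinear_cadjoint commutant_bounded_clinear)
    fix a x assume a: "a \<in> A"
    have "cinner (a (cadjoint b x)) z = cinner (cadjoint b (a x)) z" for z
      using commutant_commute[OF vna_cadjoint[OF assms a] b] a b assms
      by (simp add: cadjoint_right[OF vna_bounded_clinear[OF assms]] cadjoint_left
          commutant_bounded_clinear)
    then show "a (cadjoint b x) = cadjoint b (a x)" by (rule cinner_eqI)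
  qed
  then show ?thesis
    using assms by (simp add: von_neumann_algebra_def commutant_bounded_clinear)
qed

text \<open>Membership is tested in the bicommutant, where it is a commutation relation. This is how
  an algebra specified by adjoints and \<open>commutant (commutant A) = A\<close> acquires its
  algebraic operations.\<close>

lemma
  assumes "von_neumann_algebra A"
  shows vna_id: "id \<in> A"
    and vna_plus: "a \<in> A \<Longrightarrow> b \<in> A \<Longrightarrow> a + b \<in> A"
    and vna_comp: "a \<in> A \<Longrightarrow> b \<in> A \<Longrightarrow> a \<circ> b \<in> A"
    and vna_scaleC: "a \<in> A \<Longrightarrow> c *\<^sub>C a \<in> A"
proof -
  let ?C = "commutant (commutant A)"
  have C: "?C = A" by (rule vna_bicommutant[OF assms])
  note bc = commutant_bounded_clinear and comm = commutant_commute[of _ "commutant A"]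
  have "id \<in> ?C" by (rule commutantI) (simp_all add: bounded_clinear_id)
  then show "id \<in> A" by (simp add: C)
  show "a + b \<in> A" if "a \<in> A" "b \<in> A"
  proof -
    have "a + b \<in> ?C" if "a \<in> ?C" "b \<in> ?C"
    proof (rule commutantI)
      show "bounded_clinear (a + b)" using that by (intro bounded_clinear_plus bc)
      show "c ((a + b) x) = (a + b) (c x)" if "c \<in> commutant A" for c x
        using that comm[OF that] \<open>a \<in> ?C\<close> \<open>b \<in> ?C\<close> by (simp add: bounded_clinear_add[OF bc])
    qed
    with that show ?thesis by (simp add: C)
  qed
  show "a \<circ> b \<in> A" if "a \<in> A" "b \<in> A"
  proof -
    have "a \<circ> b \<in> ?C" if "a \<in> ?C" "b \<in> ?C"
    proof (rule commutantI)
      show "bounded_clinear (a \<circ> b)" using that by (intro bounded_clinear_comp bc)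
      show "c ((a \<circ> b) x) = (a \<circ> b) (c x)" if "c \<in> commutant A" for c x
        using comm[OF that \<open>a \<in> ?C\<close>, of "b x"] comm[OF that \<open>b \<in> ?C\<close>, of x] by simp
    qed
    with that show ?thesis by (simp add: C)
  qed
  show "c *\<^sub>C a \<in> A" if "a \<in> A"
  proof -
    have "c *\<^sub>C a \<in> ?C" if "a \<in> ?C"
    proof (rule commutantI)
      show "bounded_clinear (c *\<^sub>C a)" using that by (intro bounded_clinear_scale bc)
      show "b ((c *\<^sub>C a) x) = (c *\<^sub>C a) (b x)" if b: "b \<in> commutant A" for b x
        using comm[OF b \<open>a \<in> ?C\<close>, of x] by (simp add: scaleC_fun_def bounded_clinear_scaleC[OF bc[OF b]])
    qed
    with that show ?thesis by (simp add: C)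
  qed
qed

lemma vna_minus: "von_neumann_algebra A \<Longrightarrow> a \<in> A \<Longrightarrow> b \<in> A \<Longrightarrow> a - b \<in> A"
proof -
  assume A: "von_neumann_algebra A" "a \<in> A" "b \<in> A"
  have "a - b = a + (- 1) *\<^sub>C b"
    by (simp add: fun_eq_iff scaleC_fun_def scaleC_one)
  then show "a - b \<in> A" using A vna_plus vna_scaleC by metis
qed

section \<open>Semi-inner products\<close>

text \<open>The axioms are relative to a carrier and do not ask for definiteness, so that they cover
  the form of a positive operator, the finitely supported functions under a kernel, their
  completion, and the space of an arbitrary representation.\<close>

locale semi_inner =
  fixes V :: "'a::complex_vector set" and ip :: "'a \<Rightarrow> 'a \<Rightarrow> complex"
  assumes V: "csubspace V"
    and ip_add_right: "x \<in> V \<Longrightarrow> y \<in> V \<Longrightarrow> z \<in> V \<Longrightarrow> ip x (y + z) = ip x y + ip x z"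
    and ip_scaleC_right: "x \<in> V \<Longrightarrow> y \<in> V \<Longrightarrow> ip x (c *\<^sub>C y) = c * ip x y"
    and ip_commute: "x \<in> V \<Longrightarrow> y \<in> V \<Longrightarrow> ip y x = cnj (ip x y)"
    and ip_nonneg: "x \<in> V \<Longrightarrow> ip x x \<in> \<real>\<^sub>\<ge>\<^sub>0"
begin

definition nrm :: "'a \<Rightarrow> real" where "nrm x = sqrt (Re (ip x x))"

lemma V_closed [simp, intro]:
  "0 \<in> V" "x \<in> V \<Longrightarrow> y \<in> V \<Longrightarrow> x + y \<in> V" "x \<in> V \<Longrightarrow> c *\<^sub>C x \<in> V" 
  "x \<in> V \<Longrightarrow> y \<in> V \<Longrightarrow> x - y \<in> V" "x \<in> V \<Longrightarrow> - x \<in> V"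
  using V by (auto simp: complex_vector.subspace_0 complex_vector.subspace_add
      complex_vector.subspace_scale complex_vector.subspace_diff complex_vector.subspace_neg)

lemma ip_add_left: "x \<in> V \<Longrightarrow> y \<in> V \<Longrightarrow> z \<in> V \<Longrightarrow> ip (x + y) z = ip x z + ip y z"
  using ip_commute[of z "x + y"] ip_commute[of z x] ip_commute[of z y] ip_add_right[of z x y] by simp

lemma ip_scaleC_left: "x \<in> V \<Longrightarrow> y \<in> V \<Longrightarrow> ip (c *\<^sub>C x) y = cnj c * ip x y"
  using ip_commute[of y "c *\<^sub>C x"] ip_commute[of y x] ip_scaleC_right[of y x c] by simp

lemma ip_diff_right: "x \<in> V \<Longrightarrow> y \<in> V \<Longrightarrow> z \<in> V \<Longrightarrow> ip x (y - z) = ip x y - ip x z"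
  using ip_add_right[of x "y - z" z] by simp

lemma ip_diff_left: "x \<in> V \<Longrightarrow> y \<in> V \<Longrightarrow> z \<in> V \<Longrightarrow> ip (x - y) z = ip x z - ip y z"
  using ip_add_left[of "x - y" y z] by simp

lemma ip_zero_right: "x \<in> V \<Longrightarrow> ip x 0 = 0"
  using ip_diff_right[of x 0 0] by simp

lemma ip_zero_left: "x \<in> V \<Longrightarrow> ip 0 x = 0"
  using ip_diff_left[of 0 0 x] by simp

lemma V_sum [intro]: "(\<And>i. i \<in> I \<Longrightarrow> f i \<in> V) \<Longrightarrow> sum f I \<in> V"
  by (rule complex_vector.subspace_sum[OF V])

lemma ip_sum_left:
  "(\<And>i. i \<in> I \<Longrightarrow> f i \<in> V) \<Longrightarrow> y \<in> V \<Longrightarrow> ip (sum f I) y = (\<Sum>i\<in>I. ip (f i) y)"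
proof (induction I rule: infinite_finite_induct)
  case (insert i I)
  then have "sum f I \<in> V" by auto
  with insert show ?case by (simp add: ip_add_left)
qed (simp_all add: ip_zero_left)

lemma ip_sum_right:
  "(\<And>i. i \<in> I \<Longrightarrow> f i \<in> V) \<Longrightarrow> y \<in> V \<Longrightarrow> ip y (sum f I) = (\<Sum>i\<in>I. ip y (f i))"
proof (induction I rule: infinite_finite_induct)
  case (insert i I)
  then have "sum f I \<in> V" by auto
  with insert show ?case by (simp add: ip_add_right)
qed (simp_all add: ip_zero_right)

lemma Re_ip_nonneg: "x \<in> V \<Longrightarrow> 0 \<le> Re (ip x x)"
  using ip_nonneg[of x] by (simp add: complex_nonneg_Reals_iff)

lemma ip_self: "x \<in> V \<Longrightarrow> ip x x = complex_of_real ((nrm x)\<^sup>2)"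
  using ip_nonneg[of x] by (simp add: nrm_def complex_nonneg_Reals_iff complex_eq_iff)

lemma nrm_nonneg [simp]: "x \<in> V \<Longrightarrow> 0 \<le> nrm x"
  by (simp add: nrm_def Re_ip_nonneg)

lemma nrm_power2: "x \<in> V \<Longrightarrow> (nrm x)\<^sup>2 = Re (ip x x)"
  by (simp add: ip_self)

text \<open>The coefficient \<open>c\<close> makes \<open>c * ip x y\<close> the real number
  \<open>- t * b\<close>, which leaves a real quadratic in \<open>t\<close>. As the form may be
  degenerate, \<open>nrm y = 0\<close> does not give \<open>y = 0\<close>; there the quadratic is
  affine in \<open>t\<close>, and this forces \<open>b = 0\<close>.\<close>

lemma cauchy_schwarz:
  assumes x: "x \<in> V" and y: "y \<in> V"
  shows "cmod (ip x y) \<le> nrm x * nrm y"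
proof -
  define b where "b = (cmod (ip x y))\<^sup>2"
  have ge: "0 \<le> (nrm x)\<^sup>2 - 2 * t * b + t\<^sup>2 * b * (nrm y)\<^sup>2" for t :: real
  proof -
    define c where "c = - (complex_of_real t * cnj (ip x y))"
    have "ip (x + c *\<^sub>C y) (x + c *\<^sub>C y) =
        ip x x + c * ip x y + cnj (c * ip x y) + cnj c * c * ip y y"
      using x y by (simp add: ip_add_left ip_add_right ip_scaleC_left ip_scaleC_right
          ip_commute[of x y] algebra_simps)
    moreover have "c * ip x y = - complex_of_real (t * b)"
      using complex_norm_square[of "ip x y"] by (simp add: c_def b_def mult_ac)
    moreover have "cnj c * c = complex_of_real (t\<^sup>2 * b)"
      using complex_norm_square[of "ip x y"] by (simp add: c_def b_def mult_ac power2_eq_square)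
    ultimately have "Re (ip (x + c *\<^sub>C y) (x + c *\<^sub>C y)) = (nrm x)\<^sup>2 - 2 * t * b + t\<^sup>2 * b * (nrm y)\<^sup>2"
      using x y by (simp add: ip_self flip: of_real_power)
    moreover have "0 \<le> Re (ip (x + c *\<^sub>C y) (x + c *\<^sub>C y))" using x y by (intro Re_ip_nonneg) auto
    ultimately show ?thesis by simp
  qed
  have "b \<le> (nrm x * nrm y)\<^sup>2"
  proof (cases "nrm y = 0")
    case True
    have "b = 0"
    proof (rule ccontr)
      assume "b \<noteq> 0"
      then have "b > 0" by (simp add: b_def)
      have "0 \<le> (nrm x)\<^sup>2 - 2 * (((nrm x)\<^sup>2 + 1) / (2 * b)) * b"
        using ge[of "((nrm x)\<^sup>2 + 1) / (2 * b)"] True by simp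
      with \<open>b > 0\<close> show False by (simp add: field_simps)
    qed
    then show ?thesis by simp
  next
    case False
    then have pos: "(nrm y)\<^sup>2 > 0" by simp
    have "0 \<le> (nrm x)\<^sup>2 - 2 * (1 / (nrm y)\<^sup>2) * b + (1 / (nrm y)\<^sup>2)\<^sup>2 * b * (nrm y)\<^sup>2" by (rule ge)
    also have "\<dots> = (nrm x)\<^sup>2 - b / (nrm y)\<^sup>2"
      using False by (simp add: power2_eq_square field_simps)
    finally show ?thesis using pos by (simp add: field_simps power_mult_distrib)
  qed
  then show ?thesis
    using x y unfolding b_def by (meson power2_le_imp_le mult_nonneg_nonneg nrm_nonneg)
qed

lemma nrm_triangle: "x \<in> V \<Longrightarrow> y \<in> V \<Longrightarrow> nrm (x + y) \<le> nrm x + nrm y"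
proof (rule power2_le_imp_le)
  assume xy: "x \<in> V" "y \<in> V"
  have "Re (ip (x + y) (x + y)) = Re (ip x x) + Re (ip y y) + 2 * Re (ip x y)"
    using xy ip_commute[of x y] by (simp add: ip_add_left ip_add_right)
  also have "\<dots> = (nrm x)\<^sup>2 + (nrm y)\<^sup>2 + 2 * Re (ip x y)"
    using xy by (simp add: nrm_power2)
  also have "\<dots> \<le> (nrm x)\<^sup>2 + (nrm y)\<^sup>2 + 2 * (nrm x * nrm y)"
    using cauchy_schwarz[OF xy] complex_Re_le_cmod[of "ip x y"] by simp
  finally show "(nrm (x + y))\<^sup>2 \<le> (nrm x + nrm y)\<^sup>2"
    using xy by (simp add: nrm_power2[of "x + y"] power2_sum algebra_simps)
qed auto

lemma nrm_minus_commute: "x \<in> V \<Longrightarrow> y \<in> V \<Longrightarrow> nrm (x - y) = nrm (y - x)"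
  by (simp add: nrm_def ip_diff_left ip_diff_right algebra_simps)

lemma nrm_triangle3: "x \<in> V \<Longrightarrow> y \<in> V \<Longrightarrow> z \<in> V \<Longrightarrow> nrm (x - z) \<le> nrm (x - y) + nrm (y - z)"
  using nrm_triangle[of "x - y" "y - z"] by simp

lemma nrm_le_diff: "x \<in> V \<Longrightarrow> y \<in> V \<Longrightarrow> nrm x \<le> nrm (x - y) + nrm y"
  using nrm_triangle[of "x - y" y] by simp

lemma nrm_scaleC: "x \<in> V \<Longrightarrow> nrm (c *\<^sub>C x) = cmod c * nrm x"
proof -
  assume x: "x \<in> V"
  have "ip (c *\<^sub>C x) (c *\<^sub>C x) = (c * cnj c) * ip x x"
    using x by (simp add: ip_scaleC_left ip_scaleC_right)
  also have "\<dots> = complex_of_real ((cmod c * nrm x)\<^sup>2)"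
    using x by (simp add: complex_norm_square[symmetric] ip_self power_mult_distrib)
  finally have "ip (c *\<^sub>C x) (c *\<^sub>C x) = complex_of_real ((cmod c * nrm x)\<^sup>2)" .
  then show ?thesis using x by (simp only: nrm_def[of "c *\<^sub>C x"]) simp
qed

lemma tendsto_nrm:
  assumes X: "\<And>n. X n \<in> V" and x: "x \<in> V" and lim: "(\<lambda>n::nat. nrm (X n - x)) \<longlonglongrightarrow> 0"
  shows "(\<lambda>n. nrm (X n)) \<longlonglongrightarrow> nrm x"
proof (rule Lim_null_comparison[where g = "\<lambda>n. nrm (X n - x)", THEN LIM_zero_cancel])
  have "\<bar>nrm (X n) - nrm x\<bar> \<le> nrm (X n - x)" for n
    using nrm_le_diff[OF X[of n] x] nrm_le_diff[OF x X[of n]] nrm_minus_commute[OF X[of n] x] by linarith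
  then show "\<forall>\<^sub>F n in sequentially. norm (nrm (X n) - nrm x) \<le> nrm (X n - x)" by simp
qed (rule lim)

lemma tendsto_ip:
  assumes X: "\<And>n. X n \<in> V" "x \<in> V" "(\<lambda>n::nat. nrm (X n - x)) \<longlonglongrightarrow> 0"
    and Y: "\<And>n. Y n \<in> V" "y \<in> V" "(\<lambda>n. nrm (Y n - y)) \<longlonglongrightarrow> 0"
  shows "(\<lambda>n. ip (X n) (Y n)) \<longlonglongrightarrow> ip x y"
proof (rule Lim_null_comparison[where g = "\<lambda>n. nrm (X n - x) * nrm (Y n) + nrm x * nrm (Y n - y)",
      THEN LIM_zero_cancel])
  have "norm (ip (X n) (Y n) - ip x y) \<le> nrm (X n - x) * nrm (Y n) + nrm x * nrm (Y n - y)" for n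
  proof -
    have "ip (X n) (Y n) - ip x y = ip (X n - x) (Y n) + ip x (Y n - y)"
      using X(1,2) Y(1,2) by (simp add: ip_diff_left ip_diff_right)
    then show ?thesis
      using norm_triangle_ineq[of "ip (X n - x) (Y n)" "ip x (Y n - y)"] X(1,2) Y(1,2)
        cauchy_schwarz[of "X n - x" "Y n"] cauchy_schwarz[of x "Y n - y"] by (smt (verit) V_closed(4))
  qed
  then show "\<forall>\<^sub>F n in sequentially. norm (ip (X n) (Y n) - ip x y)
      \<le> nrm (X n - x) * nrm (Y n) + nrm x * nrm (Y n - y)" by simp
  have "(\<lambda>n. nrm (X n - x) * nrm (Y n) + nrm x * nrm (Y n - y)) \<longlonglongrightarrow> 0 * nrm y + nrm x * 0"
    by (intro tendsto_intros X Y tendsto_nrm)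
  then show "(\<lambda>n. nrm (X n - x) * nrm (Y n) + nrm x * nrm (Y n - y)) \<longlonglongrightarrow> 0" by simp
qed

end

section \<open>Square roots in von Neumann algebras\<close>

instance complex_hilbert_space \<subseteq> banach ..

text \<open>An algebra is cut out by complex homogeneity and commutation relations, both closed
  conditions at each vector. Closedness allows Banach's fixed point theorem to be applied inside the
  algebra.\<close>

lemma closed_blinfun_vna:
  fixes M :: "'g::complex_hilbert_space op set"
  assumes "von_neumann_algebra M"
  shows "closed {f :: 'g \<Rightarrow>\<^sub>L 'g. blinfun_apply f \<in> M}"
proof -
  have "blinfun_apply f \<in> M \<longleftrightarrow>
      (\<forall>c x. f (c *\<^sub>C x) = c *\<^sub>C f x) \<and> (\<forall>b\<in>commutant M. \<forall>x. b (f x) = f (b x))" for f :: "'g \<Rightarrow>\<^sub>L 'g"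
  proof -
    have "bounded_clinear (blinfun_apply f) \<longleftrightarrow> (\<forall>c x. f (c *\<^sub>C x) = c *\<^sub>C f x)"
      by (auto intro!: bounded_clinearI[where K = "norm f"]
          simp: bounded_clinear_scaleC norm_blinfun blinfun.add_right)
    then show ?thesis
      by (subst vna_bicommutant[OF assms, symmetric]) (auto simp: commutant_def[of "commutant M"] fun_eq_iff)
  qed
  moreover have "closed {f :: 'g \<Rightarrow>\<^sub>L 'g. (\<forall>c x. f (c *\<^sub>C x) = c *\<^sub>C f x) \<and>
      (\<forall>b\<in>commutant M. \<forall>x. b (f x) = f (b x))}"
    unfolding Collect_conj_eq Collect_ball_eq Collect_all_eq
  proof (intro closed_Int closed_INT ballI)
    show "closed {f :: 'g \<Rightarrow>\<^sub>L 'g. f (c *\<^sub>C x) = c *\<^sub>C f x}" for c x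
    proof (rule closed_Collect_eq)
      have "bounded_linear (\<lambda>y::'g. c *\<^sub>C y)"
      proof (rule bounded_linear_intro)
        show "c *\<^sub>C (r *\<^sub>R y) = r *\<^sub>R (c *\<^sub>C y)" for r and y :: 'g
          unfolding scaleR_scaleC scaleC_scaleC by (simp only: mult.commute)
        show "norm (c *\<^sub>C y) \<le> norm y * cmod c" for y :: 'g by (simp add: norm_scaleC)
      qed (rule complex_vector.scale_right_distrib)
      then show "continuous_on UNIV (\<lambda>f :: 'g \<Rightarrow>\<^sub>L 'g. c *\<^sub>C f x)"
        by (rule bounded_linear.continuous_on) (intro continuous_intros)
    qed (intro continuous_intros)
    show "closed {f :: 'g \<Rightarrow>\<^sub>L 'g. b (f x) = f (b x)}" if "b \<in> commutant M" for b x
    proof (rule closed_Collect_eq)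
      have "bounded_linear b"
        using that by (intro bounded_clinear_bounded_linear commutant_bounded_clinear)
      then show "continuous_on UNIV (\<lambda>f :: 'g \<Rightarrow>\<^sub>L 'g. b (f x))"
        by (rule bounded_linear.continuous_on) (intro continuous_intros)
    qed (intro continuous_intros)
  qed
  ultimately show ?thesis by simp
qed

lemma blinfun_vna:
  assumes "von_neumann_algebra M" "a \<in> M"
  shows "blinfun_apply (Blinfun a) = a"
  using assms by (simp add: bounded_linear_Blinfun_apply bounded_clinear_bounded_linear vna_bounded_clinear)

text \<open>For \<open>0 \<le> h \<le> r < 1\<close>, a root of \<open>1 - h\<close> is \<open>1 - y\<close>, where \<open>y\<close> is the fixed point of the
  contraction \<open>y \<mapsto> (h + y\<^sup>2) / 2\<close> of the ball of radius \<open>r\<close>.\<close>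

lemma vna_sqrt_aux:
  fixes M :: "'g::complex_hilbert_space op set"
  assumes M: "von_neumann_algebra M" and h: "h \<in> M"
    and sa: "\<And>x y. cinner (h x) y = cinner x (h y)"
    and r: "0 \<le> r" "r < 1" and bound: "\<And>x. norm (h x) \<le> r * norm x"
  obtains c d where "c \<in> M" "d \<in> M" "cadjoint c = c" "c \<circ> c = id - h" "c \<circ> d = id"
proof -
  define H where "H = Blinfun h"
  have H: "blinfun_apply H = h" unfolding H_def by (rule blinfun_vna[OF M h])
  have nH: "norm H \<le> r" using r bound by (intro norm_blinfun_bound) (auto simp: H)
  let ?T = "{f :: 'g \<Rightarrow>\<^sub>L 'g. blinfun_apply f \<in> M}"
  \<comment> \<open>Self-adjointness is part of the complete set, so that the fixed point inherits
    it.\<close>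
  define S where "S = ?T \<inter> cball 0 r \<inter> {f :: 'g \<Rightarrow>\<^sub>L 'g. \<forall>x y. cinner (f x) y = cinner x (f y)}"
  have "closed {f :: 'g \<Rightarrow>\<^sub>L 'g. cinner (f x) y = cinner x (f y)}" for x y
    by (intro closed_Collect_eq continuous_on_cinner continuous_intros)
  then have "closed S"
    unfolding S_def by (intro closed_Int closed_blinfun_vna[OF M] closed_cball closed_Collect_all)
  then have S: "complete S" by (simp add: complete_eq_closed)
  define F where "F f = (1/2) *\<^sub>R (H + (f o\<^sub>L f))" for f
  have F_apply: "blinfun_apply (F f) = complex_of_real (1/2) *\<^sub>C (h + (blinfun_apply f \<circ> blinfun_apply f))" for f
    by (simp add: F_def fun_eq_iff blinfun.scaleR_left blinfun.add_left H scaleC_fun_def scaleR_scaleC)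
  have "\<exists>!f\<in>S. F f = f"
  proof (rule Banach_fix[OF S _ r])
    have "0 \<in> M" using vna_scaleC[OF M vna_id[OF M], of 0] by (simp add: zero_fun_def)
    then have "0 \<in> S" using r by (simp add: S_def zero_fun_def zero_blinfun.rep_eq)
    then show "S \<noteq> {}" by blast
    show "F ` S \<subseteq> S"
    proof safe
      fix f assume f: "f \<in> S"
      then have fM: "blinfun_apply f \<in> M" and fr: "norm f \<le> r"
        and fs: "\<And>x y. cinner (f x) y = cinner x (f y)" by (auto simp: S_def)
      have "norm (F f) \<le> (1/2) * (norm H + norm f * norm f)"
        unfolding F_def norm_scaleR
        using norm_triangle_ineq[of H "f o\<^sub>L f"] norm_blinfun_compose[of f f] by simp
      also have "\<dots> \<le> (1/2) * (r + r * 1)"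
        using nH fr r by (intro mult_left_mono add_mono mult_mono) auto
      finally have "norm (F f) \<le> r" by simp
      moreover have "blinfun_apply (F f) \<in> M"
        unfolding F_apply using M h fM by (intro vna_scaleC vna_plus vna_comp)
      moreover have "cinner (F f x) y = cinner x (F f y)" for x y
        by (simp add: F_def blinfun.scaleR_left blinfun.add_left H cinner_scaleR_left
            cinner_scaleR_right cinner_add_left cinner_add_right sa fs)
      ultimately show "F f \<in> S" by (simp add: S_def)
    qed
    show "dist (F f) (F g) \<le> r * dist f g" if "f \<in> S" "g \<in> S" for f g
    proof -
      have fg: "norm f \<le> r" "norm g \<le> r" using that by (auto simp: S_def)
      have "F f - F g = (1/2) *\<^sub>R ((f o\<^sub>L (f - g)) + ((f - g) o\<^sub>L g))"
        by (rule blinfun_eqI) (simp add: F_def blinfun.bilinear_simps algebra_simps)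
      also have "norm \<dots> \<le> (1/2) * (norm f * norm (f - g) + norm (f - g) * norm g)"
        unfolding norm_scaleR
        using norm_triangle_ineq[of "f o\<^sub>L (f - g)" "(f - g) o\<^sub>L g"] norm_blinfun_compose[of f "f - g"]
          norm_blinfun_compose[of "f - g" g] by simp
      also have "\<dots> \<le> (1/2) * (r * norm (f - g) + norm (f - g) * r)"
        using fg by (intro mult_left_mono add_mono mult_right_mono) auto
      finally show ?thesis by (simp add: dist_norm)
    qed
  qed
  then obtain y where "y \<in> S" and Fy: "F y = y" by blast
  then have yM: "blinfun_apply y \<in> M" and yr: "norm y \<le> r"
    and ysa: "\<And>u v. cinner (y u) v = cinner u (y v)" by (auto simp: S_def)
  \<comment> \<open>The equation of the Neumann series: its solution is a right inverse of
    \<open>1 - y\<close>.\<close>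
  have "\<exists>!g\<in>?T. id_blinfun + (y o\<^sub>L g) = g"
  proof (rule Banach_fix[OF _ _ r])
    show "complete ?T" by (simp add: complete_eq_closed closed_blinfun_vna[OF M])
    show "?T \<noteq> {}" using yM by blast
    show "(\<lambda>g. id_blinfun + (y o\<^sub>L g)) ` ?T \<subseteq> ?T"
    proof safe
      fix g :: "'g \<Rightarrow>\<^sub>L 'g" assume "blinfun_apply g \<in> M"
      moreover have "blinfun_apply (id_blinfun + (y o\<^sub>L g)) = id + (blinfun_apply y \<circ> blinfun_apply g)"
        by (simp add: fun_eq_iff blinfun.add_left)
      ultimately show "blinfun_apply (id_blinfun + (y o\<^sub>L g)) \<in> M"
        using M yM by (simp add: vna_plus vna_comp vna_id)
    qed
    show "dist (id_blinfun + (y o\<^sub>L f)) (id_blinfun + (y o\<^sub>L g)) \<le> r * dist f g" for f g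
    proof -
      have "(id_blinfun + (y o\<^sub>L f)) - (id_blinfun + (y o\<^sub>L g)) = y o\<^sub>L (f - g)"
        by (rule blinfun_eqI) (simp add: blinfun.bilinear_simps)
      then show ?thesis
        using norm_blinfun_compose[of y "f - g"] mult_right_mono[OF yr, of "norm (f - g)"]
        by (simp add: dist_norm)
    qed
  qed
  then obtain g where gM: "blinfun_apply g \<in> M" and g: "id_blinfun + (y o\<^sub>L g) = g" by blast
  have g': "y (g x) = g x - x" for x
    using arg_cong[OF g, of "\<lambda>f. blinfun_apply f x"] by (simp add: blinfun.add_left algebra_simps)
  have y': "y (y x) = 2 *\<^sub>R y x - h x" for x
  proof -
    have "(1/2) *\<^sub>R (h x + y (y x)) = y x"
      using arg_cong[OF Fy, of "\<lambda>f. blinfun_apply f x"]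
      by (simp add: F_def blinfun.scaleR_left blinfun.add_left H)
    then have "2 *\<^sub>R ((1/2) *\<^sub>R (h x + y (y x))) = 2 *\<^sub>R y x" by (rule arg_cong)
    then show ?thesis by (simp add: algebra_simps)
  qed
  show ?thesis
  proof (rule that)
    show "id - blinfun_apply y \<in> M" by (intro vna_minus vna_id M yM)
    show "blinfun_apply g \<in> M" by (rule gM)
    show "cadjoint (id - blinfun_apply y) = id - blinfun_apply y"
      by (rule cadjoint_unique) (simp add: cinner_diff_left cinner_diff_right ysa)
    show "(id - blinfun_apply y) \<circ> (id - blinfun_apply y) = id - h"
      by (simp add: fun_eq_iff blinfun.diff_right y' scaleR_2)
    show "(id - blinfun_apply y) \<circ> blinfun_apply g = id"
      by (simp add: fun_eq_iff g')
  qed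
qed

text \<open>After division by \<open>m\<close> the operator \<open>h = 1 - p / m\<close> has a form
  between \<open>0\<close> and \<open>r < 1\<close>, and a root of \<open>1 - h\<close> is rescaled
  by the square root of \<open>m\<close>. The lower bound \<open>e\<close> keeps \<open>r\<close>
  below 1 and thus makes the root invertible.\<close>

lemma vna_sqrt:
  fixes M :: "'g::complex_hilbert_space op set"
  assumes M: "von_neumann_algebra M" and p: "p \<in> M" and sa: "cadjoint p = p"
    and e: "e > 0" and pos: "\<And>x. e * (norm x)\<^sup>2 \<le> Re (cinner x (p x))"
  obtains c d where "c \<in> M" "d \<in> M" "cadjoint c = c" "c \<circ> c = p" "c \<circ> d = id"
proof -
  have bp: "bounded_clinear p" using M p by (rule vna_bounded_clinear)
  have psa: "cinner (p x) y = cinner x (p y)" for x y using cadjoint_right[OF bp] sa by simp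
  obtain K where K: "K > 0" "\<And>x. norm (p x) \<le> K * norm x"
    using bounded_clinear_bound[OF bp] by metis
  \<comment> \<open>Large enough for both ends: \<open>K \<le> m\<close> makes \<open>h\<close>
    positive, and \<open>e \<le> m\<close> makes \<open>r\<close> nonnegative.\<close>
  define m where "m = K + e"
  have m: "m > 0" "K \<le> m" "e \<le> m" using K(1) e by (auto simp: m_def)
  define r where "r = 1 - e / m"
  have r: "0 \<le> r" "r < 1" using m e by (auto simp: r_def field_simps)
  define h where "h = id - complex_of_real (1/m) *\<^sub>C p"
  have h_apply: "h x = x - (1/m) *\<^sub>R p x" for x
    by (simp add: h_def scaleC_fun_def scaleR_scaleC)
  have hM: "h \<in> M" unfolding h_def by (intro vna_minus vna_id vna_scaleC M p)
  then have bh: "bounded_clinear h" using M vna_bounded_clinear by blast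
  have hsa: "cinner (h x) y = cinner x (h y)" for x y
    by (simp add: h_apply cinner_diff_left cinner_diff_right cinner_scaleR_left cinner_scaleR_right psa)
  have form: "Re (cinner x (h x)) = (norm x)\<^sup>2 - Re (cinner x (p x)) / m" for x
    by (simp add: h_apply cinner_diff_right cinner_scaleR_right cinner_self del: of_real_power)
  have up: "Re (cinner x (h x)) \<le> r * (norm x)\<^sup>2" for x
    using divide_right_mono[OF pos[of x], of m] m by (simp add: form r_def algebra_simps)
  have low: "0 \<le> Re (cinner x (h x))" for x
  proof -
    have "Re (cinner x (p x)) \<le> norm x * norm (p x)"
      using complex_Re_le_cmod cmod_cinner_le by (rule order_trans)
    also have "\<dots> \<le> norm x * (K * norm x)" by (intro mult_left_mono K) simp
    also have "\<dots> \<le> m * (norm x)\<^sup>2"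
      using mult_right_mono[OF m(2), of "(norm x)\<^sup>2"] by (simp add: power2_eq_square mult_ac)
    finally show ?thesis using m(1) by (simp add: form field_simps)
  qed
  have im: "Im (cinner x (h x)) = 0" for x
    using hsa[of x x] cinner_commute[of "h x" x] by (metis complex_is_Real_iff Reals_cnj_iff)
  \<comment> \<open>Cauchy-Schwarz for the form of \<open>h\<close> converts the bound on the
    quadratic form into the norm bound that the contraction argument requires.\<close>
  interpret h: semi_inner UNIV "\<lambda>x y. cinner x (h y)"
    using bh by unfold_locales
      (auto simp: bounded_clinear_add cinner_add_right bounded_clinear_scaleC cinner_scaleC_right
        complex_nonneg_Reals_iff low im hsa cinner_commute[symmetric])
  have "norm (h x) \<le> r * norm x" for x
  proof (cases "h x = 0")
    case False
    have sq: "h.nrm z \<le> sqrt r * norm z" for z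
      using real_sqrt_le_mono[OF up[of z]] by (simp add: h.nrm_def real_sqrt_mult)
    have "norm (h x) * norm (h x) = cmod (cinner (h x) (h x))"
      by (simp add: cinner_self norm_power power2_eq_square norm_mult)
    also have "\<dots> \<le> h.nrm (h x) * h.nrm x" by (rule h.cauchy_schwarz) auto
    also have "\<dots> \<le> (sqrt r * norm (h x)) * (sqrt r * norm x)"
      using r by (intro mult_mono sq h.nrm_nonneg) auto
    also have "\<dots> = norm (h x) * (r * norm x)"
      using r by simp
    finally show ?thesis using False by simp
  qed (use r in auto)
  then obtain c d where cd: "c \<in> M" "d \<in> M" "cadjoint c = c" "c \<circ> c = id - h" "c \<circ> d = id"
    using vna_sqrt_aux[OF M hM hsa r] by metis
  have bc: "bounded_clinear c" using M cd(1) by (rule vna_bounded_clinear)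
  define s where "s = complex_of_real (sqrt m)"
  have s: "s * s = complex_of_real m" "s \<noteq> 0" "cnj s = s"
    using m by (auto simp: s_def simp flip: of_real_mult)
  show ?thesis
  proof (rule that)
    show "s *\<^sub>C c \<in> M" "inverse s *\<^sub>C d \<in> M" using cd M by (auto intro: vna_scaleC)
    show "cadjoint (s *\<^sub>C c) = s *\<^sub>C c" by (simp add: cadjoint_scaleC bc s cd)
    show "(s *\<^sub>C c) \<circ> (s *\<^sub>C c) = p"
    proof
      fix x
      have "((s *\<^sub>C c) \<circ> (s *\<^sub>C c)) x = complex_of_real m *\<^sub>C c (c x)"
        by (simp add: scaleC_fun_def bounded_clinear_scaleC[OF bc] scaleC_scaleC s)
      also have "c (c x) = (1/m) *\<^sub>R p x"
        using fun_cong[OF cd(4), of x] by (simp add: h_apply)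
      finally show "((s *\<^sub>C c) \<circ> (s *\<^sub>C c)) x = p x"
        using m by (simp add: scaleR_scaleC scaleC_scaleC scaleC_one flip: of_real_mult)
    qed
    show "(s *\<^sub>C c) \<circ> (inverse s *\<^sub>C d) = id"
      using fun_cong[OF cd(5)] s
      by (simp add: fun_eq_iff scaleC_fun_def bounded_clinear_scaleC[OF bc] scaleC_scaleC scaleC_one)
  qed
qed

section \<open>The Hilbert space of a positive semidefinite kernel\<close>

lemma sum_fun_apply: "(\<Sum>i\<in>I. f i) x = (\<Sum>i\<in>I. f i x)"
  by (induction I rule: infinite_finite_induct) auto

text \<open>The reproducing kernel construction. Its vectors are functions on the index set, as the
  type \<open>'g rep_vec\<close> demands of a representation space.\<close>

locale psd_kernel =
  fixes S :: "'x set" and K :: "'x \<Rightarrow> 'x \<Rightarrow> complex"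
  assumes herm: "p \<in> S \<Longrightarrow> q \<in> S \<Longrightarrow> K q p = cnj (K p q)"
    and psd: "finite F \<Longrightarrow> F \<subseteq> S \<Longrightarrow> (\<Sum>p\<in>F. \<Sum>q\<in>F. cnj (c p) * c q * K p q) \<in> \<real>\<^sub>\<ge>\<^sub>0"
begin

definition supp :: "('x \<Rightarrow> complex) \<Rightarrow> 'x set" where "supp c = {p. c p \<noteq> 0}"

definition fin :: "('x \<Rightarrow> complex) set" where "fin = {c. finite (supp c) \<and> supp c \<subseteq> S}"

text \<open>The value at \<open>p\<close> is the product of the point \<open>p\<close> with the
  combination \<open>c\<close>. Combinations that differ by a null vector have the same image, so no
  quotient has to be formed.\<close>

definition kemb :: "('x \<Rightarrow> complex) \<Rightarrow> 'x \<Rightarrow> complex" where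
  "kemb c p = (if p \<in> S then \<Sum>q\<in>supp c. c q * K p q else 0)"

definition kform :: "('x \<Rightarrow> complex) \<Rightarrow> ('x \<Rightarrow> complex) \<Rightarrow> complex" where
  "kform c d = (\<Sum>p\<in>supp c. cnj (c p) * kemb d p)"

definition point :: "'x \<Rightarrow> 'x \<Rightarrow> complex" where "point p = (\<lambda>q. if q = p then 1 else 0)"

lemma kemb_superset:
  "finite F \<Longrightarrow> supp c \<subseteq> F \<Longrightarrow> p \<in> S \<Longrightarrow> kemb c p = (\<Sum>q\<in>F. c q * K p q)"
  unfolding kemb_def by (simp, intro sum.mono_neutral_left) (auto simp: supp_def)

lemma supp_add: "supp (c + d) \<subseteq> supp c \<union> supp d"
  by (auto simp: supp_def)

lemma supp_scale: "supp (z *\<^sub>C c) \<subseteq> supp c"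
  by (auto simp: supp_def scaleC_fun_def scaleC_complex_def)

lemma fin_subspace: "csubspace fin"
  unfolding complex_vector.subspace_def
proof (intro conjI ballI allI)
  show "0 \<in> fin" by (simp add: fin_def supp_def)
  show "c + d \<in> fin" if "c \<in> fin" "d \<in> fin" for c d
    using that supp_add[of c d] by (auto simp: fin_def dest: finite_subset)
  show "z *\<^sub>C c \<in> fin" if "c \<in> fin" for z c
    using that supp_scale[of z c] by (auto simp: fin_def dest: finite_subset)
qed

lemma kemb_add: "c \<in> fin \<Longrightarrow> d \<in> fin \<Longrightarrow> kemb (c + d) = kemb c + kemb d"
proof
  fix p assume "c \<in> fin" "d \<in> fin"
  then have F: "finite (supp c \<union> supp d)" by (simp add: fin_def)
  show "kemb (c + d) p = (kemb c + kemb d) p"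
  proof (cases "p \<in> S")
    case True
    then show ?thesis
      using kemb_superset[OF F _ True, of c] kemb_superset[OF F _ True, of d]
        kemb_superset[OF F supp_add True] by (simp add: distrib_right sum.distrib)
  qed (simp add: kemb_def)
qed

lemma kemb_scale: "c \<in> fin \<Longrightarrow> kemb (z *\<^sub>C c) = z *\<^sub>C kemb c"
proof
  fix p assume "c \<in> fin"
  then have F: "finite (supp c)" by (simp add: fin_def)
  show "kemb (z *\<^sub>C c) p = (z *\<^sub>C kemb c) p"
  proof (cases "p \<in> S")
    case True
    then show ?thesis
      using kemb_superset[OF F _ True, of c] kemb_superset[OF F supp_scale True]
      by (simp add: scaleC_fun_def scaleC_complex_def sum_distrib_left mult.assoc)
  qed (simp add: kemb_def scaleC_fun_def scaleC_complex_def)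
qed

lemma kemb_scale_apply: "c \<in> fin \<Longrightarrow> kemb (z *\<^sub>C c) p = z * kemb c p"
  by (subst kemb_scale) (simp_all add: scaleC_fun_def scaleC_complex_def)

sublocale semi_inner fin kform
proof
  show "csubspace fin" by (rule fin_subspace)
  show "kform x (y + z) = kform x y + kform x z" if "x \<in> fin" "y \<in> fin" "z \<in> fin" for x y z
    using that by (simp add: kform_def kemb_add distrib_left sum.distrib)
  show "kform x (c *\<^sub>C y) = c * kform x y" if "x \<in> fin" "y \<in> fin" for x y c
    using that by (simp add: kform_def kemb_scale_apply sum_distrib_left mult_ac)
  show "kform y x = cnj (kform x y)" if xy: "x \<in> fin" "y \<in> fin" for x y
  proof -
    have "kform y x = (\<Sum>p\<in>supp y. \<Sum>q\<in>supp x. cnj (y p) * (x q * K p q))"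
      using xy unfolding kform_def
      by (intro sum.cong refl) (auto simp: kemb_def fin_def sum_distrib_left)
    also have "\<dots> = (\<Sum>q\<in>supp x. \<Sum>p\<in>supp y. cnj (y p) * (x q * K p q))" by (rule sum.swap)
    also have "\<dots> = (\<Sum>q\<in>supp x. \<Sum>p\<in>supp y. cnj (cnj (x q) * (y p * K q p)))"
    proof (intro sum.cong refl)
      fix q p assume "q \<in> supp x" "p \<in> supp y"
      then have "K p q = cnj (K q p)" using xy herm[of q p] by (auto simp: fin_def)
      then show "cnj (y p) * (x q * K p q) = cnj (cnj (x q) * (y p * K q p))" by (simp add: mult_ac)
    qed
    also have "\<dots> = cnj (\<Sum>q\<in>supp x. cnj (x q) * kemb y q)"
      using xy unfolding cnj_sum
      by (intro sum.cong refl) (auto simp: kemb_def fin_def sum_distrib_left)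
    finally show ?thesis by (simp only: kform_def)
  qed
  show "kform x x \<in> \<real>\<^sub>\<ge>\<^sub>0" if x: "x \<in> fin" for x
  proof -
    have "kform x x = (\<Sum>p\<in>supp x. \<Sum>q\<in>supp x. cnj (x p) * x q * K p q)"
      using x unfolding kform_def
      by (intro sum.cong refl) (auto simp: kemb_def fin_def sum_distrib_left mult.assoc)
    then show ?thesis using x psd[of "supp x" x] by (simp add: fin_def)
  qed
qed

lemma supp_point [simp]: "supp (point p) = {p}"
  by (auto simp: supp_def point_def)

lemma point_fin [simp, intro]: "p \<in> S \<Longrightarrow> point p \<in> fin"
  by (simp add: fin_def)

lemma kform_point: "kform (point p) d = kemb d p"
  by (simp add: kform_def) (simp add: point_def)

lemma kemb_point: "kemb (point p) q = (if q \<in> S then K q p else 0)"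
  by (simp add: kemb_def) (simp add: point_def)

lemma fin_decompose: "c \<in> fin \<Longrightarrow> c = (\<Sum>p\<in>supp c. c p *\<^sub>C point p)"
proof
  fix q assume "c \<in> fin"
  then have "finite (supp c)" by (simp add: fin_def)
  then have "(\<Sum>p\<in>supp c. c p * (if q = p then 1 else 0)) = (if q \<in> supp c then c q else 0)"
    by (simp add: if_distrib[of "times _"] sum.delta' cong: if_cong)
  then show "c q = (\<Sum>p\<in>supp c. c p *\<^sub>C point p) q"
    by (simp add: sum_fun_apply scaleC_fun_def scaleC_complex_def point_def supp_def)
qed

lemma kernel_cauchy_schwarz:
  "p \<in> S \<Longrightarrow> q \<in> S \<Longrightarrow> (cmod (K p q))\<^sup>2 \<le> Re (K p p) * Re (K q q)"
proof -
  assume pq: "p \<in> S" "q \<in> S"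
  have "cmod (K p q) \<le> nrm (point p) * nrm (point q)"
    using cauchy_schwarz[of "point p" "point q"] pq by (simp add: kform_point kemb_point)
  then have "(cmod (K p q))\<^sup>2 \<le> (nrm (point p) * nrm (point q))\<^sup>2" by (intro power_mono) auto
  also have "\<dots> = Re (K p p) * Re (K q q)"
    using pq by (simp add: power_mult_distrib nrm_power2 kform_point kemb_point)
  finally show ?thesis .
qed

section \<open>Completion by pointwise limits of Cauchy sequences\<close>

lemma kemb_bound: "p \<in> S \<Longrightarrow> c \<in> fin \<Longrightarrow> cmod (kemb c p) \<le> nrm (point p) * nrm c"
  using cauchy_schwarz[of "point p" c] by (simp add: kform_point)

text \<open>An element of the completion is identified with the pointwise limit of the embedded
  Cauchy sequence. By \<open>represents_zero\<close> this limit determines the sequence up to a null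
  sequence.\<close>

definition represents :: "(nat \<Rightarrow> 'x \<Rightarrow> complex) \<Rightarrow> ('x \<Rightarrow> complex) \<Rightarrow> bool" where
  "represents s v \<longleftrightarrow> (\<forall>n. s n \<in> fin) \<and> (\<forall>e>0. \<exists>N. \<forall>m\<ge>N. \<forall>n\<ge>N. nrm (s m - s n) < e) \<and>
     (\<forall>p. (\<lambda>n. kemb (s n) p) \<longlonglongrightarrow> v p)"

definition H :: "('x \<Rightarrow> complex) set" where "H = {v. \<exists>s. represents s v}"

text \<open>The chosen sequences do not matter: by \<open>kform_difference\<close> all representing
  sequences of \<open>v\<close> and \<open>w\<close> lead to the same limit.\<close>

definition kip :: "('x \<Rightarrow> complex) \<Rightarrow> ('x \<Rightarrow> complex) \<Rightarrow> complex" where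
  "kip v w = lim (\<lambda>n. kform ((SOME s. represents s v) n) ((SOME s. represents s w) n))"

lemma represents_fin: "represents s v \<Longrightarrow> s n \<in> fin"
  by (simp add: represents_def)

lemma represents_kemb: "c \<in> fin \<Longrightarrow> represents (\<lambda>_. c) (kemb c)"
  by (auto simp: represents_def nrm_def ip_zero_left)

lemma represents_add:
  assumes s: "represents s v" and t: "represents t w"
  shows "represents (\<lambda>n. s n + t n) (v + w)"
  unfolding represents_def
proof (intro conjI allI impI)
  note fs = represents_fin[OF s] and ft = represents_fin[OF t]
  show "s n + t n \<in> fin" for n using fs ft by auto
  show "(\<lambda>n. kemb (s n + t n) p) \<longlonglongrightarrow> (v + w) p" for p
    using s t fs ft unfolding represents_def by (auto simp: kemb_add intro!: tendsto_add)
  fix e :: real assume "e > 0"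
  then obtain N1 N2 where N: "\<forall>m\<ge>N1. \<forall>n\<ge>N1. nrm (s m - s n) < e/2" "\<forall>m\<ge>N2. \<forall>n\<ge>N2. nrm (t m - t n) < e/2"
    using s t unfolding represents_def by (meson half_gt_zero)
  have "nrm (s m + t m - (s n + t n)) < e" if "m \<ge> max N1 N2" "n \<ge> max N1 N2" for m n
  proof -
    have "nrm (s m + t m - (s n + t n)) \<le> nrm (s m - s n) + nrm (t m - t n)"
      using nrm_triangle[of "s m - s n" "t m - t n"] fs ft by (simp add: algebra_simps)
    moreover have "nrm (s m - s n) < e/2" "nrm (t m - t n) < e/2" using N that by auto
    ultimately show ?thesis by linarith
  qed
  then show "\<exists>N. \<forall>m\<ge>N. \<forall>n\<ge>N. nrm (s m + t m - (s n + t n)) < e" by blast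
qed

lemma nrm_linear_image_cauchy:
  assumes s: "represents s v" and B: "\<And>m n. nrm (L (s m) - L (s n)) \<le> B * nrm (s m - s n)"
  shows "\<forall>e>0. \<exists>N. \<forall>m\<ge>N. \<forall>n\<ge>N. nrm (L (s m) - L (s n)) < e"
proof (intro allI impI)
  fix e :: real assume e: "e > 0"
  define B' where "B' = \<bar>B\<bar> + 1"
  have B': "B' > 0" "B \<le> B'" by (auto simp: B'_def)
  obtain N where N: "\<forall>m\<ge>N. \<forall>n\<ge>N. nrm (s m - s n) < e / B'"
    using s e B'(1) unfolding represents_def by (meson divide_pos_pos)
  have "nrm (L (s m) - L (s n)) < e" if "m \<ge> N" "n \<ge> N" for m n
  proof -
    have "B * nrm (s m - s n) \<le> B' * nrm (s m - s n)"
      using B'(2) represents_fin[OF s] by (intro mult_right_mono nrm_nonneg) auto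
    moreover have "B' * nrm (s m - s n) < e" using N that B'(1) by (simp add: field_simps)
    ultimately show ?thesis using B[of m n] by linarith
  qed
  then show "\<exists>N. \<forall>m\<ge>N. \<forall>n\<ge>N. nrm (L (s m) - L (s n)) < e" by blast
qed

lemma represents_scale:
  assumes s: "represents s v"
  shows "represents (\<lambda>n. z *\<^sub>C s n) (z *\<^sub>C v)"
  unfolding represents_def
proof (intro conjI)
  note fs = represents_fin[OF s]
  show "\<forall>n. z *\<^sub>C s n \<in> fin" using fs by auto
  show "\<forall>p. (\<lambda>n. kemb (z *\<^sub>C s n) p) \<longlonglongrightarrow> (z *\<^sub>C v) p"
    using s fs unfolding represents_def scaleC_fun_def[of z v] scaleC_complex_def
    by (auto simp: kemb_scale_apply intro!: tendsto_mult)
  show "\<forall>e>0. \<exists>N. \<forall>m\<ge>N. \<forall>n\<ge>N. nrm (z *\<^sub>C s m - z *\<^sub>C s n) < e"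
    by (rule nrm_linear_image_cauchy[OF s, where L = "scaleC z" and B = "cmod z"])
      (use fs in \<open>simp add: nrm_scaleC flip: complex_vector.scale_right_diff_distrib\<close>)
qed

lemma represents_diff:
  assumes "represents s v" "represents t w"
  shows "represents (\<lambda>n. s n - t n) (v - w)"
proof -
  have eq: "c + (-1) *\<^sub>C d = c - d" for c d :: "'x \<Rightarrow> complex"
    by (simp add: fun_eq_iff scaleC_fun_def scaleC_complex_def)
  show ?thesis
    using represents_add[OF assms(1) represents_scale[OF assms(2), of "-1"]] by (simp only: eq)
qed

lemma H_subspace: "csubspace H"
  unfolding complex_vector.subspace_def
proof (intro conjI ballI allI)
  have "kemb 0 = 0" by (simp add: fun_eq_iff kemb_def supp_def)
  then show "0 \<in> H" using represents_kemb[of 0] V_closed(1) unfolding H_def by auto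
qed (auto simp: H_def intro: represents_add represents_scale)

lemma represents_bounded:
  assumes "represents s v" obtains B where "B > 0" "\<And>n. nrm (s n) \<le> B"
proof -
  obtain N where N: "\<forall>m\<ge>N. \<forall>n\<ge>N. nrm (s m - s n) < 1"
    using assms unfolding represents_def by (meson zero_less_one)
  define B where "B = Max ((\<lambda>n. nrm (s n)) ` {..N}) + 1"
  have le: "nrm (s n) \<le> B - 1" if "n \<le> N" for n
    unfolding B_def using that by simp
  have "nrm (s n) \<le> B" for n
  proof (cases "n \<le> N")
    case False
    then have "nrm (s n - s N) < 1" using N by auto
    then show ?thesis
      using nrm_le_diff[of "s n" "s N"] represents_fin[OF assms] le[of N] by fastforce
  qed (use le in fastforce)
  moreover have "B > 0"
    using le[of 0] nrm_nonneg[OF represents_fin[OF assms], of 0] by linarith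
  ultimately show ?thesis using that by blast
qed

text \<open>For fixed \<open>m\<close> the sesquilinear term \<open>kform (s m) (s n)\<close> tends to \<open>0\<close> with the values of the
  embedding, while \<open>kform (s n - s m) (s n)\<close> is small by the Cauchy property.\<close>

lemma represents_zero:
  assumes s: "represents s 0"
  shows "(\<lambda>n. nrm (s n)) \<longlonglongrightarrow> 0"
proof -
  note fs = represents_fin[OF s]
  obtain B where B: "B > 0" "\<And>n. nrm (s n) \<le> B" using represents_bounded[OF s] by metis
  have "(\<lambda>n. (nrm (s n))\<^sup>2) \<longlonglongrightarrow> 0"
  proof (rule LIMSEQ_I)
    fix e :: real assume e: "e > 0"
    obtain m where m: "\<forall>n\<ge>m. \<forall>n'\<ge>m. nrm (s n - s n') < e / (2 * B)"
      using s e B(1) unfolding represents_def by (meson divide_pos_pos mult_pos_pos zero_less_numeral)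
    have "(\<lambda>n. kform (s m) (s n)) \<longlonglongrightarrow> (\<Sum>p\<in>supp (s m). cnj (s m p) * 0)"
      unfolding kform_def using s by (intro tendsto_sum tendsto_mult) (auto simp: represents_def)
    then have "(\<lambda>n. kform (s m) (s n)) \<longlonglongrightarrow> 0" by simp
    then obtain N where N: "\<forall>n\<ge>N. cmod (kform (s m) (s n)) < e / 2"
      using LIMSEQ_D[of _ "0::complex" "e/2"] e by fastforce
    have "norm ((nrm (s n))\<^sup>2 - 0) < e" if n: "n \<ge> max m N" for n
    proof -
      have "kform (s n) (s n) = kform (s n - s m) (s n) + kform (s m) (s n)"
        using fs by (simp add: ip_diff_left)
      then have "cmod (kform (s n) (s n)) \<le> cmod (kform (s n - s m) (s n)) + cmod (kform (s m) (s n))"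
        by (simp add: norm_triangle_ineq)
      moreover have "cmod (kform (s n) (s n)) = (nrm (s n))\<^sup>2"
        using fs by (simp add: ip_self norm_power)
      moreover have "cmod (kform (s n - s m) (s n)) \<le> nrm (s n - s m) * nrm (s n)"
        using fs by (intro cauchy_schwarz) auto
      moreover have "nrm (s n - s m) * nrm (s n) \<le> e / (2 * B) * B"
        using m n B fs e by (intro mult_mono less_imp_le[of _ "e / (2 * B)"] nrm_nonneg) auto
      ultimately have "(nrm (s n))\<^sup>2 \<le> e / 2 + cmod (kform (s m) (s n))" using B(1) by simp
      moreover have "cmod (kform (s m) (s n)) < e / 2" using N n by simp
      ultimately show ?thesis by simp
    qed
    then show "\<exists>N. \<forall>n\<ge>N. norm ((nrm (s n))\<^sup>2 - 0) < e" by blast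
  qed
  then have "(\<lambda>n. sqrt ((nrm (s n))\<^sup>2)) \<longlonglongrightarrow> sqrt 0" by (rule tendsto_real_sqrt)
  then show ?thesis using fs by simp
qed

lemma kform_difference:
  assumes s: "represents s v" "represents s' v" and t: "represents t w" "represents t' w"
  shows "(\<lambda>n. kform (s n) (t n) - kform (s' n) (t' n)) \<longlonglongrightarrow> 0"
proof -
  note f = represents_fin[OF s(1)] represents_fin[OF s(2)] represents_fin[OF t(1)] represents_fin[OF t(2)]
  obtain B where B: "B > 0" "\<And>n. nrm (t n) \<le> B" using represents_bounded[OF t(1)] by metis
  obtain C where C: "C > 0" "\<And>n. nrm (s' n) \<le> C" using represents_bounded[OF s(2)] by metis
  show ?thesis
  proof (rule Lim_null_comparison)
    have "norm (kform (s n) (t n) - kform (s' n) (t' n)) \<le> nrm (s n - s' n) * B + C * nrm (t n - t' n)" for n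
    proof -
      have eq: "kform (s n) (t n) - kform (s' n) (t' n) = kform (s n - s' n) (t n) + kform (s' n) (t n - t' n)"
        using f by (simp add: ip_diff_left ip_diff_right)
      have "norm (kform (s n) (t n) - kform (s' n) (t' n))
          \<le> nrm (s n - s' n) * nrm (t n) + nrm (s' n) * nrm (t n - t' n)"
        unfolding eq using f by (intro norm_triangle_le add_mono cauchy_schwarz) auto
      also have "\<dots> \<le> nrm (s n - s' n) * B + C * nrm (t n - t' n)"
        using f B C by (intro add_mono mult_left_mono mult_right_mono nrm_nonneg) auto
      finally show ?thesis .
    qed
    then show "\<forall>\<^sub>F n in sequentially. norm (kform (s n) (t n) - kform (s' n) (t' n))
        \<le> nrm (s n - s' n) * B + C * nrm (t n - t' n)" by simp
    have z: "represents (\<lambda>n. s n - s' n) 0" "represents (\<lambda>n. t n - t' n) 0"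
      using represents_diff[OF s] represents_diff[OF t] by simp_all
    have "(\<lambda>n. nrm (s n - s' n) * B + C * nrm (t n - t' n)) \<longlonglongrightarrow> 0 * B + C * 0"
      by (intro tendsto_intros represents_zero z)
    then show "(\<lambda>n. nrm (s n - s' n) * B + C * nrm (t n - t' n)) \<longlonglongrightarrow> 0" by simp
  qed
qed

lemma kform_convergent:
  assumes s: "represents s v" and t: "represents t w"
  shows "convergent (\<lambda>n. kform (s n) (t n))"
proof -
  note f = represents_fin[OF s] represents_fin[OF t]
  obtain B where B: "B > 0" "\<And>n. nrm (t n) \<le> B" using represents_bounded[OF t] by metis
  obtain C where C: "C > 0" "\<And>n. nrm (s n) \<le> C" using represents_bounded[OF s] by metis
  have "Cauchy (\<lambda>n. kform (s n) (t n))"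
  proof (rule CauchyI)
    fix e :: real assume e: "e > 0"
    have "e / (2 * B) > 0" "e / (2 * C) > 0" using e B(1) C(1) by auto
    then obtain N1 N2 where N: "\<forall>m\<ge>N1. \<forall>n\<ge>N1. nrm (s m - s n) < e / (2 * B)"
        "\<forall>m\<ge>N2. \<forall>n\<ge>N2. nrm (t m - t n) < e / (2 * C)"
      using s t unfolding represents_def by meson
    have "norm (kform (s m) (t m) - kform (s n) (t n)) < e" if mn: "m \<ge> max N1 N2" "n \<ge> max N1 N2" for m n
    proof -
      have eq: "kform (s m) (t m) - kform (s n) (t n) = kform (s m - s n) (t m) + kform (s n) (t m - t n)"
        using f by (simp add: ip_diff_left ip_diff_right)
      have "norm (kform (s m) (t m) - kform (s n) (t n))
          \<le> nrm (s m - s n) * nrm (t m) + nrm (s n) * nrm (t m - t n)"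
        unfolding eq using f by (intro norm_triangle_le add_mono cauchy_schwarz) auto
      also have "\<dots> \<le> nrm (s m - s n) * B + C * nrm (t m - t n)"
        using f B C by (intro add_mono mult_left_mono mult_right_mono nrm_nonneg) auto
      also have "\<dots> < e / (2 * B) * B + C * (e / (2 * C))"
        using N mn B(1) C(1) by (intro add_strict_mono mult_strict_right_mono mult_strict_left_mono) auto
      also have "\<dots> = e" using B(1) C(1) by simp
      finally show ?thesis .
    qed
    then show "\<exists>M. \<forall>m\<ge>M. \<forall>n\<ge>M. norm (kform (s m) (t m) - kform (s n) (t n)) < e" by blast
  qed
  then show ?thesis by (rule Cauchy_convergent)
qed

lemma kip_limit:
  assumes s: "represents s v" and t: "represents t w"
  shows "(\<lambda>n. kform (s n) (t n)) \<longlonglongrightarrow> kip v w"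
proof -
  define s' where "s' = (SOME s. represents s v)"
  define t' where "t' = (SOME t. represents t w)"
  have s': "represents s' v" unfolding s'_def using s by (rule someI[where P = "\<lambda>s. represents s v"])
  have t': "represents t' w" unfolding t'_def using t by (rule someI[where P = "\<lambda>t. represents t w"])
  have "(\<lambda>n. kform (s' n) (t' n)) \<longlonglongrightarrow> kip v w"
    using kform_convergent[OF s' t'] by (simp add: kip_def s'_def t'_def convergent_LIMSEQ_iff)
  from tendsto_add[OF kform_difference[OF s s' t t'] this] show ?thesis by simp
qed

lemma kip_eqI:
  "represents s v \<Longrightarrow> represents t w \<Longrightarrow> (\<lambda>n. kform (s n) (t n)) \<longlonglongrightarrow> l \<Longrightarrow> kip v w = l"
  using kip_limit LIMSEQ_unique by blast

lemma represents_obtain: assumes "v \<in> H" obtains s where "represents s v"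
  using assms by (auto simp: H_def)

sublocale H: semi_inner H kip
proof
  show "csubspace H" by (rule H_subspace)
next
  fix x y z assume "x \<in> H" "y \<in> H" "z \<in> H"
  then obtain r s t where r: "represents r x" and s: "represents s y" and t: "represents t z"
    by (meson represents_obtain)
  have "(\<lambda>n. kform (r n) (s n) + kform (r n) (t n)) \<longlonglongrightarrow> kip x y + kip x z"
    by (intro tendsto_add kip_limit r s t)
  then show "kip x (y + z) = kip x y + kip x z"
    using r s t by (intro kip_eqI[OF r represents_add[OF s t]]) (simp add: ip_add_right represents_fin)
next
  fix x y c assume "x \<in> H" "y \<in> H"
  then obtain r s where r: "represents r x" and s: "represents s y"
    by (meson represents_obtain)
  have "(\<lambda>n. c * kform (r n) (s n)) \<longlonglongrightarrow> c * kip x y"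
    by (intro tendsto_mult_left kip_limit r s)
  then show "kip x (c *\<^sub>C y) = c * kip x y"
    using r s by (intro kip_eqI[OF r represents_scale[OF s]]) (simp add: ip_scaleC_right represents_fin)
  have "(\<lambda>n. cnj (kform (r n) (s n))) \<longlonglongrightarrow> cnj (kip x y)"
    by (intro tendsto_cnj kip_limit r s)
  then show "kip y x = cnj (kip x y)"
    using r s by (intro kip_eqI[OF s r]) (simp add: ip_commute[of "r _" "s _"] represents_fin)
next
  fix x assume "x \<in> H"
  then obtain r where r: "represents r x" by (meson represents_obtain)
  show "kip x x \<in> \<real>\<^sub>\<ge>\<^sub>0"
    by (rule closed_sequentially[OF closed_nonneg_Reals_complex _ kip_limit[OF r r]])
      (simp add: ip_nonneg represents_fin[OF r])
qed

lemma nrm_limit: "represents s v \<Longrightarrow> (\<lambda>n. nrm (s n)) \<longlonglongrightarrow> H.nrm v"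
  unfolding nrm_def H.nrm_def by (intro tendsto_real_sqrt tendsto_Re kip_limit)

lemma kemb_H [simp, intro]: "c \<in> fin \<Longrightarrow> kemb c \<in> H"
  using represents_kemb by (auto simp: H_def)

lemma kip_kemb: "c \<in> fin \<Longrightarrow> d \<in> fin \<Longrightarrow> kip (kemb c) (kemb d) = kform c d"
  by (rule kip_eqI[OF represents_kemb represents_kemb]) auto

lemma kemb_diff: "c \<in> fin \<Longrightarrow> d \<in> fin \<Longrightarrow> kemb (c - d) = kemb c - kemb d"
  using kemb_add[of "c - d" d] by simp

lemma nrm_kemb: "c \<in> fin \<Longrightarrow> H.nrm (kemb c) = nrm c"
  by (simp add: nrm_def H.nrm_def kip_kemb)

lemma H_outside: "v \<in> H \<Longrightarrow> p \<notin> S \<Longrightarrow> v p = 0"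
  by (auto simp: H_def represents_def kemb_def LIMSEQ_const_iff elim!: allE[of _ p])

lemma reproducing: "v \<in> H \<Longrightarrow> p \<in> S \<Longrightarrow> kip (kemb (point p)) v = v p"
proof -
  assume "v \<in> H" and p: "p \<in> S"
  then obtain s where s: "represents s v" by (meson represents_obtain)
  show ?thesis
    using s by (intro kip_eqI[OF represents_kemb[OF point_fin[OF p]] s]) (simp add: kform_point represents_def)
qed

text \<open>By the reproducing property a value \<open>v p\<close> is a product with
  \<open>v\<close>, so Cauchy-Schwarz makes every value of a null vector vanish.\<close>

lemma kip_definite: "v \<in> H \<Longrightarrow> kip v v = 0 \<Longrightarrow> v = 0"
proof
  fix p assume v: "v \<in> H" "kip v v = 0"
  show "v p = 0 p"
  proof (cases "p \<in> S")
    case True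
    have "cmod (v p) \<le> H.nrm (kemb (point p)) * H.nrm v"
      using H.cauchy_schwarz[of "kemb (point p)" v] reproducing[OF v(1) True] v True by simp
    moreover have "H.nrm v = 0" using v(2) by (simp add: H.nrm_def)
    ultimately show ?thesis by simp
  qed (simp add: H_outside[OF v(1)])
qed

lemma represents_nrm_tendsto:
  assumes s: "represents s v"
  shows "(\<lambda>n. H.nrm (kemb (s n) - v)) \<longlonglongrightarrow> 0"
proof (rule LIMSEQ_I)
  fix e :: real assume e: "e > 0"
  obtain N where N: "\<forall>m\<ge>N. \<forall>n\<ge>N. nrm (s m - s n) < e / 2"
    using s e unfolding represents_def by (meson half_gt_zero)
  have v: "v \<in> H" using s by (auto simp: H_def)
  have "norm (H.nrm (kemb (s n) - v) - 0) < e" if n: "n \<ge> N" for n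
  proof -
    have "(\<lambda>m. nrm (s n - s m)) \<longlonglongrightarrow> H.nrm (kemb (s n) - v)"
      by (rule nrm_limit[OF represents_diff[OF represents_kemb s]]) (rule represents_fin[OF s])
    moreover have "\<forall>m\<ge>N. nrm (s n - s m) \<le> e / 2" using N n by (auto intro: less_imp_le)
    ultimately have "H.nrm (kemb (s n) - v) \<le> e / 2" by (intro LIMSEQ_le_const2) auto
    moreover have "0 \<le> H.nrm (kemb (s n) - v)"
      using v represents_fin[OF s] by (intro H.nrm_nonneg) auto
    ultimately show ?thesis using e by simp
  qed
  then show "\<exists>N. \<forall>n\<ge>N. norm (H.nrm (kemb (s n) - v) - 0) < e" by blast
qed

text \<open>Each \<open>X n\<close> is replaced by an embedded finite combination \<open>c n\<close>
  within \<open>1 / (n + 1)\<close>. The combinations are then Cauchy themselves, so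
  \<open>c\<close> represents its own pointwise limit, and that function is the limit of
  \<open>X\<close>.\<close>

lemma H_complete:
  assumes X: "\<And>n. X n \<in> H"
    and cauchy: "\<forall>e>0. \<exists>M. \<forall>m\<ge>M. \<forall>n\<ge>M. H.nrm (X m - X n) < e"
  shows "\<exists>v\<in>H. (\<lambda>n::nat. H.nrm (X n - v)) \<longlonglongrightarrow> 0"
proof -
  have "\<exists>c\<in>fin. H.nrm (kemb c - X n) < inverse (real (Suc n))" for n
  proof -
    obtain s where s: "represents s (X n)" using X by (meson represents_obtain)
    have "inverse (real (Suc n)) > 0" by simp
    from LIMSEQ_D[OF represents_nrm_tendsto[OF s] this]
    obtain k where "norm (H.nrm (kemb (s k) - X n) - 0) < inverse (real (Suc n))" by blast
    then show ?thesis using represents_fin[OF s] by (intro bexI[of _ "s k"]) (auto simp: abs_less_iff)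
  qed
  then obtain c where c: "\<And>n. c n \<in> fin" "\<And>n. H.nrm (kemb (c n) - X n) < inverse (real (Suc n))"
    by metis
  have lim0: "(\<lambda>n. H.nrm (kemb (c n) - X n)) \<longlonglongrightarrow> 0"
    by (rule Lim_null_comparison[OF _ LIMSEQ_inverse_real_of_nat])
      (use c X in \<open>auto intro!: always_eventually less_imp_le\<close>)
  have ccauchy: "\<forall>e>0. \<exists>N. \<forall>m\<ge>N. \<forall>n\<ge>N. nrm (c m - c n) < e"
  proof (intro allI impI)
    fix e :: real assume e: "e > 0"
    then have e3: "e / 3 > 0" by simp
    obtain N1 where N1: "\<forall>m\<ge>N1. \<forall>n\<ge>N1. H.nrm (X m - X n) < e / 3" using cauchy e3 by meson
    obtain N2 where N2: "\<forall>n\<ge>N2. norm (H.nrm (kemb (c n) - X n) - 0) < e / 3"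
      using LIMSEQ_D[OF lim0 e3] by blast
    have "nrm (c m - c n) < e" if mn: "m \<ge> max N1 N2" "n \<ge> max N1 N2" for m n
    proof -
      have "nrm (c m - c n) = H.nrm (kemb (c m) - kemb (c n))"
        using c(1) by (simp add: kemb_diff[symmetric] nrm_kemb)
      also have "\<dots> \<le> H.nrm (kemb (c m) - X m) + (H.nrm (X m - X n) + H.nrm (X n - kemb (c n)))"
        using H.nrm_triangle3[of "kemb (c m)" "X m" "kemb (c n)"]
          H.nrm_triangle3[of "X m" "X n" "kemb (c n)"] c(1) X by fastforce
      also have "H.nrm (X n - kemb (c n)) = H.nrm (kemb (c n) - X n)"
        using c(1) X by (intro H.nrm_minus_commute) auto
      finally have "nrm (c m - c n) \<le> H.nrm (kemb (c m) - X m) + (H.nrm (X m - X n) + H.nrm (kemb (c n) - X n))" .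
      moreover have "H.nrm (X m - X n) < e / 3" using N1 mn by simp
      moreover have "norm (H.nrm (kemb (c m) - X m) - 0) < e / 3" "norm (H.nrm (kemb (c n) - X n) - 0) < e / 3"
        using N2 mn by simp_all
      ultimately show ?thesis unfolding real_norm_def diff_0_right by linarith
    qed
    then show "\<exists>N. \<forall>m\<ge>N. \<forall>n\<ge>N. nrm (c m - c n) < e" by blast
  qed
  have "convergent (\<lambda>n. kemb (c n) p)" for p
  proof (cases "p \<in> S")
    case True
    define B where "B = nrm (point p) + 1"
    have B: "B > 0" using True by (simp add: B_def add_nonneg_pos)
    have "Cauchy (\<lambda>n. kemb (c n) p)"
    proof (rule CauchyI)
      fix e :: real assume "e > 0"
      then obtain N where N: "\<forall>m\<ge>N. \<forall>n\<ge>N. nrm (c m - c n) < e / B"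
        using ccauchy B by (meson divide_pos_pos)
      have "norm (kemb (c m) p - kemb (c n) p) < e" if "m \<ge> N" "n \<ge> N" for m n
      proof -
        have "norm (kemb (c m) p - kemb (c n) p) \<le> nrm (point p) * nrm (c m - c n)"
          using kemb_bound[OF True, of "c m - c n"] c(1) by (simp add: kemb_diff)
        also have "\<dots> \<le> B * nrm (c m - c n)"
          using c(1) by (intro mult_right_mono nrm_nonneg) (auto simp: B_def)
        also have "\<dots> < e" using N that B by (simp add: field_simps)
        finally show ?thesis .
      qed
      then show "\<exists>M. \<forall>m\<ge>M. \<forall>n\<ge>M. norm (kemb (c m) p - kemb (c n) p) < e" by blast
    qed
    then show ?thesis by (rule Cauchy_convergent)
  qed (simp add: kemb_def convergent_const)
  then obtain v where v: "\<And>p. (\<lambda>n. kemb (c n) p) \<longlonglongrightarrow> v p" unfolding convergent_def by metis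
  then have rep: "represents c v" using c(1) ccauchy by (simp add: represents_def)
  then have vH: "v \<in> H" by (auto simp: H_def)
  have "(\<lambda>n. H.nrm (X n - v)) \<longlonglongrightarrow> 0"
  proof (rule Lim_null_comparison)
    have "norm (H.nrm (X n - v)) \<le> H.nrm (kemb (c n) - X n) + H.nrm (kemb (c n) - v)" for n
      using H.nrm_triangle3[of "X n" "kemb (c n)" v] X c(1) vH
        H.nrm_minus_commute[of "X n" "kemb (c n)"] by fastforce
    then show "\<forall>\<^sub>F n in sequentially. norm (H.nrm (X n - v))
        \<le> H.nrm (kemb (c n) - X n) + H.nrm (kemb (c n) - v)" by simp
    show "(\<lambda>n. H.nrm (kemb (c n) - X n) + H.nrm (kemb (c n) - v)) \<longlonglongrightarrow> 0"
      using tendsto_add[OF lim0 represents_nrm_tendsto[OF rep]] by simp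
  qed
  with vH show ?thesis by blast
qed

end

section \<open>The GNS representation of a state on the tensor product\<close>

lemma plus_comp: "(f + g) \<circ> h = (f \<circ> h) + (g \<circ> h)"
  by (simp add: fun_eq_iff)

lemma scaleC_comp: "(c *\<^sub>C f) \<circ> h = c *\<^sub>C (f \<circ> h)"
  by (simp add: fun_eq_iff scaleC_fun_def)

lemma comp_plus: "bounded_clinear f \<Longrightarrow> f \<circ> (g + h) = (f \<circ> g) + (f \<circ> h)"
  by (simp add: fun_eq_iff bounded_clinear_add)

lemma comp_scaleC: "bounded_clinear f \<Longrightarrow> f \<circ> (c *\<^sub>C g) = c *\<^sub>C (f \<circ> g)"
  by (simp add: fun_eq_iff scaleC_fun_def bounded_clinear_scaleC)

text \<open>Taking the coefficients \<open>1, 1\<close> and \<open>1, \<i>\<close> on a two-point set shows that \<open>K p q + K q p\<close> and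
  \<open>\<i> (K p q - K q p)\<close> are real.\<close>

lemma psd_kernelI:
  fixes K :: "'x \<Rightarrow> 'x \<Rightarrow> complex"
  assumes psd: "\<And>F c. finite F \<Longrightarrow> F \<subseteq> S \<Longrightarrow> (\<Sum>p\<in>F. \<Sum>q\<in>F. cnj (c p) * c q * K p q) \<in> \<real>\<^sub>\<ge>\<^sub>0"
  shows "psd_kernel S K"
proof
  have diag: "Im (K p p) = 0" if "p \<in> S" for p
    using psd[of "{p}" "\<lambda>_. 1"] that by (simp add: complex_nonneg_Reals_iff)
  show "K q p = cnj (K p q)" if pq: "p \<in> S" "q \<in> S" for p q
  proof (cases "p = q")
    case True
    then show ?thesis using diag pq by (simp add: complex_eq_iff)
  next
    case False
    then have "Im (K p q + K q p) = 0"
      using psd[of "{p, q}" "\<lambda>_. 1"] pq diag[OF pq(1)] diag[OF pq(2)]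
      by (simp add: complex_nonneg_Reals_iff)
    moreover have "Im (\<i> * (K p q - K q p)) = 0"
      using psd[of "{p, q}" "\<lambda>x. if x = p then 1 else \<i>"] pq diag[OF pq(1)] diag[OF pq(2)] False
      by (simp add: complex_nonneg_Reals_iff)
    ultimately show ?thesis by (simp add: complex_eq_iff)
  qed
qed (rule psd)

locale tensor_functional =
  fixes A B :: "'g::complex_hilbert_space op set" and \<omega> :: "'g op \<Rightarrow> 'g op \<Rightarrow> complex"
  assumes vA: "von_neumann_algebra A" and vB: "von_neumann_algebra B" and ts: "tensor_state A B \<omega>"
begin

lemma \<omega>_add_left: "a \<in> A \<Longrightarrow> a' \<in> A \<Longrightarrow> b \<in> B \<Longrightarrow> \<omega> (a + a') b = \<omega> a b + \<omega> a' b"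
  and \<omega>_add_right: "a \<in> A \<Longrightarrow> b \<in> B \<Longrightarrow> b' \<in> B \<Longrightarrow> \<omega> a (b + b') = \<omega> a b + \<omega> a b'"
  and \<omega>_scale_left: "a \<in> A \<Longrightarrow> b \<in> B \<Longrightarrow> \<omega> (c *\<^sub>C a) b = c * \<omega> a b"
  and \<omega>_scale_right: "a \<in> A \<Longrightarrow> b \<in> B \<Longrightarrow> \<omega> a (c *\<^sub>C b) = c * \<omega> a b"
  and \<omega>_id: "\<omega> id id = 1"
  using ts by (auto simp: tensor_state_def)

lemma \<omega>_diff_left: "a \<in> A \<Longrightarrow> a' \<in> A \<Longrightarrow> b \<in> B \<Longrightarrow> \<omega> (a - a') b = \<omega> a b - \<omega> a' b"
  using \<omega>_add_left[of "a - a'" a' b] vna_minus[OF vA, of a a'] by simp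

lemmas A_closed = vna_id[OF vA] vna_plus[OF vA] vna_comp[OF vA] vna_scaleC[OF vA]
  vna_cadjoint[OF vA] vna_minus[OF vA]
lemmas B_closed = vna_id[OF vB] vna_plus[OF vB] vna_comp[OF vB] vna_scaleC[OF vB]
  vna_cadjoint[OF vB] vna_minus[OF vB]
lemmas A_bounded = vna_bounded_clinear[OF vA]
lemmas B_bounded = vna_bounded_clinear[OF vB]

text \<open>Arguments about the left factor, such as the operator bound and later the map
  \<open>cp\<close>, reach the right factor through this exchange.\<close>

lemma swap: "tensor_functional B A (\<lambda>b a. \<omega> a b)"
proof
  have "(\<Sum>i<N. \<Sum>j<(N::nat). \<omega> (cadjoint (g i) \<circ> g j) (cadjoint (f i) \<circ> f j)) \<in> \<real>\<^sub>\<ge>\<^sub>0"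
    if "\<forall>i<N. f i \<in> B \<and> g i \<in> A" for N f g
    using ts that unfolding tensor_state_def by blast
  then show "tensor_state B A (\<lambda>b a. \<omega> a b)"
    using ts unfolding tensor_state_def by blast
qed (rule vA vB)+

text \<open>The scalars are absorbed into the left factors and the index set is enumerated, which
  leads back to the positivity condition of \<open>tensor_state\<close>.\<close>

lemma \<omega>_positive:
  assumes I: "finite I" and f: "\<And>i. i \<in> I \<Longrightarrow> f i \<in> A" and g: "\<And>i. i \<in> I \<Longrightarrow> g i \<in> B"
  shows "(\<Sum>i\<in>I. \<Sum>j\<in>I. cnj (c i) * c j * \<omega> (cadjoint (f i) \<circ> f j) (cadjoint (g i) \<circ> g j)) \<in> \<real>\<^sub>\<ge>\<^sub>0"
proof -
  obtain h :: "nat \<Rightarrow> _" where h: "bij_betw h {..<card I} I"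
    using ex_bij_betw_nat_finite[OF I] by (metis atLeast0LessThan)
  define F where "F i = c (h i) *\<^sub>C f (h i)" for i
  define G where "G i = g (h i)" for i
  have hI: "h i \<in> I" if "i < card I" for i using h that by (auto simp: bij_betw_def)
  have FG: "\<forall>i<card I. F i \<in> A \<and> G i \<in> B"
    using hI f g A_closed by (auto simp: F_def G_def)
  have "(\<Sum>i<card I. \<Sum>j<card I. \<omega> (cadjoint (F i) \<circ> F j) (cadjoint (G i) \<circ> G j)) \<in> \<real>\<^sub>\<ge>\<^sub>0"
    using ts FG unfolding tensor_state_def by blast
  also have "(\<Sum>i<card I. \<Sum>j<card I. \<omega> (cadjoint (F i) \<circ> F j) (cadjoint (G i) \<circ> G j)) =
      (\<Sum>i<card I. \<Sum>j<card I. cnj (c (h i)) * c (h j) *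
         \<omega> (cadjoint (f (h i)) \<circ> f (h j)) (cadjoint (g (h i)) \<circ> g (h j)))"
  proof (intro sum.cong refl)
    fix i j assume "i \<in> {..<card I}" "j \<in> {..<card I}"
    then have i: "h i \<in> I" and j: "h j \<in> I" using hI by auto
    have "cadjoint (F i) \<circ> F j = (cnj (c (h i)) * c (h j)) *\<^sub>C (cadjoint (f (h i)) \<circ> f (h j))"
      unfolding F_def using A_bounded f[OF i] f[OF j] A_closed(5)
      by (simp add: cadjoint_scaleC scaleC_comp comp_scaleC scaleC_scaleC)
    then show "\<omega> (cadjoint (F i) \<circ> F j) (cadjoint (G i) \<circ> G j) = cnj (c (h i)) * c (h j) *
         \<omega> (cadjoint (f (h i)) \<circ> f (h j)) (cadjoint (g (h i)) \<circ> g (h j))"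
      using f[OF i] f[OF j] g[OF i] g[OF j] by (simp add: G_def \<omega>_scale_left A_closed B_closed)
  qed
  also have "\<dots> = (\<Sum>i<card I. \<Sum>j\<in>I. cnj (c (h i)) * c j *
         \<omega> (cadjoint (f (h i)) \<circ> f j) (cadjoint (g (h i)) \<circ> g j))"
    by (intro sum.cong refl sum.reindex_bij_betw[OF h])
  also have "\<dots> = (\<Sum>i\<in>I. \<Sum>j\<in>I. cnj (c i) * c j *
         \<omega> (cadjoint (f i) \<circ> f j) (cadjoint (g i) \<circ> g j))"
    by (rule sum.reindex_bij_betw[OF h])
  finally show ?thesis .
qed

definition ker :: "'g op \<times> 'g op \<Rightarrow> 'g op \<times> 'g op \<Rightarrow> complex" where
  "ker p q = \<omega> (cadjoint (fst p) \<circ> fst q) (cadjoint (snd p) \<circ> snd q)"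

sublocale psd_kernel "A \<times> B" ker
proof (rule psd_kernelI)
  fix F c assume "finite F" "F \<subseteq> A \<times> B"
  then show "(\<Sum>p\<in>F. \<Sum>q\<in>F. cnj (c p) * c q * ker p q) \<in> \<real>\<^sub>\<ge>\<^sub>0"
    unfolding ker_def by (intro \<omega>_positive) auto
qed

lemma \<omega>_cadjoint: "a \<in> A \<Longrightarrow> b \<in> B \<Longrightarrow> \<omega> (cadjoint a) (cadjoint b) = cnj (\<omega> a b)"
  using herm[of "(id, id)" "(a, b)"] A_closed B_closed by (simp add: ker_def)

text \<open>With \<open>c\<^sup>2 = m - a\<^sup>* a\<close> the difference of the two sides is \<open>\<omega>(x\<^sup>* x)\<close> for \<open>x\<close> the sum of the
  elementary tensors of \<open>c f\<^sub>i\<close> and \<open>g\<^sub>i\<close>.\<close>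

lemma \<omega>_left_bound:
  assumes a: "a \<in> A"
  shows "\<exists>m>0. \<forall>(I :: 'i set) f g c. finite I \<longrightarrow> (\<forall>i\<in>I. f i \<in> A \<and> g i \<in> B) \<longrightarrow>
     Re (\<Sum>i\<in>I. \<Sum>j\<in>I. cnj (c i) * c j * \<omega> (cadjoint (a \<circ> f i) \<circ> (a \<circ> f j)) (cadjoint (g i) \<circ> g j))
     \<le> m * Re (\<Sum>i\<in>I. \<Sum>j\<in>I. cnj (c i) * c j * \<omega> (cadjoint (f i) \<circ> f j) (cadjoint (g i) \<circ> g j))"
proof -
  have ba: "bounded_clinear a" using A_bounded a by blast
  obtain K where K: "K > 0" "\<And>x. norm (a x) \<le> K * norm x" using bounded_clinear_bound[OF ba] by metis
  \<comment> \<open>\<open>K\<^sup>2\<close> dominates \<open>cadjoint a \<circ> a\<close>; the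
    extra 1 makes the difference \<open>p\<close> strictly positive, as \<open>vna_sqrt\<close>
    requires.\<close>
  define m where "m = K\<^sup>2 + 1"
  define p where "p = complex_of_real m *\<^sub>C id - (cadjoint a \<circ> a)"
  have m: "m > 0" by (simp add: m_def add_nonneg_pos)
  have p: "p \<in> A" unfolding p_def using a by (intro A_closed)
  have p_form: "cinner x (p y) = complex_of_real m * cinner x y - cinner (a x) (a y)" for x y
    by (simp add: p_def cinner_diff_right scaleC_fun_def cinner_scaleC_right cadjoint_right[OF ba])
  have "cadjoint p = p"
  proof (rule cadjoint_unique)
    show "cinner (p x) y = cinner x (p y)" for x y
      using p_form[of y x] p_form[of x y] cinner_commute[of "p x" y] cinner_commute[of y x]
        cinner_commute[of "a y" "a x"] by (metis complex_cnj_complex_of_real complex_cnj_diff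
          complex_cnj_mult cinner_commute)
  qed
  moreover have "1 * (norm x)\<^sup>2 \<le> Re (cinner x (p x))" for x
  proof -
    have "(norm (a x))\<^sup>2 \<le> (K * norm x)\<^sup>2" using K by (intro power_mono) auto
    then show ?thesis
      by (simp add: p_form cinner_self m_def power_mult_distrib algebra_simps del: of_real_power)
  qed
  ultimately obtain c where c: "c \<in> A" "cadjoint c = c" "c \<circ> c = p"
    using vna_sqrt[OF vA p] by (metis zero_less_one)
  have "Re (\<Sum>i\<in>I. \<Sum>j\<in>I. cnj (k i) * k j * \<omega> (cadjoint (a \<circ> f i) \<circ> (a \<circ> f j)) (cadjoint (g i) \<circ> g j))
     \<le> m * Re (\<Sum>i\<in>I. \<Sum>j\<in>I. cnj (k i) * k j * \<omega> (cadjoint (f i) \<circ> f j) (cadjoint (g i) \<circ> g j))"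
    if I: "finite I" and fg: "\<forall>i\<in>I. f i \<in> A \<and> g i \<in> B"
    for I :: "'i set" and f g k
  proof -
    have f: "\<And>i. i \<in> I \<Longrightarrow> f i \<in> A" and g: "\<And>i. i \<in> I \<Longrightarrow> g i \<in> B" using fg by auto
    have eq: "cnj (k i) * k j * \<omega> (cadjoint (c \<circ> f i) \<circ> (c \<circ> f j)) (cadjoint (g i) \<circ> g j) =
      complex_of_real m * (cnj (k i) * k j * \<omega> (cadjoint (f i) \<circ> f j) (cadjoint (g i) \<circ> g j)) -
      cnj (k i) * k j * \<omega> (cadjoint (a \<circ> f i) \<circ> (a \<circ> f j)) (cadjoint (g i) \<circ> g j)"
      if i: "i \<in> I" and j: "j \<in> I" for i j
    proof -
      have "cadjoint (c \<circ> f i) \<circ> (c \<circ> f j) = cadjoint (f i) \<circ> (p \<circ> f j)"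
        using A_bounded c f[OF i] by (simp add: cadjoint_comp c(3)[symmetric] o_assoc)
      also have "p \<circ> f j = complex_of_real m *\<^sub>C f j - (cadjoint a \<circ> (a \<circ> f j))"
        by (simp add: p_def fun_eq_iff scaleC_fun_def)
      also have "cadjoint (f i) \<circ> (complex_of_real m *\<^sub>C f j - (cadjoint a \<circ> (a \<circ> f j))) =
          complex_of_real m *\<^sub>C (cadjoint (f i) \<circ> f j) - (cadjoint (a \<circ> f i) \<circ> (a \<circ> f j))"
        using A_bounded[OF A_closed(5)[OF f[OF i]]] A_bounded[OF f[OF i]] ba
        by (simp add: fun_eq_iff bounded_clinear_diff bounded_clinear_scaleC scaleC_fun_def cadjoint_comp)
      finally have op_eq: "cadjoint (c \<circ> f i) \<circ> (c \<circ> f j) =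
          complex_of_real m *\<^sub>C (cadjoint (f i) \<circ> f j) - (cadjoint (a \<circ> f i) \<circ> (a \<circ> f j))" .
      have "\<omega> (cadjoint (c \<circ> f i) \<circ> (c \<circ> f j)) (cadjoint (g i) \<circ> g j) =
          complex_of_real m * \<omega> (cadjoint (f i) \<circ> f j) (cadjoint (g i) \<circ> g j) -
          \<omega> (cadjoint (a \<circ> f i) \<circ> (a \<circ> f j)) (cadjoint (g i) \<circ> g j)"
        unfolding op_eq using a f[OF i] f[OF j] g[OF i] g[OF j]
        by (simp only: \<omega>_diff_left \<omega>_scale_left A_closed B_closed)
      then show ?thesis by (simp only: right_diff_distrib mult_ac)
    qed
    have "(\<Sum>i\<in>I. \<Sum>j\<in>I. cnj (k i) * k j * \<omega> (cadjoint (c \<circ> f i) \<circ> (c \<circ> f j)) (cadjoint (g i) \<circ> g j)) \<in> \<real>\<^sub>\<ge>\<^sub>0"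
      using I f g c by (intro \<omega>_positive) (auto simp: A_closed)
    then have "0 \<le> Re (\<Sum>i\<in>I. \<Sum>j\<in>I. cnj (k i) * k j * \<omega> (cadjoint (c \<circ> f i) \<circ> (c \<circ> f j)) (cadjoint (g i) \<circ> g j))"
      by (simp add: complex_nonneg_Reals_iff)
    then show ?thesis
      by (simp add: eq sum_subtractf flip: sum_distrib_left)
  qed
  with m show ?thesis by blast
qed

text \<open>The action on formal combinations, where positivity of \<open>\<omega>\<close> provides
  the norm bound. On functions the same action is \<open>act\<close>, which involves no choice of a
  combination; \<open>kemb_shift\<close> links the two.\<close>

definition shift :: "'g op \<Rightarrow> 'g op \<Rightarrow> 'g rep_vec \<Rightarrow> 'g rep_vec" where
  "shift a b c = (\<Sum>p\<in>supp c. c p *\<^sub>C point (a \<circ> fst p, b \<circ> snd p))"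

text \<open>A function \<open>v\<close> stands for the vector with \<open>v (p, q) = \<langle>\<pi>(p \<otimes> q) \<Omega>, v\<rangle>\<close>.\<close>

definition act :: "'g op \<Rightarrow> 'g op \<Rightarrow> 'g rep_vec \<Rightarrow> 'g rep_vec" where
  "act a b v = (\<lambda>p. if p \<in> A \<times> B then v (cadjoint a \<circ> fst p, cadjoint b \<circ> snd p) else 0)"

context
  fixes a b assumes a: "a \<in> A" and b: "b \<in> B"
begin

lemma moved_in: "p \<in> A \<times> B \<Longrightarrow> (a \<circ> fst p, b \<circ> snd p) \<in> A \<times> B"
  using a b by (auto simp: A_closed B_closed)

lemma shift_fin: "c \<in> fin \<Longrightarrow> shift a b c \<in> fin"
  unfolding shift_def using moved_in by (intro V_sum V_closed(3) point_fin) (auto simp: fin_def)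

lemma shift_superset:
  "finite F \<Longrightarrow> supp c \<subseteq> F \<Longrightarrow> shift a b c = (\<Sum>p\<in>F. c p *\<^sub>C point (a \<circ> fst p, b \<circ> snd p))"
  unfolding shift_def by (intro sum.mono_neutral_left) (auto simp: supp_def)

lemma shift_diff: "c \<in> fin \<Longrightarrow> d \<in> fin \<Longrightarrow> shift a b (c - d) = shift a b c - shift a b d"
proof -
  assume "c \<in> fin" "d \<in> fin"
  then have F: "finite (supp c \<union> supp d)" by (simp add: fin_def)
  have "supp (c - d) \<subseteq> supp c \<union> supp d" by (auto simp: supp_def)
  then show ?thesis
    using shift_superset[OF F, of c] shift_superset[OF F, of d] shift_superset[OF F, of "c - d"]
    by (simp add: complex_vector.scale_left_diff_distrib sum_subtractf)
qed

lemma kform_shift_left: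
  "c \<in> fin \<Longrightarrow> d \<in> fin \<Longrightarrow>
    kform (shift a b c) d = (\<Sum>p\<in>supp c. cnj (c p) * kemb d (a \<circ> fst p, b \<circ> snd p))"
proof -
  assume c: "c \<in> fin" and d: "d \<in> fin"
  have p: "(a \<circ> fst p, b \<circ> snd p) \<in> A \<times> B" if "p \<in> supp c" for p
    using c that moved_in by (auto simp: fin_def)
  have "kform (shift a b c) d = (\<Sum>p\<in>supp c. kform (c p *\<^sub>C point (a \<circ> fst p, b \<circ> snd p)) d)"
    unfolding shift_def using p d by (intro ip_sum_left V_closed(3) point_fin)
  also have "\<dots> = (\<Sum>p\<in>supp c. cnj (c p) * kemb d (a \<circ> fst p, b \<circ> snd p))"
    using p d by (intro sum.cong refl) (simp only: ip_scaleC_left point_fin kform_point)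
  finally show ?thesis .
qed

lemma kemb_shift_sum:
  assumes c: "c \<in> fin" and r: "r \<in> A \<times> B"
  shows "kemb (shift a b c) r = (\<Sum>p\<in>supp c. c p * ker r (a \<circ> fst p, b \<circ> snd p))"
proof -
  have p: "(a \<circ> fst p, b \<circ> snd p) \<in> A \<times> B" if "p \<in> supp c" for p
    using c that moved_in by (auto simp: fin_def)
  have "kemb (shift a b c) r = kform (point r) (shift a b c)" by (simp only: kform_point)
  also have "\<dots> = (\<Sum>p\<in>supp c. kform (point r) (c p *\<^sub>C point (a \<circ> fst p, b \<circ> snd p)))"
    unfolding shift_def using p r by (intro ip_sum_right V_closed(3) point_fin)
  also have "\<dots> = (\<Sum>p\<in>supp c. c p * ker r (a \<circ> fst p, b \<circ> snd p))"
    using p r by (intro sum.cong refl) (simp only: kform_point kemb_scale_apply point_fin kemb_point if_True)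
  finally show ?thesis .
qed

lemma kemb_shift: "c \<in> fin \<Longrightarrow> kemb (shift a b c) = act a b (kemb c)"
proof
  fix r assume c: "c \<in> fin"
  show "kemb (shift a b c) r = act a b (kemb c) r"
  proof (cases "r \<in> A \<times> B")
    case True
    then have r: "fst r \<in> A" "snd r \<in> B" by auto
    have "ker r (a \<circ> fst p, b \<circ> snd p) = ker (cadjoint a \<circ> fst r, cadjoint b \<circ> snd r) p" for p
      unfolding ker_def using a b r
      by (simp add: cadjoint_comp A_bounded B_bounded A_closed B_closed cadjoint_cadjoint o_assoc)
    moreover have "(cadjoint a \<circ> fst r, cadjoint b \<circ> snd r) \<in> A \<times> B"
      using a b r by (simp add: A_closed B_closed)
    ultimately show ?thesis
      using True kemb_shift_sum[OF c True] by (simp add: act_def kemb_def)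
  next
    case False
    then show ?thesis by (simp only: kemb_def act_def if_False)
  qed
qed

text \<open>The factors are removed one at a time: first \<open>a\<close>, with the right entries
  \<open>b \<circ> snd p\<close> held fixed, then \<open>b\<close> by the same bound for the
  exchanged factors.\<close>

lemma nrm_shift_bound:
  obtains m where "m > 0" "\<And>c. c \<in> fin \<Longrightarrow> nrm (shift a b c) \<le> m * nrm c"
proof -
  obtain m1 where m1: "m1 > 0" and bd1: "\<forall>(I :: ('g op \<times> 'g op) set) f g c. finite I \<longrightarrow> (\<forall>i\<in>I. f i \<in> A \<and> g i \<in> B) \<longrightarrow>
     Re (\<Sum>i\<in>I. \<Sum>j\<in>I. cnj (c i) * c j * \<omega> (cadjoint (a \<circ> f i) \<circ> (a \<circ> f j)) (cadjoint (g i) \<circ> g j))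
     \<le> m1 * Re (\<Sum>i\<in>I. \<Sum>j\<in>I. cnj (c i) * c j * \<omega> (cadjoint (f i) \<circ> f j) (cadjoint (g i) \<circ> g j))"
    using \<omega>_left_bound[OF a, where 'i = "'g op \<times> 'g op"] by blast
  obtain m2 where m2: "m2 > 0" and bd2: "\<forall>(I :: ('g op \<times> 'g op) set) f g c. finite I \<longrightarrow> (\<forall>i\<in>I. f i \<in> B \<and> g i \<in> A) \<longrightarrow>
     Re (\<Sum>i\<in>I. \<Sum>j\<in>I. cnj (c i) * c j * \<omega> (cadjoint (g i) \<circ> g j) (cadjoint (b \<circ> f i) \<circ> (b \<circ> f j)))
     \<le> m2 * Re (\<Sum>i\<in>I. \<Sum>j\<in>I. cnj (c i) * c j * \<omega> (cadjoint (g i) \<circ> g j) (cadjoint (f i) \<circ> f j))"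
    using tensor_functional.\<omega>_left_bound[OF swap b, where 'i = "'g op \<times> 'g op"] by blast
  have "nrm (shift a b c) \<le> sqrt (m1 * m2) * nrm c" if c: "c \<in> fin" for c
  proof -
    have F: "finite (supp c)" "\<And>p. p \<in> supp c \<Longrightarrow> fst p \<in> A" "\<And>p. p \<in> supp c \<Longrightarrow> snd p \<in> B"
      using c by (auto simp: fin_def)
    have mv: "(a \<circ> fst p, b \<circ> snd p) \<in> A \<times> B" if "p \<in> supp c" for p
      using c that moved_in by (auto simp: fin_def)
    have "Re (kform (shift a b c) (shift a b c)) =
        Re (\<Sum>p\<in>supp c. \<Sum>q\<in>supp c. cnj (c p) * c q *
          \<omega> (cadjoint (a \<circ> fst p) \<circ> (a \<circ> fst q)) (cadjoint (b \<circ> snd p) \<circ> (b \<circ> snd q)))"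
      by (simp only: kform_shift_left[OF c shift_fin[OF c]] kemb_shift_sum[OF c mv]
          sum_distrib_left ker_def fst_conv snd_conv mult.assoc cong: sum.cong)
    also have "\<dots> \<le> m1 * Re (\<Sum>p\<in>supp c. \<Sum>q\<in>supp c. cnj (c p) * c q *
          \<omega> (cadjoint (fst p) \<circ> fst q) (cadjoint (b \<circ> snd p) \<circ> (b \<circ> snd q)))"
      by (rule bd1[rule_format]) (simp_all add: F B_closed b)
    also have "\<dots> \<le> m1 * (m2 * Re (\<Sum>p\<in>supp c. \<Sum>q\<in>supp c. cnj (c p) * c q *
          \<omega> (cadjoint (fst p) \<circ> fst q) (cadjoint (snd p) \<circ> snd q)))"
      using m1 by (intro mult_left_mono bd2[rule_format]) (simp_all add: F)
    also have "(\<Sum>p\<in>supp c. \<Sum>q\<in>supp c. cnj (c p) * c q *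
          \<omega> (cadjoint (fst p) \<circ> fst q) (cadjoint (snd p) \<circ> snd q)) = kform c c"
      using c by (auto simp: kform_def kemb_def sum_distrib_left ker_def mult.assoc fin_def intro!: sum.cong)
    finally have "Re (kform (shift a b c) (shift a b c)) \<le> (m1 * m2) * Re (kform c c)" by simp
    then show ?thesis
      unfolding nrm_def real_sqrt_mult[symmetric] by (rule real_sqrt_le_mono)
  qed
  moreover have "sqrt (m1 * m2) > 0" using m1 m2 by simp
  ultimately show ?thesis using that by blast
qed

lemma represents_act:
  assumes s: "represents s v"
  shows "represents (\<lambda>n. shift a b (s n)) (act a b v)"
  unfolding represents_def
proof (intro conjI allI impI)
  note fs = represents_fin[OF s]
  show "shift a b (s n) \<in> fin" for n using fs by (rule shift_fin)
  show "(\<lambda>n. kemb (shift a b (s n)) p) \<longlonglongrightarrow> act a b v p" for p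
    using s unfolding represents_def by (simp add: kemb_shift act_def)
  obtain m where "\<And>c. c \<in> fin \<Longrightarrow> nrm (shift a b c) \<le> m * nrm c" using nrm_shift_bound by metis
  then have "nrm (shift a b (s i) - shift a b (s j)) \<le> m * nrm (s i - s j)" for i j
    using fs by (simp add: shift_diff[symmetric])
  then show "\<exists>N. \<forall>m\<ge>N. \<forall>n\<ge>N. nrm (shift a b (s m) - shift a b (s n)) < e" if "0 < e" for e
    using nrm_linear_image_cauchy[OF s, where L = "shift a b"] that by blast
qed

lemma act_H: "v \<in> H \<Longrightarrow> act a b v \<in> H"
  unfolding H_def using represents_act by blast

lemma act_bounded: "\<exists>m. \<forall>v\<in>H. H.nrm (act a b v) \<le> m * H.nrm v"
proof -
  obtain m where m: "\<And>c. c \<in> fin \<Longrightarrow> nrm (shift a b c) \<le> m * nrm c" using nrm_shift_bound by metis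
  have "H.nrm (act a b v) \<le> m * H.nrm v" if v: "v \<in> H" for v
  proof -
    obtain s where s: "represents s v" using v by (auto simp: H_def)
    show ?thesis
      by (rule LIMSEQ_le[OF nrm_limit[OF represents_act[OF s]] tendsto_mult_left[OF nrm_limit[OF s]]])
        (use m represents_fin[OF s] in blast)
  qed
  then show ?thesis by blast
qed

lemma act_kemb_point: "p \<in> A \<times> B \<Longrightarrow> act a b (kemb (point p)) = kemb (point (a \<circ> fst p, b \<circ> snd p))"
proof -
  assume p: "p \<in> A \<times> B"
  have "shift a b (point p) = point (a \<circ> fst p, b \<circ> snd p)"
    unfolding shift_def supp_point by (simp add: scaleC_one) (simp add: point_def scaleC_one)
  then show ?thesis using kemb_shift[of "point p"] p by simp
qed

end

lemma act_adjoint: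
  assumes a: "a \<in> A" and b: "b \<in> B" and v: "v \<in> H" and w: "w \<in> H"
  shows "kip (act a b v) w = kip v (act (cadjoint a) (cadjoint b) w)"
proof -
  have ab': "cadjoint a \<in> A" "cadjoint b \<in> B" using a b by (auto simp: A_closed B_closed)
  have eq: "kform (shift a b c) d = kform c (shift (cadjoint a) (cadjoint b) d)"
    if c: "c \<in> fin" and d: "d \<in> fin" for c d
  proof -
    have "act (cadjoint a) (cadjoint b) (kemb d) p = kemb d (a \<circ> fst p, b \<circ> snd p)"
      if "p \<in> supp c" for p
    proof -
      have "p \<in> A \<times> B" using that c by (auto simp: fin_def)
      then show ?thesis using a b by (simp add: act_def cadjoint_cadjoint A_bounded B_bounded)
    qed
    then show ?thesis
      by (simp add: kform_shift_left[OF a b c d] kform_def[of c] kemb_shift[OF ab' d])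
  qed
  obtain s t where s: "represents s v" and t: "represents t w" using v w by (auto simp: H_def)
  show ?thesis
  proof (rule kip_eqI[OF represents_act[OF a b s] t])
    have "(\<lambda>n. kform (s n) (shift (cadjoint a) (cadjoint b) (t n)))
        \<longlonglongrightarrow> kip v (act (cadjoint a) (cadjoint b) w)"
      by (rule kip_limit[OF s represents_act[OF ab' t]])
    then show "(\<lambda>n. kform (shift a b (s n)) (t n)) \<longlonglongrightarrow> kip v (act (cadjoint a) (cadjoint b) w)"
      by (simp only: eq[OF represents_fin[OF s] represents_fin[OF t]])
  qed
qed

lemma ker_conj_linear:
  assumes "a \<in> A" "b \<in> B" "q \<in> A \<times> B"
  shows "a' \<in> A \<Longrightarrow> ker (a + a', b) q = ker (a, b) q + ker (a', b) q"
    and "b' \<in> B \<Longrightarrow> ker (a, b + b') q = ker (a, b) q + ker (a, b') q"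
    and "ker (c *\<^sub>C a, b) q = cnj c * ker (a, b) q"
    and "ker (a, c *\<^sub>C b) q = cnj c * ker (a, b) q"
  using assms by (auto simp: ker_def cadjoint_plus cadjoint_scaleC A_bounded B_bounded plus_comp
      scaleC_comp \<omega>_add_left \<omega>_add_right \<omega>_scale_left \<omega>_scale_right A_closed B_closed)

text \<open>A value \<open>v (a, b)\<close> is the product of a vector depending linearly on
  \<open>a\<close> and on \<open>b\<close> with \<open>v\<close>, hence conjugate linear. The
  adjoints in \<open>act\<close> undo the conjugation, so \<open>act\<close> is linear in its
  operators.\<close>

lemma H_conj_linear:
  assumes v: "v \<in> H" and a: "a \<in> A" and b: "b \<in> B"
  shows "a' \<in> A \<Longrightarrow> v (a + a', b) = v (a, b) + v (a', b)"
    and "b' \<in> B \<Longrightarrow> v (a, b + b') = v (a, b) + v (a, b')"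
    and "v (c *\<^sub>C a, b) = cnj c * v (a, b)"
    and "v (a, c *\<^sub>C b) = cnj c * v (a, b)"
proof -
  obtain s where s: "represents s v" using v by (auto simp: H_def)
  then have lim: "(\<lambda>n. kemb (s n) p) \<longlonglongrightarrow> v p" for p unfolding represents_def by blast
  have sq: "q \<in> A \<times> B" if "q \<in> supp (s n)" for q n
    using represents_fin[OF s, of n] that by (auto simp: fin_def)
  show "v (a + a', b) = v (a, b) + v (a', b)" if "a' \<in> A"
  proof (rule LIMSEQ_unique[OF lim])
    have "kemb (s n) (a + a', b) = kemb (s n) (a, b) + kemb (s n) (a', b)" for n
      using a b that sq
      by (simp add: kemb_def A_closed ker_conj_linear distrib_left sum.distrib cong: sum.cong)
    then show "(\<lambda>n. kemb (s n) (a + a', b)) \<longlonglongrightarrow> v (a, b) + v (a', b)"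
      using tendsto_add[OF lim lim] by simp
  qed
  show "v (a, b + b') = v (a, b) + v (a, b')" if "b' \<in> B"
  proof (rule LIMSEQ_unique[OF lim])
    have "kemb (s n) (a, b + b') = kemb (s n) (a, b) + kemb (s n) (a, b')" for n
      using a b that sq
      by (simp add: kemb_def B_closed ker_conj_linear distrib_left sum.distrib cong: sum.cong)
    then show "(\<lambda>n. kemb (s n) (a, b + b')) \<longlonglongrightarrow> v (a, b) + v (a, b')"
      using tendsto_add[OF lim lim] by simp
  qed
  show "v (c *\<^sub>C a, b) = cnj c * v (a, b)"
  proof (rule LIMSEQ_unique[OF lim])
    have "kemb (s n) (c *\<^sub>C a, b) = cnj c * kemb (s n) (a, b)" for n
      using a b sq
      by (simp add: kemb_def A_closed ker_conj_linear sum_distrib_left mult_ac cong: sum.cong)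
    then show "(\<lambda>n. kemb (s n) (c *\<^sub>C a, b)) \<longlonglongrightarrow> cnj c * v (a, b)"
      using tendsto_mult_left[OF lim] by simp
  qed
  show "v (a, c *\<^sub>C b) = cnj c * v (a, b)"
  proof (rule LIMSEQ_unique[OF lim])
    have "kemb (s n) (a, c *\<^sub>C b) = cnj c * kemb (s n) (a, b)" for n
      using a b sq
      by (simp add: kemb_def B_closed ker_conj_linear sum_distrib_left mult_ac cong: sum.cong)
    then show "(\<lambda>n. kemb (s n) (a, c *\<^sub>C b)) \<longlonglongrightarrow> cnj c * v (a, b)"
      using tendsto_mult_left[OF lim] by simp
  qed
qed

section \<open>The kernel space as a cyclic representation\<close>

definition gns :: "'g tensor_rep" where
  "gns = \<lparr>rep_space = H, rep_inner = kip, rep_act = act, rep_cyc = kemb (point (id, id))\<rparr>"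

lemma rep_norm_gns: "rep_norm gns = H.nrm"
  by (simp add: fun_eq_iff rep_norm_def gns_def H.nrm_def)

lemma hilbert_rep_space_gns: "hilbert_rep_space gns"
proof -
  have sel: "rep_space gns = H" "rep_inner gns = kip" by (simp_all add: gns_def)
  show ?thesis
    unfolding hilbert_rep_space_def rep_norm_gns sel
  proof (intro conjI allI ballI impI)
    fix X :: "nat \<Rightarrow> 'g rep_vec"
    assume X: "range X \<subseteq> H \<and> (\<forall>e>0. \<exists>M. \<forall>m\<ge>M. \<forall>n\<ge>M. H.nrm (X m - X n) < e)"
    then have "X n \<in> H" for n by blast
    then show "\<exists>v\<in>H. (\<lambda>n. H.nrm (X n - v)) \<longlonglongrightarrow> 0" using X by (intro H_complete) auto
  qed (rule H_subspace H.ip_add_right H.ip_scaleC_right H.ip_commute H.ip_nonneg kip_definite; assumption)+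
qed

lemma id_in: "(id, id) \<in> A \<times> B" by (simp add: A_closed B_closed)

lemma act_algebra:
  assumes v: "v \<in> H"
  shows "a \<in> A \<Longrightarrow> a' \<in> A \<Longrightarrow> b \<in> B \<Longrightarrow> act (a + a') b v = act a b v + act a' b v"
    and "a \<in> A \<Longrightarrow> b \<in> B \<Longrightarrow> b' \<in> B \<Longrightarrow> act a (b + b') v = act a b v + act a b' v"
    and "a \<in> A \<Longrightarrow> b \<in> B \<Longrightarrow> act (c *\<^sub>C a) b v = c *\<^sub>C act a b v"
    and "a \<in> A \<Longrightarrow> b \<in> B \<Longrightarrow> act a (c *\<^sub>C b) v = c *\<^sub>C act a b v"
    and "act id id v = v"
    and "a \<in> A \<Longrightarrow> a' \<in> A \<Longrightarrow> b \<in> B \<Longrightarrow> b' \<in> B \<Longrightarrow> act (a \<circ> a') (b \<circ> b') v = act a b (act a' b' v)"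
proof -
  have point: "act a b w = w'"
    if "\<And>p q. p \<in> A \<Longrightarrow> q \<in> B \<Longrightarrow> w (cadjoint a \<circ> p, cadjoint b \<circ> q) = w' (p, q)"
      and "\<And>p. p \<notin> A \<times> B \<Longrightarrow> w' p = 0" for a b w w'
    using that by (force simp: act_def)
  have act_in: "act a b w (p, q) = w (cadjoint a \<circ> p, cadjoint b \<circ> q)" if "p \<in> A" "q \<in> B" for a b w p q
    using that by (simp add: act_def)
  have act_out: "act a b w p = 0" if "p \<notin> A \<times> B" for a b w p
    using that unfolding act_def by (rule if_not_P)
  show "act (a + a') b v = act a b v + act a' b v" if "a \<in> A" "a' \<in> A" "b \<in> B"
    using that by (intro point)
      (simp_all add: act_in act_out cadjoint_plus A_bounded plus_comp H_conj_linear[OF v] A_closed B_closed)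
  show "act a (b + b') v = act a b v + act a b' v" if "a \<in> A" "b \<in> B" "b' \<in> B"
    using that by (intro point)
      (simp_all add: act_in act_out cadjoint_plus B_bounded plus_comp H_conj_linear[OF v] A_closed B_closed)
  have scale: "(c *\<^sub>C w) p = c * w p" for c and w :: "'g rep_vec" and p
    by (simp add: scaleC_fun_def scaleC_complex_def)
  show "act (c *\<^sub>C a) b v = c *\<^sub>C act a b v" if "a \<in> A" "b \<in> B"
    using that by (intro point) (simp_all add: scale act_in act_out cadjoint_scaleC A_bounded scaleC_comp
        H_conj_linear[OF v] A_closed B_closed)
  show "act a (c *\<^sub>C b) v = c *\<^sub>C act a b v" if "a \<in> A" "b \<in> B"
    using that by (intro point) (simp_all add: scale act_in act_out cadjoint_scaleC B_bounded scaleC_comp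
        H_conj_linear[OF v] A_closed B_closed)
  show "act id id v = v" by (rule point) (simp_all add: H_outside[OF v])
  show "act (a \<circ> a') (b \<circ> b') v = act a b (act a' b' v)" if "a \<in> A" "a' \<in> A" "b \<in> B" "b' \<in> B"
    using that by (intro point) (simp_all add: act_in act_out cadjoint_comp A_bounded B_bounded
        A_closed B_closed o_assoc)
qed

text \<open>The embedded point of \<open>(a, b)\<close> is the image of the embedded point
  \<open>(id, id)\<close> under \<open>act a b\<close>, so the span contains every embedded
  combination, and these are dense by \<open>represents_nrm_tendsto\<close>.\<close>

lemma closure_gns:
  "rep_closure gns (cspan {rep_act gns a b (rep_cyc gns) |a b. a \<in> A \<and> b \<in> B}) = rep_space gns"
proof -
  let ?G = "{rep_act gns a b (rep_cyc gns) |a b. a \<in> A \<and> b \<in> B}"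
  have "H \<subseteq> rep_closure gns (cspan ?G)"
  proof
    fix v assume v: "v \<in> H"
    then obtain s where s: "represents s v" by (auto simp: H_def)
    have emb: "kemb c \<in> cspan ?G" if c: "c \<in> fin" for c
    proof -
      have cp: "p \<in> A \<times> B" if "p \<in> supp c" for p using c that by (auto simp: fin_def)
      have "kemb (\<Sum>p\<in>F. c p *\<^sub>C point p) = (\<Sum>p\<in>F. c p *\<^sub>C kemb (point p))" if "F \<subseteq> supp c" "finite F" for F
        using that(2,1)
      proof (induction F)
        case empty
        then show ?case by (simp add: fun_eq_iff kemb_def supp_def)
      next
        case (insert p F)
        have "point p \<in> fin" "(\<Sum>p\<in>F. c p *\<^sub>C point p) \<in> fin"
          using insert.prems cp by (auto intro!: V_sum V_closed(3) point_fin)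
        then have "kemb (c p *\<^sub>C point p + (\<Sum>p\<in>F. c p *\<^sub>C point p)) =
            c p *\<^sub>C kemb (point p) + kemb (\<Sum>p\<in>F. c p *\<^sub>C point p)"
          by (simp only: kemb_add kemb_scale V_closed(3))
        with insert show ?case by (simp only: sum.insert insert_subset simp_thms)
      qed
      note sum_eq = this
      have "finite (supp c)" using c by (simp add: fin_def)
      then have "kemb c = (\<Sum>p\<in>supp c. c p *\<^sub>C kemb (point p))"
        using arg_cong[OF fin_decompose[OF c], of kemb] sum_eq[OF subset_refl] by (rule_tac trans)
      moreover have "kemb (point p) \<in> ?G" if "p \<in> supp c" for p
      proof -
        have "kemb (point p) = act (fst p) (snd p) (kemb (point (id, id)))"
          using act_kemb_point[OF _ _ id_in, of "fst p" "snd p"] cp[OF that] by auto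
        moreover have "fst p \<in> A" "snd p \<in> B" using cp[OF that] by auto
        ultimately show ?thesis by (simp add: gns_def) blast
      qed
      ultimately show ?thesis
        by (simp only:) (intro complex_vector.span_sum complex_vector.span_scale complex_vector.span_base)
    qed
    have "range (\<lambda>n. kemb (s n)) \<subseteq> cspan ?G" using emb represents_fin[OF s] by blast
    then show "v \<in> rep_closure gns (cspan ?G)"
      using v represents_nrm_tendsto[OF s] unfolding rep_closure_def rep_norm_gns
      by (simp add: gns_def) blast
  qed
  then show ?thesis by (auto simp: rep_closure_def gns_def)
qed

lemma cyclic_representation_gns: "cyclic_representation A B \<omega> gns"
proof -
  have sel: "rep_space gns = H" "rep_inner gns = kip" "rep_act gns = act"
    "rep_cyc gns = kemb (point (id, id))" by (simp_all add: gns_def)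
  have act_vec: "act a b (v + w) = act a b v + act a b w" "act a b (c *\<^sub>C v) = c *\<^sub>C act a b v" for a b v w c
    by (auto simp: act_def fun_eq_iff scaleC_fun_def scaleC_complex_def)
  have "\<omega> a b = kip (kemb (point (id, id))) (act a b (kemb (point (id, id))))" if "a \<in> A" "b \<in> B" for a b
    using that id_in act_kemb_point[OF that id_in] by (simp add: kip_kemb kform_point kemb_point ker_def A_closed B_closed)
  note cyc = this
  have cyc_H: "kemb (point (id, id)) \<in> H" using id_in by blast
  show ?thesis
    unfolding cyclic_representation_def rep_norm_gns sel
    by (intro conjI ballI allI)
      (rule hilbert_rep_space_gns act_H act_vec act_bounded act_algebra act_adjoint cyc_H
        closure_gns[unfolded sel] cyc; assumption)+
qed

end

section \<open>The completely positive map of a transport plan\<close>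

lemma norm_le_dense:
  fixes v :: "'g::complex_hilbert_space"
  assumes D: "closure D = UNIV" and "0 \<le> C" and le: "\<And>d. d \<in> D \<Longrightarrow> cmod (cinner v d) \<le> C * norm d"
  shows "norm v \<le> C"
proof -
  obtain s where s: "\<forall>n. s n \<in> D" "s \<longlonglongrightarrow> v" using D closure_sequential[of v D] by auto
  have "cmod (cinner v v) \<le> C * norm v"
  proof (rule LIMSEQ_le)
    show "(\<lambda>n. cmod (cinner v (s n))) \<longlonglongrightarrow> cmod (cinner v v)"
      by (intro tendsto_norm tendsto_cinner tendsto_const s(2))
    show "(\<lambda>n. C * norm (s n)) \<longlonglongrightarrow> C * norm v"
      by (intro tendsto_mult tendsto_norm tendsto_const s(2))
  qed (use s(1) le in blast)
  then have "norm v * norm v \<le> C * norm v" by (simp add: cinner_self norm_mult power2_eq_square)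
  then show ?thesis using \<open>0 \<le> C\<close> by (cases "norm v = 0") auto
qed

lemma bounded_clinear_dense_eqI:
  fixes S T :: "'g::complex_hilbert_space op"
  assumes S: "bounded_clinear S" and T: "bounded_clinear T"
    and D: "closure D = UNIV" and eq: "\<And>d. d \<in> D \<Longrightarrow> S d = T d"
  shows "S = T"
proof
  fix x
  obtain s where s: "\<forall>n. s n \<in> D" "s \<longlonglongrightarrow> x" using D closure_sequential[of x D] by auto
  have "(\<lambda>n. S (s n)) \<longlonglongrightarrow> S x" "(\<lambda>n. T (s n)) \<longlonglongrightarrow> T x"
    using s(2) by (auto intro: bounded_clinear_tendsto S T)
  then show "S x = T x" using s(1) eq LIMSEQ_unique by simp
qed

text \<open>Meant for functionals on vectors \<open>b \<Lambda>\<close> that are given by a formula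
  in the operator \<open>b\<close>. The bound by \<open>norm (e x)\<close> serves twice: it makes
  the value independent of the parameter \<open>x\<close>, and it is the bound for Riesz.\<close>

lemma riesz_parametrized:
  fixes e :: "'v::complex_vector \<Rightarrow> 'g::complex_hilbert_space" and g :: "'v \<Rightarrow> complex"
  assumes B: "csubspace B"
    and e: "\<And>x y. x \<in> B \<Longrightarrow> y \<in> B \<Longrightarrow> e (x + y) = e x + e y" "\<And>c x. x \<in> B \<Longrightarrow> e (c *\<^sub>C x) = c *\<^sub>C e x"
    and g: "\<And>x y. x \<in> B \<Longrightarrow> y \<in> B \<Longrightarrow> g (x + y) = g x + g y" "\<And>c x. x \<in> B \<Longrightarrow> g (c *\<^sub>C x) = c * g x"
    and le: "\<And>x. x \<in> B \<Longrightarrow> cmod (g x) \<le> C * norm (e x)" and "0 \<le> C"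
  shows "\<exists>z. norm z \<le> C \<and> (\<forall>x\<in>B. cinner z (e x) = g x)"
proof -
  have eq: "g x = g y" if "x \<in> B" "y \<in> B" "e x = e y" for x y
  proof -
    have m: "x + (-1) *\<^sub>C y \<in> B" "(-1) *\<^sub>C y \<in> B"
      using that B by (auto intro: complex_vector.subspace_diff complex_vector.subspace_neg)
    have "e (x + (-1) *\<^sub>C y) = e x + (-1) *\<^sub>C e x"
      using e(1)[OF that(1) m(2)] e(2)[OF that(2), of "-1"] that(3) by (simp only:)
    also have "\<dots> = (1 + (-1)) *\<^sub>C e x" by (simp only: scaleC_add_left scaleC_one)
    finally have "e (x + (-1) *\<^sub>C y) = 0" by simp
    then have "g (x + (-1) *\<^sub>C y) = 0" using le[OF m(1)] by simp
    then have "g x + (-1) * g y = 0" using g(1)[OF that(1) m(2)] g(2)[OF that(2), of "-1"] by (simp only:)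
    then show ?thesis by simp
  qed
  define r where "r d = (SOME x. x \<in> B \<and> e x = d)" for d
  have r: "r d \<in> B" "e (r d) = d" if "d \<in> e ` B" for d
    using that someI_ex[of "\<lambda>x. x \<in> B \<and> e x = d"] by (auto simp: r_def)
  have D: "csubspace (e ` B)"
    unfolding complex_vector.subspace_def
  proof (intro conjI ballI allI)
    have "e 0 = 0"
      using e(2)[of 0 0] complex_vector.subspace_0[OF B] by simp
    then show "0 \<in> e ` B" using complex_vector.subspace_0[OF B] by (metis image_eqI)
    show "x + y \<in> e ` B" if xy: "x \<in> e ` B" "y \<in> e ` B" for x y
    proof -
      obtain u v where uv: "u \<in> B" "v \<in> B" "x = e u" "y = e v" using xy by blast
      then have "x + y = e (u + v)" using e(1) by simp
      then show ?thesis using complex_vector.subspace_add[OF B uv(1,2)] by blast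
    qed
    show "c *\<^sub>C x \<in> e ` B" if x: "x \<in> e ` B" for c x
    proof -
      obtain u where u: "u \<in> B" "x = e u" using x by blast
      then have "c *\<^sub>C x = e (c *\<^sub>C u)" using e(2) by simp
      then show ?thesis using complex_vector.subspace_scale[OF B u(1)] by blast
    qed
  qed
  have "\<exists>z\<in>closure (e ` B). norm z \<le> C \<and> (\<forall>d\<in>e ` B. cinner z d = g (r d))"
  proof (rule riesz_on_subspace[OF D _ _ _ \<open>0 \<le> C\<close>])
    show "g (r (x + y)) = g (r x) + g (r y)" if x: "x \<in> e ` B" and y: "y \<in> e ` B" for x y
    proof -
      have "x + y \<in> e ` B" using D x y by (rule complex_vector.subspace_add)
      then have "g (r (x + y)) = g (r x + r y)"
        using r x y e B by (intro eq) (auto simp: complex_vector.subspace_add)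
      then show ?thesis using g r x y by simp
    qed
    show "g (r (c *\<^sub>C x)) = c * g (r x)" if x: "x \<in> e ` B" for c x
    proof -
      have "c *\<^sub>C x \<in> e ` B" using D x by (rule complex_vector.subspace_scale)
      then have "g (r (c *\<^sub>C x)) = g (c *\<^sub>C r x)"
        using r x e B by (intro eq) (auto simp: complex_vector.subspace_scale)
      then show ?thesis using g r x by simp
    qed
    show "cmod (g (r x)) \<le> C * norm x" if "x \<in> e ` B" for x using le[of "r x"] r[OF that] by simp
  qed
  then obtain z where z: "norm z \<le> C" "\<And>d. d \<in> e ` B \<Longrightarrow> cinner z d = g (r d)" by blast
  have "cinner z (e x) = g x" if "x \<in> B" for x
    using z(2)[of "e x"] eq[of "r (e x)" x] r[of "e x"] that by auto
  with z(1) show ?thesis by blast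
qed

text \<open>Riesz is used twice. The first use yields vectors \<open>R x\<close> that represent the
  form, indexed by parameters only; the second takes the adjoint of
  \<open>e x \<mapsto> R x\<close>, which is defined on the whole space at once, without an
  extension by continuity.\<close>

lemma form_operator:
  fixes e :: "'v::complex_vector \<Rightarrow> 'g::complex_hilbert_space" and F :: "'v \<Rightarrow> 'v \<Rightarrow> complex"
  assumes B: "csubspace B"
    and e: "\<And>x y. x \<in> B \<Longrightarrow> y \<in> B \<Longrightarrow> e (x + y) = e x + e y" "\<And>c x. x \<in> B \<Longrightarrow> e (c *\<^sub>C x) = c *\<^sub>C e x"
    and F_left: "\<And>x x' y. x \<in> B \<Longrightarrow> x' \<in> B \<Longrightarrow> y \<in> B \<Longrightarrow> F (x + x') y = F x y + F x' y"
      "\<And>c x y. x \<in> B \<Longrightarrow> y \<in> B \<Longrightarrow> F (c *\<^sub>C x) y = cnj c * F x y"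
    and F_right: "\<And>x y y'. x \<in> B \<Longrightarrow> y \<in> B \<Longrightarrow> y' \<in> B \<Longrightarrow> F x (y + y') = F x y + F x y'"
      "\<And>c x y. x \<in> B \<Longrightarrow> y \<in> B \<Longrightarrow> F x (c *\<^sub>C y) = c * F x y"
    and le: "\<And>x y. x \<in> B \<Longrightarrow> y \<in> B \<Longrightarrow> cmod (F x y) \<le> C * norm (e x) * norm (e y)" and C: "0 \<le> C"
    and dense: "closure (e ` B) = UNIV"
  shows "\<exists>T. bounded_clinear T \<and> (\<forall>x\<in>B. \<forall>y\<in>B. cinner (e x) (T (e y)) = F x y)"
proof -
  have "\<exists>z. norm z \<le> C * norm (e x) \<and> (\<forall>y\<in>B. cinner z (e y) = F x y)" if "x \<in> B" for x
    using that C by (intro riesz_parametrized[OF B e]) (auto simp: F_right le)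
  then obtain R where R: "\<And>x. x \<in> B \<Longrightarrow> norm (R x) \<le> C * norm (e x)"
    "\<And>x y. x \<in> B \<Longrightarrow> y \<in> B \<Longrightarrow> cinner (R x) (e y) = F x y" by metis
  note Bc = complex_vector.subspace_add[OF B] complex_vector.subspace_scale[OF B]
  have R_add: "R (x + x') = R x + R x'" if "x \<in> B" "x' \<in> B" for x x'
    using that by (intro cinner_dense_eqI[OF dense]) (auto simp: R cinner_add_left F_left Bc)
  have R_scale: "R (c *\<^sub>C x) = c *\<^sub>C R x" if "x \<in> B" for x c
    using that by (intro cinner_dense_eqI[OF dense]) (auto simp: R cinner_scaleC_left F_left Bc)
  have "\<exists>w. norm w \<le> C * norm z \<and> (\<forall>x\<in>B. cinner w (e x) = cinner z (R x))" for z
  proof (rule riesz_parametrized[OF B e])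
    show "cmod (cinner z (R x)) \<le> C * norm z * norm (e x)" if "x \<in> B" for x
      using cmod_cinner_le[of z "R x"] mult_left_mono[OF R(1)[OF that], of "norm z"] by (simp add: mult_ac)
  qed (use C in \<open>auto simp: R_add R_scale cinner_add_right cinner_scaleC_right\<close>)
  then obtain T where T: "\<And>z. norm (T z) \<le> C * norm z"
    "\<And>z x. x \<in> B \<Longrightarrow> cinner (T z) (e x) = cinner z (R x)" by metis
  have "bounded_clinear T"
  proof (rule bounded_clinearI[OF _ _ T(1)])
    show "T (x + y) = T x + T y" for x y
      by (rule cinner_dense_eqI[OF dense]) (auto simp: T cinner_add_left)
    show "T (c *\<^sub>C x) = c *\<^sub>C T x" for c x
      by (rule cinner_dense_eqI[OF dense]) (auto simp: T cinner_scaleC_left)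
  qed
  moreover have "cinner (e x) (T (e y)) = F x y" if "x \<in> B" "y \<in> B" for x y
    using T(2)[OF that(1), of "e y"] R(2)[OF that] by (metis cinner_commute)
  ultimately show ?thesis by blast
qed

lemma vna_csubspace: "von_neumann_algebra A \<Longrightarrow> csubspace A"
  unfolding complex_vector.subspace_def
  using vna_plus vna_scaleC vna_scaleC[of A id 0] vna_id by force

text \<open>Only the marginal on \<open>B\<close>, given by \<open>\<Lambda>\<close>, is prescribed.
  So a plan is an instance with its target vector and, after exchange of the factors, another one
  with its source vector.\<close>

locale right_plan = tensor_functional A B \<omega>
  for A B :: "'g::complex_hilbert_space op set" and \<omega> +
  fixes \<Lambda> :: 'g
  assumes A_commutant: "A = commutant B"
    and dense: "closure ((\<lambda>b. b \<Lambda>) ` B) = UNIV"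
    and marginal: "b \<in> B \<Longrightarrow> \<omega> id b = cinner \<Lambda> (b \<Lambda>)"
begin

lemma commute: "a \<in> A \<Longrightarrow> b \<in> B \<Longrightarrow> b (a x) = a (b x)"
  using commutant_commute[of b B a] A_commutant by simp

lemma \<omega>_bound_left: "a \<in> A \<Longrightarrow> b \<in> B \<Longrightarrow> (cmod (\<omega> a b))\<^sup>2 \<le> Re (\<omega> (a \<circ> cadjoint a) id) * (norm (b \<Lambda>))\<^sup>2"
proof -
  assume a: "a \<in> A" and b: "b \<in> B"
  have "(cmod (ker (cadjoint a, id) (id, b)))\<^sup>2 \<le> Re (ker (cadjoint a, id) (cadjoint a, id)) * Re (ker (id, b) (id, b))"
    using a b by (intro kernel_cauchy_schwarz) (auto simp: A_closed B_closed)
  then show ?thesis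
    using a b by (simp add: ker_def cadjoint_cadjoint A_bounded B_bounded marginal B_closed
        cadjoint_left[symmetric] cadjoint_left cinner_self cadjoint_right[symmetric] del: of_real_power)
qed

text \<open>The value is the product of the vectors of \<open>cadjoint a \<otimes> x\<close> and
  \<open>1 \<otimes> y\<close>. After Cauchy-Schwarz, \<open>\<omega>_left_bound\<close> over a
  one-point index set removes \<open>cadjoint a\<close>, and the marginal turns the remaining norms
  into those of \<open>x \<Lambda>\<close> and \<open>y \<Lambda>\<close>.\<close>

lemma \<omega>_form_bound:
  assumes a: "a \<in> A"
  shows "\<exists>C\<ge>0. \<forall>x\<in>B. \<forall>y\<in>B. cmod (\<omega> a (cadjoint x \<circ> y)) \<le> C * norm (x \<Lambda>) * norm (y \<Lambda>)"
proof -
  have a': "cadjoint a \<in> A" using a by (simp add: A_closed)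
  obtain m where m: "m > 0" and bd: "\<forall>(I :: unit set) f g c. finite I \<longrightarrow> (\<forall>i\<in>I. f i \<in> A \<and> g i \<in> B) \<longrightarrow>
     Re (\<Sum>i\<in>I. \<Sum>j\<in>I. cnj (c i) * c j * \<omega> (cadjoint (cadjoint a \<circ> f i) \<circ> (cadjoint a \<circ> f j)) (cadjoint (g i) \<circ> g j))
     \<le> m * Re (\<Sum>i\<in>I. \<Sum>j\<in>I. cnj (c i) * c j * \<omega> (cadjoint (f i) \<circ> f j) (cadjoint (g i) \<circ> g j))"
    using \<omega>_left_bound[OF a', where 'i = unit] by blast
  have norm2: "Re (\<omega> id (cadjoint x \<circ> x)) = (norm (x \<Lambda>))\<^sup>2" if "x \<in> B" for x
    using that by (simp add: marginal B_closed cadjoint_right[OF B_bounded, symmetric] cinner_self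
        del: of_real_power)
  have "cmod (\<omega> a (cadjoint x \<circ> y)) \<le> sqrt m * norm (x \<Lambda>) * norm (y \<Lambda>)" if x: "x \<in> B" and y: "y \<in> B" for x y
  proof (rule power2_le_imp_le)
    have "(cmod (ker (cadjoint a, x) (id, y)))\<^sup>2 \<le> Re (ker (cadjoint a, x) (cadjoint a, x)) * Re (ker (id, y) (id, y))"
      using a' x y by (intro kernel_cauchy_schwarz) (auto simp: A_closed)
    also have "\<dots> \<le> (m * (norm (x \<Lambda>))\<^sup>2) * (norm (y \<Lambda>))\<^sup>2"
    proof (rule mult_mono)
      show "Re (ker (cadjoint a, x) (cadjoint a, x)) \<le> m * (norm (x \<Lambda>))\<^sup>2"
        using bd[rule_format, of UNIV "\<lambda>_. id" "\<lambda>_. x" "\<lambda>_. 1"] x by (simp add: ker_def norm2 A_closed UNIV_unit)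
      show "Re (ker (id, y) (id, y)) \<le> (norm (y \<Lambda>))\<^sup>2" using y by (simp add: ker_def norm2)
      show "0 \<le> Re (ker (id, y) (id, y))" using y by (simp add: ker_def norm2)
    qed (use m in simp)
    finally show "(cmod (\<omega> a (cadjoint x \<circ> y)))\<^sup>2 \<le> (sqrt m * norm (x \<Lambda>) * norm (y \<Lambda>))\<^sup>2"
      using a m by (simp add: ker_def cadjoint_cadjoint A_bounded power_mult_distrib)
  qed (use m in simp)
  then show ?thesis using m by (intro exI[of _ "sqrt m"]) auto
qed

text \<open>A Radon-Nikodym argument: the bounded form on \<open>B \<Lambda>\<close> comes from an
  operator \<open>T\<close>. Inside \<open>cadjoint x \<circ> y\<close> an element of
  \<open>B\<close> can be moved from \<open>y\<close> to \<open>x\<close>, so \<open>T\<close>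
  commutes with \<open>B\<close> and lies in \<open>commutant B = A\<close>.\<close>

lemma cp_exists:
  assumes a: "a \<in> A"
  shows "\<exists>T\<in>A. \<forall>x\<in>B. \<forall>y\<in>B. cinner (x \<Lambda>) (T (y \<Lambda>)) = \<omega> a (cadjoint x \<circ> y)"
proof -
  obtain C where C: "C \<ge> 0" "\<forall>x\<in>B. \<forall>y\<in>B. cmod (\<omega> a (cadjoint x \<circ> y)) \<le> C * norm (x \<Lambda>) * norm (y \<Lambda>)"
    using \<omega>_form_bound[OF a] by blast
  have "\<exists>T. bounded_clinear T \<and> (\<forall>x\<in>B. \<forall>y\<in>B. cinner (x \<Lambda>) (T (y \<Lambda>)) = \<omega> a (cadjoint x \<circ> y))"
    by (rule form_operator[OF vna_csubspace[OF vB] _ _ _ _ _ _ _ C(1) dense])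
      (use a C(2) in \<open>simp_all add: scaleC_fun_def[of _ _, THEN fun_cong] cadjoint_plus cadjoint_scaleC
          B_bounded plus_comp scaleC_comp comp_plus comp_scaleC \<omega>_add_right \<omega>_scale_right B_closed\<close>)
  then obtain T where bT: "bounded_clinear T"
    and T: "\<And>x y. x \<in> B \<Longrightarrow> y \<in> B \<Longrightarrow> cinner (x \<Lambda>) (T (y \<Lambda>)) = \<omega> a (cadjoint x \<circ> y)" by blast
  have "b \<circ> T = T \<circ> b" if b: "b \<in> B" for b
  proof (rule bounded_clinear_dense_eqI[OF _ _ dense])
    show "bounded_clinear (b \<circ> T)" "bounded_clinear (T \<circ> b)"
      using b bT by (auto intro: bounded_clinear_comp B_bounded)
    fix d assume "d \<in> (\<lambda>b. b \<Lambda>) ` B"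
    then obtain y where y: "y \<in> B" "d = y \<Lambda>" by blast
    show "(b \<circ> T) d = (T \<circ> b) d"
    proof (rule cinner_dense_eqI[OF dense])
      fix w assume "w \<in> (\<lambda>b. b \<Lambda>) ` B"
      then obtain x where x: "x \<in> B" "w = x \<Lambda>" by blast
      have "cinner w (b (T d)) = cinner ((cadjoint b \<circ> x) \<Lambda>) (T (y \<Lambda>))"
        using b x y by (simp add: cadjoint_left B_bounded)
      also have "\<dots> = \<omega> a (cadjoint (cadjoint b \<circ> x) \<circ> y)" using b x y by (intro T B_closed)
      also have "cadjoint (cadjoint b \<circ> x) \<circ> y = cadjoint x \<circ> (b \<circ> y)"
        using b x by (simp add: cadjoint_comp B_bounded B_closed cadjoint_cadjoint o_assoc)
      also have "\<omega> a \<dots> = cinner (x \<Lambda>) (T ((b \<circ> y) \<Lambda>))" using b x y by (simp only: T B_closed)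
      finally have "cinner w ((b \<circ> T) d) = cinner w ((T \<circ> b) d)" using x y by simp
      then show "cinner ((b \<circ> T) d) w = cinner ((T \<circ> b) d) w" by (metis cinner_commute)
    qed
  qed
  then have "T \<in> A" using bT unfolding A_commutant by (auto simp: commutant_def)
  with T show ?thesis by blast
qed

definition cp :: "'g op \<Rightarrow> 'g op" where
  "cp a = (SOME T. T \<in> A \<and> (\<forall>x\<in>B. \<forall>y\<in>B. cinner (x \<Lambda>) (T (y \<Lambda>)) = \<omega> a (cadjoint x \<circ> y)))"

lemma cp_in: "a \<in> A \<Longrightarrow> cp a \<in> A"
  and cp_form: "a \<in> A \<Longrightarrow> x \<in> B \<Longrightarrow> y \<in> B \<Longrightarrow> cinner (x \<Lambda>) (cp a (y \<Lambda>)) = \<omega> a (cadjoint x \<circ> y)"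
proof -
  have P: "cp a \<in> A \<and> (\<forall>x\<in>B. \<forall>y\<in>B. cinner (x \<Lambda>) (cp a (y \<Lambda>)) = \<omega> a (cadjoint x \<circ> y))" if "a \<in> A"
    using someI_ex[of "\<lambda>T. T \<in> A \<and> (\<forall>x\<in>B. \<forall>y\<in>B. cinner (x \<Lambda>) (T (y \<Lambda>)) = \<omega> a (cadjoint x \<circ> y))"]
      cp_exists[OF that] unfolding cp_def by blast
  then show "a \<in> A \<Longrightarrow> cp a \<in> A" by blast
  show "cinner (x \<Lambda>) (cp a (y \<Lambda>)) = \<omega> a (cadjoint x \<circ> y)" if "a \<in> A" "x \<in> B" "y \<in> B"
    using P that by blast
qed

lemma cp_plan: "a \<in> A \<Longrightarrow> b \<in> B \<Longrightarrow> cinner \<Lambda> (cp a (b \<Lambda>)) = \<omega> a b"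
  using cp_form[of a id b] B_closed(1) by simp

text \<open>Elements of \<open>B\<close> commute with \<open>T\<close>, so testing on one side with
  \<open>\<Lambda>\<close> alone determines all products
  \<open>cinner (x \<Lambda>) (T (y \<Lambda>))\<close>. Identities for \<open>cp\<close> thereby
  reduce to identities for \<open>\<omega>\<close>.\<close>

lemma cp_unique:
  assumes a: "a \<in> A" and T: "T \<in> A" and eq: "\<And>b. b \<in> B \<Longrightarrow> cinner \<Lambda> (T (b \<Lambda>)) = \<omega> a b"
  shows "T = cp a"
proof (rule bounded_clinear_dense_eqI[OF _ _ dense])
  show "bounded_clinear T" "bounded_clinear (cp a)" using T cp_in[OF a] by (auto intro: A_bounded)
  fix d assume "d \<in> (\<lambda>b. b \<Lambda>) ` B"
  then obtain y where y: "y \<in> B" "d = y \<Lambda>" by blast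
  show "T d = cp a d"
  proof (rule cinner_dense_eqI[OF dense])
    fix w assume "w \<in> (\<lambda>b. b \<Lambda>) ` B"
    then obtain x where x: "x \<in> B" "w = x \<Lambda>" by blast
    have "cinner (x \<Lambda>) (T (y \<Lambda>)) = cinner \<Lambda> (T ((cadjoint x \<circ> y) \<Lambda>))"
      using x y commute[OF T B_closed(5)[OF x(1)], of "y \<Lambda>"] by (simp add: cadjoint_right B_bounded)
    also have "\<dots> = cinner (x \<Lambda>) (cp a (y \<Lambda>))" using x y a by (simp only: eq cp_form B_closed)
    finally show "cinner (T d) w = cinner (cp a d) w" using x y by (metis cinner_commute)
  qed
qed

lemma cp_add: "a \<in> A \<Longrightarrow> a' \<in> A \<Longrightarrow> cp (a + a') = cp a + cp a'"
  by (rule cp_unique[symmetric]) (simp_all add: A_closed cp_in cinner_add_right cp_plan \<omega>_add_left)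

lemma cp_scaleC: "a \<in> A \<Longrightarrow> cp (c *\<^sub>C a) = c *\<^sub>C cp a"
  by (rule cp_unique[symmetric])
    (simp_all add: A_closed cp_in scaleC_fun_def[THEN fun_cong] cinner_scaleC_right cp_plan \<omega>_scale_left)

lemma cp_id: "cp id = id"
  by (rule cp_unique[symmetric]) (simp_all add: A_closed marginal)

lemma cp_cadjoint: "a \<in> A \<Longrightarrow> cp (cadjoint a) = cadjoint (cp a)"
proof (rule cp_unique[symmetric])
  fix b assume a: "a \<in> A" and b: "b \<in> B"
  have "cinner \<Lambda> (cadjoint (cp a) (b \<Lambda>)) = cinner (cp a \<Lambda>) (b \<Lambda>)"
    using cadjoint_right[OF A_bounded[OF cp_in[OF a]]] by simp
  also have "\<dots> = cnj (cinner \<Lambda> (cp a (cadjoint b \<Lambda>)))"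
    using a b commute[OF cp_in[OF a], of "cadjoint b" \<Lambda>]
    by (simp add: B_closed cinner_commute[of _ \<Lambda>, symmetric] cadjoint_left[OF B_bounded[OF b], symmetric])
  also have "\<dots> = \<omega> (cadjoint a) b"
    using a b \<omega>_cadjoint[of a "cadjoint b"]
    by (simp add: cp_plan B_closed cadjoint_cadjoint B_bounded)
  finally show "cinner \<Lambda> (cadjoint (cp a) (b \<Lambda>)) = \<omega> (cadjoint a) b" .
qed (simp_all add: A_closed cp_in)

lemma dense_sequence: "\<exists>s. (\<forall>n::nat. s n \<in> B) \<and> (\<lambda>n. s n \<Lambda>) \<longlonglongrightarrow> x"
proof -
  obtain t where t: "\<forall>n. t n \<in> (\<lambda>b. b \<Lambda>) ` B" "t \<longlonglongrightarrow> x"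
    using dense closure_sequential[of x] by (metis UNIV_I)
  then have "\<forall>n. \<exists>b. b \<in> B \<and> t n = b \<Lambda>" by blast
  then obtain s where s: "\<forall>n. s n \<in> B \<and> t n = s n \<Lambda>" by metis
  then have "t = (\<lambda>n. s n \<Lambda>)" by auto
  then show ?thesis using s t(2) by blast
qed

text \<open>At vectors \<open>b \<Lambda>\<close> with \<open>b \<in> B\<close> the sum is an
  instance of the positivity of \<open>\<omega>\<close>; arbitrary vectors are limits of such, and
  the nonnegative half-line is closed.\<close>

lemma cp_completely_positive:
  assumes I: "finite I" and f: "\<And>i. i \<in> I \<Longrightarrow> f i \<in> A"
  shows "(\<Sum>i\<in>I. \<Sum>j\<in>I. cinner (x i) (cp (cadjoint (f i) \<circ> f j) (x j))) \<in> \<real>\<^sub>\<ge>\<^sub>0"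
proof -
  have "\<exists>s. (\<forall>n. s n \<in> B) \<and> (\<lambda>n::nat. s n \<Lambda>) \<longlonglongrightarrow> x i" for i by (rule dense_sequence)
  then obtain s where s: "\<And>i n. s i n \<in> B" "\<And>i. (\<lambda>n::nat. s i n \<Lambda>) \<longlonglongrightarrow> x i" by metis
  have lim: "(\<lambda>n. \<Sum>i\<in>I. \<Sum>j\<in>I. cinner (s i n \<Lambda>) (cp (cadjoint (f i) \<circ> f j) (s j n \<Lambda>)))
      \<longlonglongrightarrow> (\<Sum>i\<in>I. \<Sum>j\<in>I. cinner (x i) (cp (cadjoint (f i) \<circ> f j) (x j)))"
  proof (intro tendsto_sum tendsto_cinner s(2))
    fix i j assume "i \<in> I" "j \<in> I"
    then have "cadjoint (f i) \<circ> f j \<in> A" using f by (intro A_closed)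
    then show "(\<lambda>n. cp (cadjoint (f i) \<circ> f j) (s j n \<Lambda>)) \<longlonglongrightarrow> cp (cadjoint (f i) \<circ> f j) (x j)"
      by (rule bounded_clinear_tendsto[OF A_bounded[OF cp_in] s(2)])
  qed
  have "(\<Sum>i\<in>I. \<Sum>j\<in>I. cinner (s i n \<Lambda>) (cp (cadjoint (f i) \<circ> f j) (s j n \<Lambda>))) \<in> \<real>\<^sub>\<ge>\<^sub>0" for n
  proof -
    have "(\<Sum>i\<in>I. \<Sum>j\<in>I. cinner (s i n \<Lambda>) (cp (cadjoint (f i) \<circ> f j) (s j n \<Lambda>))) =
        (\<Sum>i\<in>I. \<Sum>j\<in>I. cnj 1 * 1 * \<omega> (cadjoint (f i) \<circ> f j) (cadjoint (s i n) \<circ> s j n))"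
      using f s(1) by (intro sum.cong refl) (simp add: cp_form A_closed)
    then show ?thesis using \<omega>_positive[where f = f and g = "\<lambda>i. s i n" and c = "\<lambda>_. 1", OF I f] s(1)
      by (simp only:)
  qed
  then show ?thesis by (rule closed_sequentially[OF closed_nonneg_Reals_complex _ lim])
qed

text \<open>The Kadison-Schwarz inequality at \<open>\<Lambda>\<close>, obtained by testing
  \<open>cp a \<Lambda>\<close> against the dense vectors \<open>b \<Lambda>\<close> with
  Cauchy-Schwarz for \<open>\<omega>\<close>. Together with the left marginal it is the contraction
  between the \<open>L\<^sup>2\<close>-spaces.\<close>

lemma cp_vector_norm: "a \<in> A \<Longrightarrow> (norm (cp a \<Lambda>))\<^sup>2 \<le> Re (\<omega> (cadjoint a \<circ> a) id)"
proof -
  assume a: "a \<in> A"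
  define m where "m = Re (\<omega> (cadjoint a \<circ> a) id)"
  have m: "m \<ge> 0"
    using \<omega>_positive[of "{()}" "\<lambda>_. a" "\<lambda>_. id" "\<lambda>_. 1"] a
    by (simp add: m_def A_closed B_closed complex_nonneg_Reals_iff)
  have "norm (cp a \<Lambda>) \<le> sqrt m"
  proof (rule norm_le_dense[OF dense])
    fix d assume "d \<in> (\<lambda>b. b \<Lambda>) ` B"
    then obtain b where b: "b \<in> B" "d = b \<Lambda>" by blast
    have "cinner (cp a \<Lambda>) d = \<omega> (cadjoint a) b"
      using a b cadjoint_right[OF A_bounded[OF cp_in[OF a]]]
      by (simp add: cp_cadjoint[symmetric] cp_plan A_closed)
    then have "(cmod (cinner (cp a \<Lambda>) d))\<^sup>2 \<le> (sqrt m * norm d)\<^sup>2"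
      using \<omega>_bound_left[of "cadjoint a" b] a b m
      by (simp add: A_closed cadjoint_cadjoint A_bounded m_def power_mult_distrib)
    then show "cmod (cinner (cp a \<Lambda>) d) \<le> sqrt m * norm d"
      by (rule power2_le_imp_le) (simp add: m)
  qed (simp add: m)
  then have "(norm (cp a \<Lambda>))\<^sup>2 \<le> (sqrt m)\<^sup>2" by (intro power_mono) auto
  then show ?thesis using m by (simp add: m_def)
qed

end

section \<open>Composition of transport plans\<close>

lemma double_sum_insert_zero:
  fixes f :: "'i \<Rightarrow> 'i \<Rightarrow> complex"
  assumes "finite I" "k \<notin> I" "\<And>i. i \<in> insert k I \<Longrightarrow> f i k = 0" "\<And>j. j \<in> insert k I \<Longrightarrow> f k j = 0"
  shows "(\<Sum>i\<in>insert k I. \<Sum>j\<in>insert k I. f i j) = (\<Sum>i\<in>I. \<Sum>j\<in>I. f i j)"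
  using assms by simp

lemma double_sum_diagonal:
  "finite I \<Longrightarrow> (\<Sum>i\<in>I. \<Sum>j\<in>I. if i = j then f i j else 0) = (\<Sum>i\<in>I. f i i)"
  for f :: "'i \<Rightarrow> 'i \<Rightarrow> complex"
  by (intro sum.cong refl) (simp add: sum.delta')

lemma sum_cinner_sums:
  fixes x y :: "'i \<Rightarrow> 'g::complex_hilbert_space"
  shows "(\<Sum>i\<in>I. \<Sum>j\<in>I. cinner (x i) (y j)) = cinner (sum x I) (sum y I)"
  by (simp only: cinner_sum_left) (simp only: cinner_sum_right)

lemma cinner_self_nonneg: "cinner x x \<in> \<real>\<^sub>\<ge>\<^sub>0" for x :: "'g::complex_hilbert_space"
  by (simp add: cinner_self complex_nonneg_Reals_iff del: of_real_power)

text \<open>Gram-Schmidt as an induction: removing from every \<open>x i\<close> its component along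
  \<open>x k\<close> leaves vectors with \<open>x' k = 0\<close>, which live on the smaller index
  set, while the removed part contributes the Gram matrix of the vectors
  \<open>c i *\<^sub>C y i\<close>.\<close>

lemma schur_product_vectors:
  fixes x :: "'i \<Rightarrow> 'g::complex_hilbert_space" and y :: "'i \<Rightarrow> 'h::complex_hilbert_space"
  assumes "finite I"
  shows "(\<Sum>i\<in>I. \<Sum>j\<in>I. cinner (x i) (x j) * cinner (y i) (y j)) \<in> \<real>\<^sub>\<ge>\<^sub>0"
  using assms
proof (induction I arbitrary: x rule: finite_induct)
  case empty
  then show ?case by simp
next
  case (insert k I)
  \<comment> \<open>For \<open>x k = 0\<close> this gives \<open>e = 0\<close>, and the splitting
    below remains valid.\<close>
  define e where "e = complex_of_real (inverse (norm (x k))) *\<^sub>C x k"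
  define c where "c i = cinner e (x i)" for i
  define x' where "x' i = x i - c i *\<^sub>C e" for i
  have e: "cinner e e = 1 \<or> x k = 0"
  proof (cases "x k = 0")
    case False
    then have "norm e = 1" by (simp add: e_def norm_scaleC norm_inverse del: of_real_inverse)
    then show ?thesis by (simp add: cinner_self)
  qed simp
  have ce: "x k = 0 \<Longrightarrow> e = 0" by (simp add: e_def)
  have "x' k = 0"
  proof (cases "x k = 0")
    case False
    then have "c k * complex_of_real (inverse (norm (x k))) = 1"
      by (simp add: c_def e_def cinner_scaleC_left cinner_self power2_eq_square field_simps)
    then have "c k *\<^sub>C e = x k" by (simp add: e_def scaleC_scaleC scaleC_one del: of_real_inverse)
    then show ?thesis by (simp add: x'_def)
  qed (simp add: x'_def ce)
  moreover have split: "cinner (x i) (x j) = cnj (c i) * c j + cinner (x' i) (x' j)" for i j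
    using e ce cinner_commute[of e "x i"]
    by (auto simp: x'_def c_def cinner_diff_left cinner_diff_right cinner_scaleC_left cinner_scaleC_right)
  moreover have "(\<Sum>i\<in>insert k I. \<Sum>j\<in>insert k I. cinner (x i) (x j) * cinner (y i) (y j)) =
      (\<Sum>i\<in>insert k I. \<Sum>j\<in>insert k I. cinner (c i *\<^sub>C y i) (c j *\<^sub>C y j)) +
      (\<Sum>i\<in>insert k I. \<Sum>j\<in>insert k I. cinner (x' i) (x' j) * cinner (y i) (y j))"
    unfolding sum.distrib[symmetric]
    by (intro sum.cong refl) (simp add: split cinner_scaleC_left cinner_scaleC_right algebra_simps)
  moreover have "(\<Sum>i\<in>insert k I. \<Sum>j\<in>insert k I. cinner (x' i) (x' j) * cinner (y i) (y j)) =
      (\<Sum>i\<in>I. \<Sum>j\<in>I. cinner (x' i) (x' j) * cinner (y i) (y j))"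
    using \<open>x' k = 0\<close> insert.hyps by (intro double_sum_insert_zero) auto
  ultimately show ?case
    using insert.IH[of x'] by (simp only: sum_cinner_sums nonneg_Reals_add_I cinner_self_nonneg)
qed

text \<open>Induction on the index set: after adding a small multiple of the identity, one step of the
  Cholesky decomposition writes \<open>Q\<close> as \<open>C\<^sub>i\<^sup>* C\<^sub>j\<close> plus a positive matrix on the smaller index set.\<close>

lemma schur_product_commuting:
  fixes B :: "'g::complex_hilbert_space op set"
  assumes vB: "von_neumann_algebra B" and "finite I"
    and "\<And>i j. i \<in> I \<Longrightarrow> j \<in> I \<Longrightarrow> P i j \<in> commutant B"
    and "\<And>x. (\<Sum>i\<in>I. \<Sum>j\<in>I. cinner (x i) (P i j (x j))) \<in> \<real>\<^sub>\<ge>\<^sub>0"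
    and "\<And>i j. i \<in> I \<Longrightarrow> j \<in> I \<Longrightarrow> Q i j \<in> B"
    and "\<And>i j. i \<in> I \<Longrightarrow> j \<in> I \<Longrightarrow> cadjoint (Q i j) = Q j i"
    and "\<And>x. (\<Sum>i\<in>I. \<Sum>j\<in>I. cinner (x i) (Q i j (x j))) \<in> \<real>\<^sub>\<ge>\<^sub>0"
  shows "(\<Sum>i\<in>I. \<Sum>j\<in>I. cinner z (P i j (Q i j z))) \<in> \<real>\<^sub>\<ge>\<^sub>0"
  using assms(2-)
proof (induction I arbitrary: Q rule: finite_induct)
  case empty
  then show ?case by simp
next
  case (insert k I)
  let ?I = "insert k I"
  note P = insert.prems(1) and Ppos = insert.prems(2) and Q = insert.prems(3)
    and Qherm = insert.prems(4) and Qpos = insert.prems(5)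
  note bB = vna_bounded_clinear[OF vB] and bP = commutant_bounded_clinear[OF P]
  have vB_cl: "id \<in> B" "\<And>a b. a \<in> B \<Longrightarrow> b \<in> B \<Longrightarrow> a \<circ> b \<in> B" "\<And>a b. a \<in> B \<Longrightarrow> b \<in> B \<Longrightarrow> a + b \<in> B"
    "\<And>a b. a \<in> B \<Longrightarrow> b \<in> B \<Longrightarrow> a - b \<in> B" "\<And>a c. a \<in> B \<Longrightarrow> c *\<^sub>C a \<in> B" "\<And>a. a \<in> B \<Longrightarrow> cadjoint a \<in> B"
    using vB by (auto intro: vna_id vna_comp vna_plus vna_minus vna_scaleC vna_cadjoint)
  have Ppos': "(\<Sum>i\<in>I. \<Sum>j\<in>I. cinner (x i) (P i j (x j))) \<in> \<real>\<^sub>\<ge>\<^sub>0" for x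
  proof -
    define x' where "x' = x(k := 0)"
    have "(\<Sum>i\<in>?I. \<Sum>j\<in>?I. cinner (x' i) (P i j (x' j))) = (\<Sum>i\<in>I. \<Sum>j\<in>I. cinner (x' i) (P i j (x' j)))"
      using insert.hyps by (intro double_sum_insert_zero) (auto simp: x'_def bounded_clinear_zero[OF bP])
    also have "\<dots> = (\<Sum>i\<in>I. \<Sum>j\<in>I. cinner (x i) (P i j (x j)))"
      using insert.hyps by (intro sum.cong refl) (auto simp: x'_def)
    finally show ?thesis using Ppos[of x'] by simp
  qed
  define S where "S = (\<Sum>i\<in>?I. \<Sum>j\<in>?I. cinner z (P i j (Q i j z)))"
  define T where "T = (\<Sum>i\<in>?I. cinner z (P i i z))"
  have main: "S + complex_of_real \<epsilon> * T \<in> \<real>\<^sub>\<ge>\<^sub>0" if \<epsilon>: "\<epsilon> > 0" for \<epsilon>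
  proof -
    define Qe where "Qe i j = (if i = j then Q i j + complex_of_real \<epsilon> *\<^sub>C id else Q i j)" for i j
    have Qe: "Qe i j \<in> B" if "i \<in> ?I" "j \<in> ?I" for i j
      using that Q by (auto simp: Qe_def vB_cl)
    have Qe_herm: "cadjoint (Qe i j) = Qe j i" if "i \<in> ?I" "j \<in> ?I" for i j
      using cadjoint_plus[OF bB[OF Q[OF that]] bounded_clinear_scale[OF bounded_clinear_id]] that
      by (cases "i = j") (simp_all add: Qe_def Qherm cadjoint_scaleC bounded_clinear_id)
    have Qe_apply: "cinner u (Qe i j v) = cinner u (Q i j v) + (if i = j then complex_of_real \<epsilon> * cinner u v else 0)"
      for u v i j
      by (simp add: Qe_def cinner_add_right scaleC_fun_def cinner_scaleC_right)
    have Qe_pos: "(\<Sum>i\<in>?I. \<Sum>j\<in>?I. cinner (x i) (Qe i j (x j))) \<in> \<real>\<^sub>\<ge>\<^sub>0" for x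
    proof -
      have "(\<Sum>i\<in>?I. \<Sum>j\<in>?I. cinner (x i) (Qe i j (x j))) =
          (\<Sum>i\<in>?I. \<Sum>j\<in>?I. cinner (x i) (Q i j (x j))) + (\<Sum>i\<in>?I. complex_of_real \<epsilon> * cinner (x i) (x i))"
        using insert.hyps(1) unfolding Qe_apply sum.distrib by (simp only: double_sum_diagonal finite_insert)
      moreover have "(\<Sum>i\<in>?I. complex_of_real \<epsilon> * cinner (x i) (x i)) \<in> \<real>\<^sub>\<ge>\<^sub>0"
        using \<epsilon> by (auto simp: complex_nonneg_Reals_iff cinner_self simp del: of_real_power intro!: sum_nonneg)
      ultimately show ?thesis using Qpos[of x] by (simp only: nonneg_Reals_add_I)
    qed
    have pos_k: "\<epsilon> * (norm x)\<^sup>2 \<le> Re (cinner x (Qe k k x))" for x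
    proof -
      have "(\<Sum>i\<in>?I. \<Sum>j\<in>?I. cinner (if i = k then x else 0) (Q i j (if j = k then x else 0))) = cinner x (Q k k x)"
      proof -
        have zero: "Q i j 0 = 0" if "i \<in> ?I" "j \<in> ?I" for i j
          using that by (intro bounded_clinear_zero bB Q)
        have "(\<Sum>j\<in>?I. cinner (if i = k then x else 0) (Q i j (if j = k then x else 0))) =
            (if i = k then cinner x (Q k k x) else 0)" if "i \<in> ?I" for i
          using insert.hyps that zero by (simp add: if_distrib[of "Q _ _"] if_distrib[of "cinner x"] sum.neutral cong: if_cong)
        then have "(\<Sum>i\<in>?I. \<Sum>j\<in>?I. cinner (if i = k then x else 0) (Q i j (if j = k then x else 0))) =
            (\<Sum>i\<in>?I. if i = k then cinner x (Q k k x) else 0)" by (rule sum.cong[OF refl])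
        then show ?thesis using insert.hyps(1) by simp
      qed
      then have "cinner x (Q k k x) \<in> \<real>\<^sub>\<ge>\<^sub>0" using Qpos[of "\<lambda>i. if i = k then x else 0"] by simp
      then show ?thesis
        by (simp add: Qe_apply complex_nonneg_Reals_iff cinner_self del: of_real_power)
    qed
    obtain c d where cd: "c \<in> B" "d \<in> B" "cadjoint c = c" "c \<circ> c = Qe k k" "c \<circ> d = id"
      using vna_sqrt[OF vB Qe Qe_herm \<epsilon> pos_k] by blast
    have cd_apply: "c (d x) = x" "c (c x) = Qe k k x" for x
      using fun_cong[OF cd(5)] fun_cong[OF cd(4)] by auto
    \<comment> \<open>Row \<open>k\<close> of the Cholesky factor, with \<open>d\<close> in place of
      the inverse of \<open>c\<close>. Since \<open>c \<circ> C j = Qe k j\<close>, subtracting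
      \<open>cadjoint (C i) \<circ> C j\<close> clears row and column \<open>k\<close>.\<close>
    define C where "C i = (if i = k then c else d \<circ> Qe k i)" for i
    have C: "C i \<in> B" if "i \<in> ?I" for i using that cd Qe by (auto simp: C_def vB_cl)
    have cC: "c \<circ> C j = Qe k j" for j by (auto simp: C_def fun_eq_iff cd_apply)
    have Cc: "cadjoint (C i) \<circ> c = Qe i k" if "i \<in> ?I" for i
    proof -
      have "cadjoint (c \<circ> C i) = Qe i k" using that by (simp add: cC Qe_herm)
      then show ?thesis using that cd(3) by (simp add: cadjoint_comp bB C cd(1))
    qed
    define R where "R i j = Qe i j - (cadjoint (C i) \<circ> C j)" for i j
    have R: "R i j \<in> B" if "i \<in> ?I" "j \<in> ?I" for i j using that by (auto simp: R_def vB_cl Qe C)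
    have R_herm: "cadjoint (R i j) = R j i" if "i \<in> ?I" "j \<in> ?I" for i j
    proof (rule cadjoint_unique)
      fix u v
      have "cinner (Qe i j u) v = cinner u (Qe j i v)"
        using cadjoint_right[OF bB[OF Qe[OF that]]] Qe_herm[OF that] by simp
      moreover have "cinner (cadjoint (C i) (C j u)) v = cinner u (cadjoint (C j) (C i v))"
        using that by (simp add: cadjoint_left[OF bB[OF C]] cadjoint_right[OF bB[OF C]])
      ultimately show "cinner (R i j u) v = cinner u (R j i v)"
        by (simp add: R_def cinner_diff_left cinner_diff_right)
    qed
    have R_k: "R i k = 0" "R k i = 0" if "i \<in> ?I" for i
      using Cc[OF that] cC[of i] cd(3) by (simp_all add: R_def C_def[of k])
    have R_split: "cinner u (Qe i j v) = cinner (C i u) (C j v) + cinner u (R i j v)" if "i \<in> ?I" for i j u v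
      using that by (simp add: R_def cinner_diff_right cadjoint_right[OF bB[OF C]])
    have "(\<Sum>i\<in>I. \<Sum>j\<in>I. cinner z (P i j (R i j z))) \<in> \<real>\<^sub>\<ge>\<^sub>0"
    proof (rule insert.IH)
      show "P i j \<in> commutant B" "R i j \<in> B" "cadjoint (R i j) = R j i" if "i \<in> I" "j \<in> I" for i j
        using that P R R_herm by auto
      show "(\<Sum>i\<in>I. \<Sum>j\<in>I. cinner (x i) (P i j (x j))) \<in> \<real>\<^sub>\<ge>\<^sub>0" for x by (rule Ppos')
      show "(\<Sum>i\<in>I. \<Sum>j\<in>I. cinner (x i) (R i j (x j))) \<in> \<real>\<^sub>\<ge>\<^sub>0" for x
      proof -
        \<comment> \<open>The entry at \<open>k\<close> is chosen so that the sum of all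
          \<open>C j (x' j)\<close> vanishes; the form of \<open>Qe\<close> at \<open>x'\<close>
          then equals that of the Schur complement \<open>R\<close> at \<open>x\<close>.\<close>
        define x' where "x' = x(k := - d (\<Sum>j\<in>I. C j (x j)))"
        have x'_I: "x' i = x i" if "i \<in> I" for i using that insert.hyps by (auto simp: x'_def)
        have "(\<Sum>j\<in>?I. C j (x' j)) = c (x' k) + (\<Sum>j\<in>I. C j (x j))"
          using insert.hyps x'_I by (simp add: C_def[of k] cong: sum.cong)
        also have "c (x' k) = - (\<Sum>j\<in>I. C j (x j))"
          using bounded_clinear_diff[OF bB[OF cd(1)], of 0] bounded_clinear_zero[OF bB[OF cd(1)]]
          by (simp add: x'_def cd_apply)
        finally have sum0: "(\<Sum>j\<in>?I. C j (x' j)) = 0" by simp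
        have "(\<Sum>i\<in>?I. \<Sum>j\<in>?I. cinner (x' i) (Qe i j (x' j))) =
            (\<Sum>i\<in>?I. \<Sum>j\<in>?I. cinner (C i (x' i)) (C j (x' j))) + (\<Sum>i\<in>?I. \<Sum>j\<in>?I. cinner (x' i) (R i j (x' j)))"
          by (simp only: R_split sum.distrib cong: sum.cong)
        also have "(\<Sum>i\<in>?I. \<Sum>j\<in>?I. cinner (C i (x' i)) (C j (x' j))) = 0"
          by (simp only: sum_cinner_sums sum0 cinner_zero_left)
        also have "(\<Sum>i\<in>?I. \<Sum>j\<in>?I. cinner (x' i) (R i j (x' j))) = (\<Sum>i\<in>I. \<Sum>j\<in>I. cinner (x' i) (R i j (x' j)))"
          using insert.hyps R_k by (intro double_sum_insert_zero) (auto simp: zero_fun_def)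
        also have "\<dots> = (\<Sum>i\<in>I. \<Sum>j\<in>I. cinner (x i) (R i j (x j)))"
          by (intro sum.cong refl) (simp add: x'_I)
        finally show ?thesis using Qe_pos[of x'] by simp
      qed
    qed
    moreover have "(\<Sum>i\<in>?I. \<Sum>j\<in>?I. cinner z (P i j (Qe i j z))) =
        (\<Sum>i\<in>?I. \<Sum>j\<in>?I. cinner (C i z) (P i j (C j z))) + (\<Sum>i\<in>I. \<Sum>j\<in>I. cinner z (P i j (R i j z)))"
    proof -
      \<comment> \<open>\<open>P i j\<close> commutes with \<open>cadjoint (C i)\<close>, which can
        therefore be moved to the left vector. The Cholesky part becomes the form of
        \<open>P\<close> at the family \<open>C i z\<close>.\<close>
      have "cinner z (P i j (Qe i j z)) = cinner (C i z) (P i j (C j z)) + cinner z (P i j (R i j z))"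
        if i: "i \<in> ?I" and j: "j \<in> ?I" for i j
      proof -
        have "Qe i j z = cadjoint (C i) (C j z) + R i j z" by (simp add: R_def)
        then have "P i j (Qe i j z) = P i j (cadjoint (C i) (C j z)) + P i j (R i j z)"
          by (simp add: bounded_clinear_add[OF bP[OF i j]])
        also have "P i j (cadjoint (C i) (C j z)) = cadjoint (C i) (P i j (C j z))"
          using commutant_commute[OF vB_cl(6)[OF C[OF i]] P[OF i j]] by simp
        finally show ?thesis
          by (simp add: cinner_add_right cadjoint_right[OF bB[OF C[OF i]]])
      qed
      then have "(\<Sum>i\<in>?I. \<Sum>j\<in>?I. cinner z (P i j (Qe i j z))) =
        (\<Sum>i\<in>?I. \<Sum>j\<in>?I. cinner (C i z) (P i j (C j z))) + (\<Sum>i\<in>?I. \<Sum>j\<in>?I. cinner z (P i j (R i j z)))"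
        by (simp only: sum.distrib cong: sum.cong)
      also have "(\<Sum>i\<in>?I. \<Sum>j\<in>?I. cinner z (P i j (R i j z))) = (\<Sum>i\<in>I. \<Sum>j\<in>I. cinner z (P i j (R i j z)))"
        using insert.hyps R_k by (intro double_sum_insert_zero) (auto simp: zero_fun_def bounded_clinear_zero[OF bP])
      finally show ?thesis .
    qed
    moreover have "(\<Sum>i\<in>?I. \<Sum>j\<in>?I. cinner z (P i j (Qe i j z))) = S + complex_of_real \<epsilon> * T"
    proof -
      have "cinner z (P i j (Qe i j z)) =
          cinner z (P i j (Q i j z)) + (if i = j then complex_of_real \<epsilon> * cinner z (P i i z) else 0)"
        if i: "i \<in> ?I" and j: "j \<in> ?I" for i j
        using bounded_clinear_add[OF bP[OF i j]] bounded_clinear_scaleC[OF bP[OF i j]]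
        by (cases "i = j") (simp_all add: Qe_def scaleC_fun_def cinner_add_right cinner_scaleC_right)
      then have "(\<Sum>i\<in>?I. \<Sum>j\<in>?I. cinner z (P i j (Qe i j z))) =
          S + (\<Sum>i\<in>?I. \<Sum>j\<in>?I. if i = j then complex_of_real \<epsilon> * cinner z (P i i z) else 0)"
        by (simp only: sum.distrib S_def cong: sum.cong)
      also have "(\<Sum>i\<in>?I. \<Sum>j\<in>?I. if i = j then complex_of_real \<epsilon> * cinner z (P i i z) else 0) = complex_of_real \<epsilon> * T"
        using insert.hyps(1) by (simp only: double_sum_diagonal finite_insert T_def sum_distrib_left)
      finally show ?thesis .
    qed
    ultimately show ?thesis using Ppos[of "\<lambda>i. C i z"] by (simp only: nonneg_Reals_add_I)
  qed
  have "(\<lambda>n. S + complex_of_real (inverse (real (Suc n))) * T) \<longlonglongrightarrow> S + complex_of_real 0 * T"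
    by (intro tendsto_intros LIMSEQ_inverse_real_of_nat)
  then have "S + complex_of_real 0 * T \<in> \<real>\<^sub>\<ge>\<^sub>0"
    by (rule closed_sequentially[OF closed_nonneg_Reals_complex, rotated]) (rule main, simp)
  then show ?case by (simp add: S_def)
qed

text \<open>The independent coupling; it provides the plan that makes the sets under the infima
  nonempty.\<close>

lemma tensor_state_product:
  fixes A B :: "'g::complex_hilbert_space op set"
  assumes vA: "von_neumann_algebra A" and vB: "von_neumann_algebra B"
    and unit: "cinner \<Lambda> \<Lambda> = 1" "cinner \<Lambda>' \<Lambda>' = 1"
  shows "tensor_state A B (\<lambda>a b. cinner \<Lambda> (a \<Lambda>) * cinner \<Lambda>' (b \<Lambda>'))"
  unfolding tensor_state_def
proof (intro conjI allI ballI impI)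
  fix N :: nat and f g :: "nat \<Rightarrow> 'g op"
  assume fg: "\<forall>i<N. f i \<in> A \<and> g i \<in> B"
  have "(\<Sum>i<N. \<Sum>j<N. cinner \<Lambda> ((cadjoint (f i) \<circ> f j) \<Lambda>) * cinner \<Lambda>' ((cadjoint (g i) \<circ> g j) \<Lambda>')) =
      (\<Sum>i<N. \<Sum>j<N. cinner (f i \<Lambda>) (f j \<Lambda>) * cinner (g i \<Lambda>') (g j \<Lambda>'))"
    using fg by (intro sum.cong refl) (simp add: cadjoint_right[OF vna_bounded_clinear[OF vA]]
        cadjoint_right[OF vna_bounded_clinear[OF vB]])
  then show "(\<Sum>i<N. \<Sum>j<N. cinner \<Lambda> ((cadjoint (f i) \<circ> f j) \<Lambda>) * cinner \<Lambda>' ((cadjoint (g i) \<circ> g j) \<Lambda>')) \<in> \<real>\<^sub>\<ge>\<^sub>0"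
    using schur_product_vectors[of "{..<N}" "\<lambda>i. f i \<Lambda>" "\<lambda>i. g i \<Lambda>'"] by simp
qed (simp_all add: unit cinner_add_right cinner_scaleC_right scaleC_fun_def algebra_simps)

text \<open>The two plans meet at the intermediate state: the same \<open>\<Lambda>\<close>
  represents the right marginal of \<open>\<omega>\<close> and the left marginal of
  \<open>\<phi>\<close>.\<close>

locale plan_pair =
  L: right_plan A B \<omega> \<Lambda> + R: right_plan B A "\<lambda>b a. \<phi> a b" \<Lambda>
  for A B :: "'g::complex_hilbert_space op set" and \<omega> \<phi> \<Lambda>
begin

definition glue :: "'g op \<Rightarrow> 'g op \<Rightarrow> complex" where
  "glue a b = cinner \<Lambda> (L.cp a (R.cp b \<Lambda>))"

text \<open>\<open>L.cp a\<close> and \<open>R.cp b\<close> commute, so \<open>glue\<close> can be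
  read as \<open>\<phi>\<close> after \<open>L.cp\<close> or, in \<open>glue_right\<close>, as
  \<open>\<omega>\<close> after \<open>R.cp\<close>. The first reading shows the right marginal and
  the composition of maps, the second the left marginal.\<close>

lemma glue_left: "a \<in> A \<Longrightarrow> b \<in> B \<Longrightarrow> glue a b = \<phi> (L.cp a) b"
  using L.commute[OF L.cp_in R.cp_in, of a b \<Lambda>] R.cp_plan[of b "L.cp a"] L.cp_in[of a]
  by (simp add: glue_def)

lemma glue_right: "a \<in> A \<Longrightarrow> b \<in> B \<Longrightarrow> glue a b = \<omega> a (R.cp b)"
  using L.cp_plan[of a "R.cp b"] R.cp_in[of b] by (simp add: glue_def)

lemma glue_id_right: "a \<in> A \<Longrightarrow> glue a id = \<omega> a id"
  using glue_right[of a id] by (simp add: R.cp_id L.B_closed)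

lemma glue_id_left: "b \<in> B \<Longrightarrow> glue id b = \<phi> id b"
  using glue_left[of id b] by (simp add: L.cp_id L.A_closed)

lemma tensor_state_glue: "tensor_state A B glue"
  unfolding tensor_state_def
proof (intro conjI allI ballI impI)
  fix N :: nat and f g :: "nat \<Rightarrow> 'g op"
  assume fg: "\<forall>i<N. f i \<in> A \<and> g i \<in> B"
  then have f: "\<And>i. i \<in> {..<N} \<Longrightarrow> f i \<in> A" and g: "\<And>i. i \<in> {..<N} \<Longrightarrow> g i \<in> B" by auto
  show "(\<Sum>i<N. \<Sum>j<N. glue (cadjoint (f i) \<circ> f j) (cadjoint (g i) \<circ> g j)) \<in> \<real>\<^sub>\<ge>\<^sub>0"
    unfolding glue_def
  proof (rule schur_product_commuting[where P = "\<lambda>i j. L.cp (cadjoint (f i) \<circ> f j)"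
        and Q = "\<lambda>i j. R.cp (cadjoint (g i) \<circ> g j)", OF L.vB])
    fix i j assume i: "i \<in> {..<N}" and j: "j \<in> {..<N}"
    show "L.cp (cadjoint (f i) \<circ> f j) \<in> commutant B"
      using f[OF i] f[OF j] L.A_commutant by (metis L.cp_in L.A_closed(3,5))
    have gB: "cadjoint (g i) \<circ> g j \<in> B" using g[OF i] g[OF j] by (intro L.B_closed)
    then show "R.cp (cadjoint (g i) \<circ> g j) \<in> B" by (rule R.cp_in)
    have "cadjoint (cadjoint (g i) \<circ> g j) = cadjoint (g j) \<circ> g i"
      using g[OF i] g[OF j] by (simp add: cadjoint_comp L.B_bounded L.B_closed cadjoint_cadjoint)
    then show "cadjoint (R.cp (cadjoint (g i) \<circ> g j)) = R.cp (cadjoint (g j) \<circ> g i)"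
      using R.cp_cadjoint[OF gB] by simp
  qed (simp_all only: finite_lessThan L.cp_completely_positive[OF _ f] R.cp_completely_positive[OF _ g])
next
  show "glue id id = 1" by (simp add: glue_id_left L.B_closed R.\<omega>_id)
qed (simp_all add: glue_left L.cp_add L.cp_scaleC R.\<omega>_add_left R.\<omega>_add_right R.\<omega>_scale_left
    R.\<omega>_scale_right L.cp_in L.A_closed L.B_closed)

end

section \<open>Spectral integrals and the modular group\<close>

lemma polarization:
  fixes V :: "'g::complex_hilbert_space op"
  assumes add: "\<And>x y. V (x + y) = V x + V y" and scale: "\<And>c x. V (c *\<^sub>C x) = c *\<^sub>C V x"
  shows "4 * cinner x (V y) =
    (\<Sum>c\<in>{1, -1, \<i>, -\<i>}. cnj c * cinner (x + c *\<^sub>C y) (V (x + c *\<^sub>C y)))"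
proof -
  have distinct: "(1::complex) \<noteq> -1" "1 \<noteq> \<i>" "1 \<noteq> -\<i>" "-1 \<noteq> \<i>" "-1 \<noteq> -\<i>" "\<i> \<noteq> -\<i>"
    by (auto simp: complex_eq_iff)
  have "cnj c * cinner (x + c *\<^sub>C y) (V (x + c *\<^sub>C y)) = cnj c * cinner x (V x) + (cnj c * c) * cinner x (V y) +
      (cnj c * cnj c) * cinner y (V x) + cnj c * (cnj c * c) * cinner y (V y)" for c
    by (simp add: add scale cinner_add_left cinner_add_right cinner_scaleC_left cinner_scaleC_right algebra_simps)
  then show ?thesis using distinct by simp
qed

lemma quadratic_form_eqI:
  fixes S T :: "'g::complex_hilbert_space op"
  assumes S: "bounded_clinear S" and T: "bounded_clinear T" and eq: "\<And>x. cinner x (S x) = cinner x (T x)"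
  shows "S = T"
proof
  fix y
  have "4 * cinner x (S y) = 4 * cinner x (T y)" for x
    unfolding polarization[OF bounded_clinear_add[OF S] bounded_clinear_scaleC[OF S]]
      polarization[OF bounded_clinear_add[OF T] bounded_clinear_scaleC[OF T]] eq ..
  then have "cinner (S y) x = cinner (T y) x" for x by (metis cinner_commute mult_cancel_left zero_neq_numeral)
  then show "S y = T y" by (rule cinner_eqI)
qed

text \<open>For unit vectors the four polarization terms pair up by the parallelogram law, each pair
  contributing \<open>4 * d\<close>. The total \<open>8 * d\<close> against the factor 4 on the left
  gives the constant 2; scaling does the rest.\<close>

lemma numerical_radius_bound:
  fixes V :: "'g::complex_hilbert_space op"
  assumes add: "\<And>x y. V (x + y) = V x + V y" and scale: "\<And>c x. V (c *\<^sub>C x) = c *\<^sub>C V x"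
    and le: "\<And>x. cmod (cinner x (V x)) \<le> d * (norm x)\<^sup>2"
  shows "norm (V x) \<le> 2 * d * norm x"
proof -
  have unit: "cmod (cinner x (V y)) \<le> 2 * d" if "norm x = 1" "norm y = 1" for x y
  proof -
    have "d \<ge> 0" using order_trans[OF norm_ge_zero le[of x]] that by simp
    have t: "cmod (cnj c * cinner (x + c *\<^sub>C y) (V (x + c *\<^sub>C y))) \<le> d * (norm (x + c *\<^sub>C y))\<^sup>2" if "cmod c = 1" for c
      using le[of "x + c *\<^sub>C y"] that by (simp add: norm_mult)
    have par: "(norm (x + c *\<^sub>C y))\<^sup>2 + (norm (x + (-c) *\<^sub>C y))\<^sup>2 = 4" if "cmod c = 1" for c
    proof -
      have "(norm (x + c *\<^sub>C y))\<^sup>2 + (norm (x - c *\<^sub>C y))\<^sup>2 = 2 * (norm x)\<^sup>2 + 2 * (norm (c *\<^sub>C y))\<^sup>2"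
        by (simp add: power2_norm_eq_inner inner_add inner_diff inner_commute)
      then show ?thesis using that \<open>norm x = 1\<close> \<open>norm y = 1\<close> by (simp add: norm_scaleC)
    qed
    have distinct: "(1::complex) \<noteq> -1" "1 \<noteq> \<i>" "1 \<noteq> -\<i>" "-1 \<noteq> \<i>" "-1 \<noteq> -\<i>" "\<i> \<noteq> -\<i>"
      by (auto simp: complex_eq_iff)
    have "4 * cmod (cinner x (V y)) = cmod (4 * cinner x (V y))" by (simp add: norm_mult)
    also have "\<dots> \<le> (\<Sum>c\<in>{1, -1, \<i>, -\<i>}. d * (norm (x + c *\<^sub>C y))\<^sup>2)"
      unfolding polarization[of V, OF add scale] by (rule sum_norm_le) (auto intro!: t)
    also have "\<dots> = d * ((norm (x + 1 *\<^sub>C y))\<^sup>2 + (norm (x + (-1) *\<^sub>C y))\<^sup>2) +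
        d * ((norm (x + \<i> *\<^sub>C y))\<^sup>2 + (norm (x + (-\<i>) *\<^sub>C y))\<^sup>2)"
      using distinct by (simp add: algebra_simps)
    also have "\<dots> = 8 * d" using par[of 1] par[of \<i>] by simp
    finally show ?thesis by simp
  qed
  show ?thesis
  proof (cases "x = 0 \<or> V x = 0")
    case True
    have "V 0 = 0" using scale[of 0 0] by simp
    moreover have "0 \<le> d * norm x"
    proof (cases "x = 0")
      case False
      then have "0 \<le> d * (norm x)\<^sup>2" using le[of x] norm_ge_zero[of "cinner x (V x)"] by linarith
      with False show ?thesis by (simp add: zero_le_mult_iff)
    qed simp
    ultimately show ?thesis using True by auto
  next
    case False
    define a where "a = complex_of_real (inverse (norm (V x)))"
    define b where "b = complex_of_real (inverse (norm x))"
    have "cmod (cinner (a *\<^sub>C V x) (V (b *\<^sub>C x))) \<le> 2 * d"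
      using False by (intro unit) (simp_all add: a_def b_def norm_scaleC norm_inverse del: of_real_inverse)
    also have "cinner (a *\<^sub>C V x) (V (b *\<^sub>C x)) = complex_of_real (norm (V x) / norm x)"
      using False by (simp add: a_def b_def scale cinner_scaleC_left cinner_scaleC_right cinner_self
          power2_eq_square field_simps)
    finally show ?thesis using False by (simp add: field_simps norm_divide)
  qed
qed

text \<open>The angle is rounded down to a multiple of \<open>2 * pi / N\<close>, and a chord is no
  longer than its arc. The index is reduced modulo \<open>N\<close> so that only \<open>N\<close>
  values occur, however large the angle is.\<close>

lemma cis_step_approx:
  fixes \<theta> :: real and N :: nat
  assumes N: "N > 0"
  defines "j \<equiv> nat (\<lfloor>real N * \<theta> / (2 * pi)\<rfloor> mod int N)"
  shows "j < N" "cmod (cis \<theta> - cis (2 * pi * real j / real N)) \<le> 2 * pi / real N"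
proof -
  define k where "k = \<lfloor>real N * \<theta> / (2 * pi)\<rfloor>"
  show "j < N" using N by (simp add: j_def nat_less_iff)
  have jk: "int j = k mod int N" using N by (simp add: j_def k_def)
  then have "k = int N * (k div int N) + int j" by simp
  then have "real_of_int k = real N * real_of_int (k div int N) + real j"
    by (metis of_int_add of_int_mult of_int_of_nat_eq)
  then have "2 * pi * real_of_int k / real N = 2 * pi * real_of_int (k div int N) + 2 * pi * real j / real N"
    using N by (simp add: field_simps)
  then have "cis (2 * pi * real_of_int k / real N) = cis (2 * pi * real_of_int (k div int N)) * cis (2 * pi * real j / real N)"
    by (simp only: cis_mult)
  moreover have "cis (2 * pi * real_of_int (k div int N)) = 1" by (rule cis_multiple_2pi) simp
  ultimately have cis_k: "cis (2 * pi * real_of_int k / real N) = cis (2 * pi * real j / real N)"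
    by (simp only: mult_1_left)
  define \<phi> where "\<phi> = 2 * pi * real_of_int k / real N"
  have "real_of_int k \<le> real N * \<theta> / (2 * pi)" "real N * \<theta> / (2 * pi) < real_of_int k + 1"
    unfolding k_def by linarith+
  moreover have "\<theta> - \<phi> = (real N * \<theta> / (2 * pi) - real_of_int k) * (2 * pi / real N)"
    using N by (simp add: \<phi>_def field_simps)
  ultimately have diff: "0 \<le> \<theta> - \<phi>" "\<theta> - \<phi> \<le> 2 * pi / real N"
    by (auto intro!: mult_nonneg_nonneg mult_left_le_one_le simp del: times_divide_eq_right)
  have "cis \<theta> - cis \<phi> = cis \<phi> * (cis (\<theta> - \<phi>) - 1)" by (simp add: algebra_simps cis_mult)
  then have "cmod (cis \<theta> - cis \<phi>) = cmod (cis (\<theta> - \<phi>) - 1)" by (simp add: norm_mult)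
  also have "\<dots> = 2 * \<bar>sin ((\<theta> - \<phi>) / 2)\<bar>"
    using dist_exp_i_1[of "\<theta> - \<phi>"] by (simp add: cis_conv_exp)
  also have "\<dots> \<le> 2 * \<bar>(\<theta> - \<phi>) / 2\<bar>" by (intro mult_left_mono abs_sin_x_le_abs_x) simp
  also have "\<dots> = \<theta> - \<phi>" using diff by simp
  finally show "cmod (cis \<theta> - cis (2 * pi * real j / real N)) \<le> 2 * pi / real N"
    using diff cis_k by (simp add: \<phi>_def)
qed

section \<open>Projection valued measures and spectral integrals\<close>

lemma projection_cinner:
  assumes "projection p"
  shows "cinner x (p y) = cinner (p x) (p y)" and "cinner (p x) y = cinner x (p y)"
    and "bounded_clinear p" and "p (p x) = p x"
proof -
  show bp: "bounded_clinear p" and pp: "p (p x) = p x" for x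
    using assms by (auto simp: projection_def fun_eq_iff)
  show adj: "cinner (p x) y = cinner x (p y)" for x y
    using assms cadjoint_right[OF bp] by (simp add: projection_def)
  show "cinner x (p y) = cinner (p x) (p y)" using adj[of x "p y"] pp by simp
qed

lemma borel_measurable_cis [measurable]: "cis \<in> borel_measurable borel"
  by (intro borel_measurable_continuous_onI continuous_intros)

locale pvm =
  fixes E :: "real set \<Rightarrow> 'g::complex_hilbert_space op"
  assumes pvm: "projection_valued_measure E"
begin

lemma proj: "B \<in> sets borel \<Longrightarrow> projection (E B)"
  and E_UNIV: "E UNIV x = x"
  and E_Int: "B \<in> sets borel \<Longrightarrow> C \<in> sets borel \<Longrightarrow> E (B \<inter> C) x = E B (E C x)"
  and E_sums: "range F \<subseteq> sets borel \<Longrightarrow> disjoint_family F \<Longrightarrow> (\<lambda>n::nat. E (F n) x) sums E (\<Union>n. F n) x"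
  using pvm by (auto simp: projection_valued_measure_def)

lemma E_empty: "E {} x = 0"
proof -
  have "(\<lambda>n::nat. E {} x) sums E {} x"
    using E_sums[of "\<lambda>_. {}" x] by (simp add: disjoint_family_on_def)
  then have "(\<lambda>n::nat. E {} x) \<longlonglongrightarrow> 0" by (rule summable_LIMSEQ_zero[OF sums_summable])
  then show ?thesis by (simp add: LIMSEQ_const_iff)
qed

lemma Re_form: "B \<in> sets borel \<Longrightarrow> Re (cinner x (E B x)) = (norm (E B x))\<^sup>2"
  and form_real: "B \<in> sets borel \<Longrightarrow> cinner x (E B x) = complex_of_real ((norm (E B x))\<^sup>2)"
  using projection_cinner(1)[OF proj, of B x x] by (simp_all add: cinner_self)

abbreviation "\<M> x \<equiv> spectral_measure E x"

lemma sets_M [simp, measurable_cong]: "sets (\<M> x) = sets borel"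
  using sets.sigma_sets_eq[of "borel :: real measure"] by (simp add: spectral_measure_def)

lemma space_M [simp]: "space (\<M> x) = UNIV"
  by (simp add: spectral_measure_def)

text \<open>\<open>measure_of\<close> takes the prescribed values once countable additivity is
  known; here it follows by pairing the strongly convergent series of \<open>E_sums\<close> with
  \<open>x\<close>.\<close>

lemma emeasure_M: "B \<in> sets borel \<Longrightarrow> emeasure (\<M> x) B = ennreal ((norm (E B x))\<^sup>2)"
proof -
  assume B: "B \<in> sets borel"
  have "emeasure (\<M> x) B = ennreal (Re (cinner x (E B x)))"
  proof (rule emeasure_measure_of[where \<Omega> = UNIV and A = "sets borel"])
    show "\<M> x = measure_of UNIV (sets borel) (\<lambda>B. ennreal (Re (cinner x (E B x))))"
      by (rule spectral_measure_def)
    show "positive (sets (\<M> x)) (\<lambda>B. ennreal (Re (cinner x (E B x))))"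
      by (simp add: positive_def E_empty)
    show "countably_additive (sets (\<M> x)) (\<lambda>B. ennreal (Re (cinner x (E B x))))"
    proof (rule countably_additiveI)
      fix F :: "nat \<Rightarrow> real set" assume F: "range F \<subseteq> sets (\<M> x)" "disjoint_family F"
      have "(\<lambda>n. cinner x (E (F n) x)) sums cinner x (E (\<Union>n. F n) x)"
        using bounded_linear.sums[OF bounded_bilinear.bounded_linear_right[OF bounded_bilinear_cinner] E_sums] F by simp
      then have "(\<lambda>n. Re (cinner x (E (F n) x))) sums Re (cinner x (E (\<Union>n. F n) x))"
        by (rule sums_Re)
      moreover have "0 \<le> Re (cinner x (E (F n) x))" for n using F by (simp add: Re_form image_subset_iff)
      ultimately show "(\<Sum>n. ennreal (Re (cinner x (E (F n) x)))) = ennreal (Re (cinner x (E (\<Union>n. F n) x)))"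
        by (intro suminf_ennreal_eq)
    qed
  qed (use B in auto)
  then show ?thesis using B by (simp add: Re_form)
qed

lemma measure_M: "B \<in> sets borel \<Longrightarrow> measure (\<M> x) B = (norm (E B x))\<^sup>2"
  by (simp add: measure_def emeasure_M)

lemma finite_M: "finite_measure (\<M> x)"
  by (rule finite_measureI) (simp add: emeasure_M)

lemma integrable_bounded:
  fixes f :: "real \<Rightarrow> 'b::{banach, second_countable_topology}"
  assumes "f \<in> borel_measurable borel" "\<And>s. norm (f s) \<le> K"
  shows "integrable (\<M> x) f"
  using assms by (intro finite_measure.integrable_const_bound[OF finite_M, where B = K]) simp_all

lemma M_eqI: "(\<And>B. B \<in> sets borel \<Longrightarrow> norm (E B x) = norm (E B y)) \<Longrightarrow> \<M> x = \<M> y"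
  by (rule measure_eqI) (simp_all add: emeasure_M)

text \<open>A unimodular function is uniformly approximated by simple functions with unimodular values
  on a partition, for which the spectral integral is visibly isometric.\<close>

lemma spectral_integral_isometric:
  assumes U: "bounded_clinear U" and form: "\<And>x. cinner x (U x) = (\<integral>s. cis (h s) \<partial>\<M> x)"
    and h [measurable]: "h \<in> borel_measurable borel"
  shows "norm (U x) = norm x"
proof -
  have close: "\<bar>norm (U x) - norm x\<bar> \<le> 4 * pi / real N * norm x" if N: "N > 0" for N :: nat
  proof -
    define j where "j s = nat (\<lfloor>real N * h s / (2 * pi)\<rfloor> mod int N)" for s
    define B where "B i = {s. j s = i}" for i
    define w where "w i = cis (2 * pi * real i / real N)" for i
    have j_less: "j s < N" for s unfolding j_def by (rule cis_step_approx(1)[OF N])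
    have [measurable]: "j \<in> measurable borel (count_space UNIV)" unfolding j_def by measurable
    have B: "B i \<in> sets borel" for i
    proof -
      have "{s \<in> space borel. j s = i} \<in> sets borel" by measurable
      then show ?thesis by (simp add: B_def)
    qed
    \<comment> \<open>The spectral integral of the simple function \<open>w \<circ> j\<close>. The
      sets \<open>B i\<close> partition the line, so the summands are orthogonal and unimodular
      weights preserve the norm.\<close>
    define T where "T x = (\<Sum>i<N. w i *\<^sub>C E (B i) x)" for x
    note bE = projection_cinner(3)[OF proj[OF B]]
    have T_add: "T (x + y) = T x + T y" for x y
      by (simp add: T_def bounded_clinear_add[OF bE] scaleC_add_right sum.distrib)
    have T_scale: "T (c *\<^sub>C x) = c *\<^sub>C T x" for c x
      by (simp add: T_def bounded_clinear_scaleC[OF bE] scaleC_scaleC complex_vector.scale_sum_right mult.commute)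
    have pick: "(\<Sum>i<N. f i * complex_of_real (indicator (B i) s)) = f (j s)" for f :: "nat \<Rightarrow> complex" and s
    proof -
      have "(\<Sum>i<N. f i * complex_of_real (indicator (B i) s)) = (\<Sum>i<N. if j s = i then f i else 0)"
        by (intro sum.cong refl) (simp add: B_def indicator_def)
      then show ?thesis using j_less by (simp add: sum.delta')
    qed
    have int_ind: "integrable (\<M> x) (\<lambda>s. c * complex_of_real (indicator (B i) s))" for x c i
      using B by (intro integrable_mult_right integrable_of_real) (simp add: integrable_bounded emeasure_M)
    have step: "(\<Sum>i<N. f i * complex_of_real ((norm (E (B i) x))\<^sup>2)) = (\<integral>s. f (j s) \<partial>\<M> x)" for f x
    proof -
      have "(\<integral>s. f (j s) \<partial>\<M> x) = (\<integral>s. (\<Sum>i<N. f i * complex_of_real (indicator (B i) s)) \<partial>\<M> x)"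
        by (simp only: pick)
      also have "\<dots> = (\<Sum>i<N. \<integral>s. f i * complex_of_real (indicator (B i) s) \<partial>\<M> x)"
        by (rule Bochner_Integration.integral_sum) (rule int_ind)
      also have "\<dots> = (\<Sum>i<N. f i * complex_of_real ((norm (E (B i) x))\<^sup>2))"
        using B by (intro sum.cong refl) (simp add: measure_M)
      finally show ?thesis ..
    qed
    have T_norm: "norm (T x) = norm x" for x
    proof -
      have orth: "cinner (w i *\<^sub>C E (B i) x) (w k *\<^sub>C E (B k) x) =
          (if i = k then complex_of_real ((norm (E (B i) x))\<^sup>2) else 0)" for i k
      proof (cases "i = k")
        case True
        then show ?thesis
          by (simp add: cinner_self norm_scaleC w_def del: of_real_power)
      next
        case False
        then have "B i \<inter> B k = {}" by (auto simp: B_def)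
        then have "E (B i) (E (B k) x) = 0" using E_Int[OF B B, of i k x] E_empty by simp
        then show ?thesis
          using False projection_cinner(2)[OF proj[OF B], of i x "E (B k) x"]
          by (simp add: cinner_scaleC_left cinner_scaleC_right)
      qed
      have "cinner (T x) (T x) = (\<Sum>i<N. \<Sum>k<N. if i = k then complex_of_real ((norm (E (B i) x))\<^sup>2) else 0)"
        unfolding T_def sum_cinner_sums[symmetric] orth ..
      also have "\<dots> = (\<Sum>i<N. 1 * complex_of_real ((norm (E (B i) x))\<^sup>2))"
        by (subst double_sum_diagonal) simp_all
      also have "\<dots> = (\<integral>s. 1 \<partial>\<M> x)" by (rule step)
      also have "\<dots> = complex_of_real ((norm x)\<^sup>2)"
        by (simp add: measure_M E_UNIV scaleR_conv_of_real)
      finally have "(norm (T x))\<^sup>2 = (norm x)\<^sup>2" unfolding cinner_self of_real_eq_iff .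
      then show ?thesis by simp
    qed
    \<comment> \<open>\<open>U\<close> is known through its quadratic form only, so the uniform
      error passes to the operators by way of the numerical radius, at the price of a factor
      2.\<close>
    have "norm (U x - T x) \<le> 2 * (2 * pi / real N) * norm x" for x
    proof (rule numerical_radius_bound[where V = "\<lambda>x. U x - T x"])
      show "U (x + y) - T (x + y) = (U x - T x) + (U y - T y)" for x y
        by (simp add: bounded_clinear_add[OF U] T_add)
      show "U (c *\<^sub>C x) - T (c *\<^sub>C x) = c *\<^sub>C (U x - T x)" for c x
        by (simp add: bounded_clinear_scaleC[OF U] T_scale complex_vector.scale_right_diff_distrib)
      fix x
      have "cinner x (T x) = (\<Sum>i<N. w i * complex_of_real ((norm (E (B i) x))\<^sup>2))"
        using B by (simp add: T_def cinner_sum_right cinner_scaleC_right form_real del: of_real_power)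
      also have "\<dots> = (\<integral>s. w (j s) \<partial>\<M> x)" by (rule step)
      finally have "cinner x (U x - T x) = (\<integral>s. cis (h s) \<partial>\<M> x) - (\<integral>s. w (j s) \<partial>\<M> x)"
        by (simp add: cinner_diff_right form)
      also have "\<dots> = (\<integral>s. cis (h s) - w (j s) \<partial>\<M> x)"
        by (intro Bochner_Integration.integral_diff[symmetric] integrable_bounded[where K = 1])
          (auto simp: w_def)
      finally have "cmod (cinner x (U x - T x)) \<le> (\<integral>s. cmod (cis (h s) - w (j s)) \<partial>\<M> x)"
        by (simp only: integral_norm_bound)
      also have "\<dots> \<le> (\<integral>s. 2 * pi / real N \<partial>\<M> x)"
      proof (rule integral_mono)
        show "integrable (\<M> x) (\<lambda>s. cmod (cis (h s) - w (j s)))"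
          using cis_step_approx(2)[OF N] by (intro integrable_bounded[where K = "2 * pi / real N"]) (auto simp: w_def j_def)
        show "cmod (cis (h s) - w (j s)) \<le> 2 * pi / real N" for s
          unfolding w_def j_def by (rule cis_step_approx(2)[OF N])
      qed (rule finite_measure.integrable_const[OF finite_M])
      also have "\<dots> = 2 * pi / real N * (norm x)\<^sup>2" by (simp add: measure_M E_UNIV)
      finally show "cmod (cinner x (U x - T x)) \<le> 2 * pi / real N * (norm x)\<^sup>2" .
    qed
    then have "norm (U x - T x) \<le> 4 * pi / real N * norm x" by simp
    then show ?thesis using norm_triangle_ineq3[of "U x" "T x"] T_norm[of x] by simp
  qed
  have "(\<lambda>n. 4 * pi * norm x * inverse (real (Suc n))) \<longlonglongrightarrow> 4 * pi * norm x * 0"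
    by (intro tendsto_intros LIMSEQ_inverse_real_of_nat)
  moreover have "\<forall>n\<ge>0. \<bar>norm (U x) - norm x\<bar> \<le> 4 * pi * norm x * inverse (real (Suc n))"
    using close[of "Suc _"] by (simp add: divide_inverse mult_ac)
  ultimately have "\<bar>norm (U x) - norm x\<bar> \<le> 4 * pi * norm x * 0"
    by (intro LIMSEQ_le_const) auto
  then show ?thesis by simp
qed

text \<open>For \<open>w = E(B) \<Lambda>\<close> and \<open>|1 + d| = 1\<close> the vectors \<open>\<Lambda> + d w\<close> and \<open>\<Lambda>\<close> have the same spectral measure.  Comparing
  the quadratic forms for \<open>d = -2\<close> and \<open>d = \<i> - 1\<close> gives \<open>\<integral> s d\<langle>w, E w\<rangle> = \<langle>w, w\<rangle>\<close>.\<close>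

lemma fixed_vector_moment:
  assumes res: "spectral_resolution D E" and fixed: "(\<Lambda>, \<Lambda>) \<in> D"
    and B: "B \<in> sets borel" and bd: "\<forall>s\<in>B. \<bar>s\<bar> \<le> K"
  shows "integrable (\<M> (E B \<Lambda>)) (\<lambda>s. s)" "AE s in \<M> (E B \<Lambda>). s \<in> B"
    "(\<integral>s. s \<partial>\<M> (E B \<Lambda>)) = (norm (E B \<Lambda>))\<^sup>2"
proof -
  define w where "w = E B \<Lambda>"
  have EBC: "E C w = E (C \<inter> B) \<Lambda>" if "C \<in> sets borel" for C
    using E_Int[OF that B] by (simp add: w_def)
  have "E (- B) w = 0" using EBC[of "- B"] B E_empty by simp
  then have "emeasure (\<M> w) (- B) = 0" using B by (simp add: emeasure_M)
  then have "AE s in \<M> w. s \<in> B"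
    using B by (intro AE_I[where N = "- B"]) auto
  then show ae: "AE s in \<M> (E B \<Lambda>). s \<in> B" by (simp only: w_def)
  have ae': "AE s in \<M> w. \<bar>s\<bar> \<le> K" using \<open>AE s in \<M> w. s \<in> B\<close> by eventually_elim (use bd in blast)
  show int: "integrable (\<M> (E B \<Lambda>)) (\<lambda>s. s)"
    unfolding w_def[symmetric]
    by (rule finite_measure.integrable_const_bound[OF finite_M, where B = K]) (use ae' in simp_all)
  \<comment> \<open>Boundedness of \<open>B\<close> puts \<open>w\<close> into the domain of
    \<open>D\<close>, so that the form identity of the resolution applies to combinations of
    \<open>\<Lambda>\<close> and \<open>w\<close>.\<close>
  have "integrable (\<M> w) (\<lambda>s. s\<^sup>2)"
  proof (rule finite_measure.integrable_const_bound[OF finite_M, where B = "K\<^sup>2"])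
    show "AE s in \<M> w. norm (s\<^sup>2) \<le> K\<^sup>2"
      using ae' by eventually_elim (simp add: abs_le_square_iff[symmetric])
  qed simp
  then have "w \<in> Domain D" using res by (simp add: spectral_resolution_def)
  then obtain w' where w': "(w, w') \<in> D" by blast
  have form: "cinner x y = complex_of_real (\<integral>s. s \<partial>\<M> x)" if "(x, y) \<in> D" for x y
    using res that by (auto simp: spectral_resolution_def)
  have comb: "(\<Lambda> + d *\<^sub>C w, \<Lambda> + d *\<^sub>C w') \<in> D" for d
    using res fixed w' unfolding spectral_resolution_def by blast
  have same: "\<M> (\<Lambda> + d *\<^sub>C w) = \<M> \<Lambda>" if d: "d + cnj d + cnj d * d = 0" for d
  proof (rule M_eqI)
    fix C :: "real set" assume C: "C \<in> sets borel"
    note bE = projection_cinner(3)[OF proj]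
    have r: "cinner \<Lambda> (E C w) = cinner w (E C w)" "cinner w (E C \<Lambda>) = cinner w (E C w)"
    proof -
      have EBEC: "E B (E C w) = E C w"
        using E_Int[OF B C, of w] E_Int[OF C B, of w] E_Int[OF B B, of \<Lambda>] by (simp add: Int_commute w_def)
      show "cinner \<Lambda> (E C w) = cinner w (E C w)"
        using projection_cinner(2)[OF proj[OF B], of \<Lambda> "E C w"] EBEC by (simp add: w_def)
      then have "cinner (E C w) \<Lambda> = cinner (E C w) w" by (metis cinner_commute)
      then show "cinner w (E C \<Lambda>) = cinner w (E C w)" by (simp add: projection_cinner(2)[OF proj[OF C]])
    qed
    have "cinner (\<Lambda> + d *\<^sub>C w) (E C (\<Lambda> + d *\<^sub>C w)) =
        cinner \<Lambda> (E C \<Lambda>) + (d + cnj d + cnj d * d) * cinner w (E C w)"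
      by (simp add: bounded_clinear_add[OF bE[OF C]] bounded_clinear_scaleC[OF bE[OF C]] cinner_add_left
          cinner_add_right cinner_scaleC_left cinner_scaleC_right r algebra_simps)
    then have "cinner (\<Lambda> + d *\<^sub>C w) (E C (\<Lambda> + d *\<^sub>C w)) = cinner \<Lambda> (E C \<Lambda>)" by (simp only: d) simp
    then have "(norm (E C (\<Lambda> + d *\<^sub>C w)))\<^sup>2 = (norm (E C \<Lambda>))\<^sup>2"
      unfolding form_real[OF C] of_real_eq_iff .
    then show "norm (E C (\<Lambda> + d *\<^sub>C w)) = norm (E C \<Lambda>)" by simp
  qed
  define p where "p = cinner \<Lambda> w'"
  define q where "q = cinner w \<Lambda>"
  define m where "m = cinner w w'"
  have rel: "d * p + cnj d * q + cnj d * d * m = 0" if d: "d + cnj d + cnj d * d = 0" for d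
  proof -
    have "cinner (\<Lambda> + d *\<^sub>C w) (\<Lambda> + d *\<^sub>C w') = cinner \<Lambda> \<Lambda>"
      using form[OF comb[of d]] form[OF fixed] same[OF d] by simp
    then show ?thesis
      by (simp add: cinner_add_left cinner_add_right cinner_scaleC_left cinner_scaleC_right p_def q_def m_def algebra_simps)
  qed
  have "- 2 * p - 2 * q + 4 * m = 0" using rel[of "-2"] by simp
  moreover have "(\<i> - 1) * p + (- \<i> - 1) * q + 2 * m = 0"
    using rel[of "\<i> - 1"] by (simp add: algebra_simps)
  \<comment> \<open>The first relation says \<open>p = 2 * m - q\<close>; inserted into the second
    it leaves \<open>2 * \<i> * (m - q) = 0\<close>.\<close>
  ultimately have "m = q" by (simp add: complex_eq_iff)
  then have "complex_of_real (\<integral>s. s \<partial>\<M> w) = cinner w \<Lambda>" using form[OF w'] by (simp add: m_def q_def)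
  also have "\<dots> = complex_of_real ((norm w)\<^sup>2)"
    using projection_cinner(1)[OF proj[OF B], of \<Lambda> \<Lambda>] projection_cinner(2)[OF proj[OF B], of \<Lambda> \<Lambda>]
    by (simp add: w_def cinner_self)
  finally show "(\<integral>s. s \<partial>\<M> (E B \<Lambda>)) = (norm (E B \<Lambda>))\<^sup>2" unfolding of_real_eq_iff w_def .
qed

text \<open>By the moment identity \<open>c * (s - 1)\<close> has integral zero against the spectral
  measure of \<open>E B \<Lambda>\<close>, which lives on \<open>B\<close>. As the function is
  positive there, the measure is zero; the sign of \<open>c\<close> selects the side of 1.\<close>

lemma fixed_vector_null:
  assumes res: "spectral_resolution D E" and fixed: "(\<Lambda>, \<Lambda>) \<in> D"
    and B: "B \<in> sets borel" and bd: "\<forall>s\<in>B. \<bar>s\<bar> \<le> K" and sign: "\<And>s. s \<in> B \<Longrightarrow> 0 < c * (s - 1)"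
  shows "E B \<Lambda> = 0"
proof -
  let ?w = "E B \<Lambda>"
  note mom = fixed_vector_moment[OF res fixed B bd]
  interpret finite_measure "\<M> ?w" by (rule finite_M)
  have "(\<integral>s. c * (s - 1) \<partial>\<M> ?w) = c * ((\<integral>s. s \<partial>\<M> ?w) - (norm ?w)\<^sup>2)"
    using mom(1) by (simp add: Bochner_Integration.integral_diff measure_M E_UNIV)
  then have zero: "(\<integral>s. c * (s - 1) \<partial>\<M> ?w) = 0" using mom(3) by simp
  have int: "integrable (\<M> ?w) (\<lambda>s. c * (s - 1))" using mom(1) by simp
  have "AE s in \<M> ?w. 0 \<le> c * (s - 1)" using mom(2) by eventually_elim (simp add: sign less_imp_le)
  then have "AE s in \<M> ?w. c * (s - 1) = 0" using integral_nonneg_eq_0_iff_AE[OF int] zero by blast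
  with mom(2) have "AE s in \<M> ?w. False" by eventually_elim (use sign in force)
  then have "emeasure (\<M> ?w) UNIV = 0" by (simp add: AE_iff_measurable[where N = UNIV])
  then show ?thesis by (simp add: emeasure_M E_UNIV)
qed

text \<open>The moment identity is available on bounded sets only, hence the exhaustion of the
  complement of 1 by countably many bounded intervals.\<close>

lemma fixed_vector_spectrum:
  assumes res: "spectral_resolution D E" and fixed: "(\<Lambda>, \<Lambda>) \<in> D"
  shows "AE s in \<M> \<Lambda>. s = 1"
proof -
  have "AE s in \<M> \<Lambda>. \<forall>n. s \<notin> {1<..real n} \<and> s \<notin> {- real n..<1}"
  proof (subst AE_all_countable, intro allI AE_conjI)
    fix n :: nat
    have "E {1<..real n} \<Lambda> = 0"
      by (rule fixed_vector_null[OF res fixed, where K = "real n" and c = 1]) auto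
    then show "AE s in \<M> \<Lambda>. s \<notin> {1<..real n}"
      by (intro AE_I[where N = "{1<..real n}"]) (auto simp: emeasure_M)
    \<comment> \<open>The bound has to cover both ends of the interval, since points near 1 belong
      to it even for \<open>n = 0\<close>; thus the maximum with 1.\<close>
    have "E {- real n..<1} \<Lambda> = 0"
      by (rule fixed_vector_null[OF res fixed, where K = "max 1 (real n)" and c = "-1"]) auto
    then show "AE s in \<M> \<Lambda>. s \<notin> {- real n..<1}"
      by (intro AE_I[where N = "{- real n..<1}"]) (auto simp: emeasure_M)
  qed
  then show ?thesis
  proof eventually_elim
    fix s :: real assume s: "\<forall>n. s \<notin> {1<..real n} \<and> s \<notin> {- real n..<1}"
    obtain n where "\<bar>s\<bar> \<le> real n" using real_arch_simple by blast
    with s[rule_format, of n] show "s = 1" by auto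
  qed
qed

end

text \<open>Conjugating the integrand changes the sign of \<open>t\<close>, so
  \<open>U (- t)\<close> is the adjoint of \<open>U t\<close>; with isometry this gives the inverse.
  For a fixed vector of \<open>D\<close> the integrand is 1 almost everywhere, so \<open>cinner
  \<Lambda> (U t \<Lambda>) = cinner \<Lambda> \<Lambda>\<close>, the equality case of
  Cauchy-Schwarz for an isometry.\<close>

lemma imaginary_powers_unitary:
  assumes U: "imaginary_powers D U"
  shows "bounded_clinear (U t)" and "cinner (U t x) y = cinner x (U (- t) y)"
    and "U t (U (- t) x) = x"
    and "(\<Lambda>, \<Lambda>) \<in> D \<Longrightarrow> U t \<Lambda> = \<Lambda>"
proof -
  obtain E where E: "spectral_resolution D E" and bU: "\<And>t. bounded_clinear (U t)"
    and form: "\<And>t x. cinner x (U t x) = (\<integral>s. cis (t * ln s) \<partial>spectral_measure E x)"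
    using U by (auto simp: imaginary_powers_def)
  interpret pvm E by standard (use E in \<open>simp add: spectral_resolution_def\<close>)
  show "bounded_clinear (U t)" by (rule bU)
  have adj: "cadjoint (U t) = U (- t)" for t
  proof (rule quadratic_form_eqI[OF bounded_clinear_cadjoint[OF bU] bU])
    fix x
    have "cinner x (cadjoint (U t) x) = cnj (cinner x (U t x))"
      using cadjoint_right[OF bU, of t x x] cinner_commute[of "U t x" x] by simp
    also have "\<dots> = cinner x (U (- t) x)"
      unfolding form Bochner_Integration.integral_cnj[symmetric] by (simp add: cis_cnj)
    finally show "cinner x (cadjoint (U t) x) = cinner x (U (- t) x)" .
  qed
  show adj': "cinner (U t x) y = cinner x (U (- t) y)" for t x y
    using cadjoint_right[OF bU] adj by simp
  have iso: "norm (U t x) = norm x" for t x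
    by (rule spectral_integral_isometric[OF bU form]) simp
  have "U t \<circ> U (- t) = id"
  proof (rule quadratic_form_eqI[OF bounded_clinear_comp[OF bU bU] bounded_clinear_id])
    show "cinner x ((U t \<circ> U (- t)) x) = cinner x (id x)" for x
      using adj'[of "- t" x "U (- t) x"] iso[of "- t" x] by (simp add: cinner_self)
  qed
  then show "U t (U (- t) x) = x" by (simp add: fun_eq_iff)
  show "U t \<Lambda> = \<Lambda>" if "(\<Lambda>, \<Lambda>) \<in> D"
  proof -
    have "cinner \<Lambda> (U t \<Lambda>) = (\<integral>s. 1 \<partial>spectral_measure E \<Lambda>)"
      unfolding form
    proof (intro integral_cong_AE)
      show "(\<lambda>s. cis (t * ln s)) \<in> borel_measurable (\<M> \<Lambda>)" by measurable
      show "AE s in \<M> \<Lambda>. cis (t * ln s) = 1"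
        using fixed_vector_spectrum[OF E that] by eventually_elim simp
    qed simp
    also have "\<dots> = cinner \<Lambda> \<Lambda>" by (simp add: measure_M E_UNIV cinner_self scaleR_conv_of_real)
    finally have eq: "cinner \<Lambda> (U t \<Lambda>) = cinner \<Lambda> \<Lambda>" .
    then have eq': "cinner (U t \<Lambda>) \<Lambda> = cinner \<Lambda> \<Lambda>" by (metis cinner_commute)
    have "cinner (U t \<Lambda> - \<Lambda>) (U t \<Lambda> - \<Lambda>) = 0"
      by (simp add: cinner_diff_left cinner_diff_right eq eq') (simp add: cinner_self iso)
    then show ?thesis by (simp add: cinner_self)
  qed
qed

text \<open>Both \<open>S\<close> and its adjoint fix \<open>\<Lambda>\<close>. For \<open>S\<close>
  take \<open>a = id\<close>; for the adjoint, \<open>cinner \<Lambda> (a \<Lambda>) = cinner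
  (cadjoint a \<Lambda>) \<Lambda>\<close> is a closed relation and so extends from the core to the
  closure.\<close>

lemma modular_operator_fixed:
  assumes vA: "von_neumann_algebra A"
  shows "(\<Lambda>, \<Lambda>) \<in> modular_operator A \<Lambda>"
proof -
  have S: "(\<Lambda>, \<Lambda>) \<in> tomita_operator A \<Lambda>"
  proof -
    have "(\<Lambda>, \<Lambda>) \<in> {(a \<Lambda>, cadjoint a \<Lambda>) |a. a \<in> A}"
    proof -
      have "(\<Lambda>, \<Lambda>) = (id \<Lambda>, cadjoint id \<Lambda>)" by simp
      with vna_id[OF vA] show ?thesis unfolding mem_Collect_eq by (intro exI[of _ id] conjI)
    qed
    then show ?thesis unfolding tomita_operator_def by (rule subsetD[OF closure_subset])
  qed
  have "closed {p. cinner \<Lambda> (fst p) = cinner (snd p) \<Lambda>}"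
    by (intro closed_Collect_eq continuous_on_cinner continuous_intros)
  moreover have "{(a \<Lambda>, cadjoint a \<Lambda>) |a. a \<in> A} \<subseteq> {p. cinner \<Lambda> (fst p) = cinner (snd p) \<Lambda>}"
    using vna_bounded_clinear[OF vA] by (auto simp: cadjoint_left)
  ultimately have "tomita_operator A \<Lambda> \<subseteq> {p. cinner \<Lambda> (fst p) = cinner (snd p) \<Lambda>}"
    unfolding tomita_operator_def by (rule closure_minimal[rotated])
  then have "(\<Lambda>, \<Lambda>) \<in> antilinear_adjoint (tomita_operator A \<Lambda>)"
    by (auto simp: antilinear_adjoint_def)
  with S show ?thesis by (auto simp: modular_operator_def)
qed

text \<open>The dual map is the conjugation
  \<open>b \<mapsto> U (- t) \<circ> b \<circ> U t\<close>. It preserves the commutant because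
  \<open>\<sigma> t\<close> maps \<open>A\<close> into itself, and it satisfies the defining
  relation because \<open>U t\<close> fixes \<open>\<Lambda>\<close>. By cyclicity an element of the
  commutant is determined by its value at \<open>\<Lambda>\<close>, which settles the definite
  description.\<close>

lemma modular_group_dual:
  assumes vA: "von_neumann_algebra A" and cs: "cyclic_separating A \<Lambda>" and mod: "is_modular_group A \<Lambda> \<sigma>"
  shows "a \<in> A \<Longrightarrow> \<sigma> t a \<in> A" and "a \<in> A \<Longrightarrow> cinner \<Lambda> (\<sigma> t a \<Lambda>) = cinner \<Lambda> (a \<Lambda>)"
    and "b \<in> commutant A \<Longrightarrow> dual_map A \<Lambda> (\<sigma> t) b \<in> commutant A"
    and "b \<in> commutant A \<Longrightarrow> a \<in> A \<Longrightarrow>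
      cinner \<Lambda> (a (dual_map A \<Lambda> (\<sigma> t) b \<Lambda>)) = cinner \<Lambda> (\<sigma> t a (b \<Lambda>))"
proof -
  obtain U where U: "imaginary_powers (modular_operator A \<Lambda>) U"
    and \<sigma>: "\<And>t a. a \<in> A \<Longrightarrow> \<sigma> t a = U t \<circ> a \<circ> U (- t)" "\<And>t a. a \<in> A \<Longrightarrow> \<sigma> t a \<in> A"
    using mod unfolding is_modular_group_def by blast
  note bU = imaginary_powers_unitary(1)[OF U] and adj = imaginary_powers_unitary(2)[OF U]
    and inv = imaginary_powers_unitary(3)[OF U]
    and fixed = imaginary_powers_unitary(4)[OF U modular_operator_fixed[OF vA]]
  have inv': "U (- t) (U t x) = x" for t x using inv[of "- t" x] by simp
  have fix_left: "cinner \<Lambda> (U t x) = cinner \<Lambda> x" for t x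
    using adj[of "- t" \<Lambda> x] fixed[of "- t"] by simp
  show "a \<in> A \<Longrightarrow> \<sigma> t a \<in> A" by (rule \<sigma>)
  show "a \<in> A \<Longrightarrow> cinner \<Lambda> (\<sigma> t a \<Lambda>) = cinner \<Lambda> (a \<Lambda>)" by (simp add: \<sigma>(1) fix_left fixed)
  have dense: "closure ((\<lambda>a. a \<Lambda>) ` A) = UNIV" using cs by (simp add: cyclic_separating_def)
  have dual: "dual_map A \<Lambda> (\<sigma> t) b = U (- t) \<circ> b \<circ> U t \<and> U (- t) \<circ> b \<circ> U t \<in> commutant A \<and>
     (\<forall>a\<in>A. cinner \<Lambda> (a ((U (- t) \<circ> b \<circ> U t) \<Lambda>)) = cinner \<Lambda> (\<sigma> t a (b \<Lambda>)))"
    if b: "b \<in> commutant A"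
  proof -
    let ?c = "U (- t) \<circ> b \<circ> U t"
    have bb: "bounded_clinear b" using b by (rule commutant_bounded_clinear)
    have c: "?c \<in> commutant A"
    proof (rule commutantI)
      show "bounded_clinear ?c" by (intro bounded_clinear_comp bU bb)
      fix a x assume a: "a \<in> A"
      have "a (?c x) = U (- t) (\<sigma> t a (b (U t x)))" using a by (simp add: \<sigma>(1) inv')
      also have "\<dots> = U (- t) (b (\<sigma> t a (U t x)))" using commutant_commute[OF \<sigma>(2)[OF a] b] by simp
      also have "\<dots> = ?c (a x)" using a by (simp add: \<sigma>(1) inv')
      finally show "a (?c x) = ?c (a x)" .
    qed
    have pair: "cinner \<Lambda> (a (?c \<Lambda>)) = cinner \<Lambda> (\<sigma> t a (b \<Lambda>))" if "a \<in> A" for a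
      using that by (simp add: \<sigma>(1) fixed fix_left)
    have "dual_map A \<Lambda> (\<sigma> t) b = ?c"
      unfolding dual_map_def
    proof (rule the_equality)
      fix c' assume c': "c' \<in> commutant A \<and> (\<forall>a\<in>A. cinner \<Lambda> (a (c' \<Lambda>)) = cinner \<Lambda> (\<sigma> t a (b \<Lambda>)))"
      have "c' \<Lambda> = ?c \<Lambda>"
      proof (rule cinner_dense_eqI[OF dense])
        fix d assume "d \<in> (\<lambda>a. a \<Lambda>) ` A"
        then obtain a where a: "a \<in> A" "d = a \<Lambda>" by blast
        have "cinner d (c' \<Lambda>) = cinner d (?c \<Lambda>)"
          using c' pair[OF vna_cadjoint[OF vA a(1)]] vna_cadjoint[OF vA a(1)] a
          by (simp add: cadjoint_right[OF vna_bounded_clinear[OF vA]])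
        then show "cinner (c' \<Lambda>) d = cinner (?c \<Lambda>) d" by (metis cinner_commute)
      qed
      then show "c' = ?c"
        using c' c by (intro bounded_clinear_dense_eqI[OF _ _ dense])
          (auto simp: commutant_bounded_clinear commutant_commute[symmetric] simp del: o_apply)
    qed (use c pair in blast)
    with c pair show ?thesis by blast
  qed
  show "b \<in> commutant A \<Longrightarrow> dual_map A \<Lambda> (\<sigma> t) b \<in> commutant A" using dual by simp
  show "b \<in> commutant A \<Longrightarrow> a \<in> A \<Longrightarrow>
      cinner \<Lambda> (a (dual_map A \<Lambda> (\<sigma> t) b \<Lambda>)) = cinner \<Lambda> (\<sigma> t a (b \<Lambda>))" using dual by simp
qed

section \<open>The cost of a transport plan\<close>

text \<open>The orthogonal projection onto the closure of \<open>A' \<Lambda>\<close> lies in \<open>A'' = A\<close> and fixes \<open>\<Lambda>\<close>.\<close>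

lemma separating_imp_cyclic_commutant:
  assumes vA: "von_neumann_algebra A" and cs: "cyclic_separating A \<Lambda>"
  shows "closure ((\<lambda>b. b \<Lambda>) ` commutant A) = UNIV"
proof -
  note vB = von_neumann_algebra_commutant[OF vA]
  define D where "D = (\<lambda>b. b \<Lambda>) ` commutant A"
  have D_add: "x + y \<in> D" if xy: "x \<in> D" "y \<in> D" for x y
  proof -
    obtain b c where b: "b \<in> commutant A" "c \<in> commutant A" "x = b \<Lambda>" "y = c \<Lambda>" using xy by (auto simp: D_def)
    have "x + y = (b + c) \<Lambda>" using b by simp
    then show ?thesis unfolding D_def using vna_plus[OF vB b(1,2)] by blast
  qed
  have D_scale: "c *\<^sub>C x \<in> D" if x: "x \<in> D" for c x
  proof -
    obtain b where b: "b \<in> commutant A" "x = b \<Lambda>" using x by (auto simp: D_def)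
    have "c *\<^sub>C x = (c *\<^sub>C b) \<Lambda>" using b by (simp add: scaleC_fun_def)
    then show ?thesis unfolding D_def using vna_scaleC[OF vB b(1)] by blast
  qed
  have \<Lambda>D: "\<Lambda> \<in> D" unfolding D_def using vna_id[OF vB] by (rule rev_image_eqI) simp
  have D: "csubspace D"
    unfolding complex_vector.subspace_def using D_add D_scale D_scale[OF \<Lambda>D, of 0] by auto
  have "\<exists>y\<in>closure D. norm y \<le> norm x \<and> (\<forall>d\<in>D. cinner y d = cinner x d)" for x
    by (rule riesz_on_subspace[OF D]) (simp_all add: cinner_add_right cinner_scaleC_right cmod_cinner_le)
  then obtain p where p: "\<And>x. p x \<in> closure D" "\<And>x. norm (p x) \<le> norm x" 
    "\<And>x d. d \<in> D \<Longrightarrow> cinner (p x) d = cinner x d" by metis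
  \<comment> \<open>This characterizes the projection onto \<open>closure D\<close>; its linearity,
    its commutation with the commutant and \<open>p \<Lambda> = \<Lambda>\<close> are all checked by
    it.\<close>
  have unique: "y = p x" if y: "y \<in> closure D" and "\<And>d. d \<in> D \<Longrightarrow> cinner y d = cinner x d" for x y
  proof -
    obtain s where s: "\<forall>n. s n \<in> D" "s \<longlonglongrightarrow> y"
      using y closure_sequential[of y D] by auto
    obtain t where t: "\<forall>n. t n \<in> D" "t \<longlonglongrightarrow> p x"
      using p(1)[of x] closure_sequential[of "p x" D] by auto
    note st = s t
    have "cinner (y - p x) (s n - t n) = 0" for n
      using st(1,3) that(2) p(3) by (simp add: cinner_diff_left cinner_diff_right)
    moreover have "(\<lambda>n. cinner (y - p x) (s n - t n)) \<longlonglongrightarrow> cinner (y - p x) (y - p x)"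
      by (intro tendsto_cinner tendsto_const tendsto_diff st)
    ultimately have "cinner (y - p x) (y - p x) = 0" by (simp add: LIMSEQ_const_iff)
    then show ?thesis by (simp add: cinner_self)
  qed
  have cl_add: "x + y \<in> closure D" if x: "x \<in> closure D" and y: "y \<in> closure D" for x y
  proof -
    obtain s where s: "\<forall>n. s n \<in> D" "s \<longlonglongrightarrow> x"
      using x closure_sequential[of x D] by auto
    obtain t where t: "\<forall>n. t n \<in> D" "t \<longlonglongrightarrow> y"
      using y closure_sequential[of y D] by auto
    note st = s t
    then have "(\<lambda>n. s n + t n) \<longlonglongrightarrow> x + y" by (intro tendsto_add)
    then show ?thesis unfolding closure_sequential using st(1,3) D_add by (intro exI[of _ "\<lambda>n. s n + t n"]) simp
  qed
  have cl_map: "b x \<in> closure D" if b: "bounded_clinear b" "\<And>d. d \<in> D \<Longrightarrow> b d \<in> D" and x: "x \<in> closure D" for b x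
  proof -
    obtain s where s: "\<forall>n. s n \<in> D" "s \<longlonglongrightarrow> x" using x closure_sequential[of x D] by auto
    then have "(\<lambda>n. b (s n)) \<longlonglongrightarrow> b x" by (intro bounded_clinear_tendsto[OF b(1)])
    then show ?thesis unfolding closure_sequential using s(1) b(2) by (intro exI[of _ "\<lambda>n. b (s n)"]) simp
  qed
  have bp: "bounded_clinear p"
  proof (rule bounded_clinearI[where K = 1])
    show "p (x + y) = p x + p y" for x y
      by (rule unique[symmetric]) (auto intro!: cl_add p(1) simp: p(3) cinner_add_left)
    fix c x
    have "(c *\<^sub>C id) (p x) \<in> closure D"
      by (rule cl_map[OF bounded_clinear_scale[OF bounded_clinear_id] _ p(1)])
        (simp add: scaleC_fun_def D_scale)
    then show "p (c *\<^sub>C x) = c *\<^sub>C p x"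
      by (intro unique[symmetric]) (simp_all add: p(3) cinner_scaleC_left scaleC_fun_def)
  qed (simp add: p(2))
  have "p \<in> commutant (commutant A)"
  proof (rule commutantI[OF bp])
    fix b x assume b: "b \<in> commutant A"
    have bb: "bounded_clinear b" using b by (rule commutant_bounded_clinear)
    have maps: "c d \<in> D" if c: "c \<in> commutant A" and d: "d \<in> D" for c d
    proof -
      obtain e where e: "e \<in> commutant A" "d = e \<Lambda>" using d by (auto simp: D_def)
      have "c d = (c \<circ> e) \<Lambda>" using e by simp
      then show ?thesis unfolding D_def using vna_comp[OF vB c e(1)] by blast
    qed
    show "b (p x) = p (b x)"
    proof (rule unique)
      show "b (p x) \<in> closure D" by (rule cl_map[OF bb maps[OF b] p(1)])
      show "cinner (b (p x)) d = cinner (b x) d" if "d \<in> D" for d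
        using p(3)[OF maps[OF vna_cadjoint[OF vB b] that]] by (simp add: cadjoint_right[OF bb])
    qed
  qed
  then have pA: "id - p \<in> A" using vna_bicommutant[OF vA] vna_id[OF vA] by (simp add: vna_minus[OF vA])
  have "p \<Lambda> = \<Lambda>" using \<Lambda>D closure_subset by (intro unique[symmetric]) auto
  then have "(id - p) \<Lambda> = 0" by simp
  then have "id - p = 0" using cs pA unfolding cyclic_separating_def by blast
  then have "p x = x" for x by (simp add: fun_eq_iff)
  then have "x \<in> closure D" for x using p(1)[of x] by simp
  then show ?thesis by (auto simp: D_def)
qed

text \<open>\<open>R\<close> is an arbitrary cyclic representation, as the one in
  \<open>transport_cost\<close> comes from a choice operator. The aim is to express the cost through
  \<open>\<omega>\<close> and \<open>cp\<close> alone.\<close>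

locale plan_rep = right_plan A B \<omega> \<Lambda>
  for A B :: "'g::complex_hilbert_space op set" and \<omega> \<Lambda> +
  fixes R :: "'g tensor_rep"
  assumes B_commutant: "B = commutant A" and cyclic: "cyclic_representation A B \<omega> R"
begin

abbreviation "\<pi> \<equiv> rep_act R"
abbreviation "\<Omega> \<equiv> rep_cyc R"
abbreviation "W \<equiv> rep_space R"
abbreviation "rip \<equiv> rep_inner R"

lemma hilbert: "hilbert_rep_space R"
  using cyclic by (simp only: cyclic_representation_def)

sublocale W: semi_inner W rip
proof
  note h = hilbert[unfolded hilbert_rep_space_def]
  show "csubspace W" using h by (rule conjunct1)
  show "rip x (y + z) = rip x y + rip x z" if "x \<in> W" "y \<in> W" "z \<in> W" for x y z
    using h[THEN conjunct2, THEN conjunct1] that by blast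
  show "rip x (c *\<^sub>C y) = c * rip x y" if "x \<in> W" "y \<in> W" for x y c
    using h[THEN conjunct2, THEN conjunct2, THEN conjunct1] that by blast
  show "rip y x = cnj (rip x y)" if "x \<in> W" "y \<in> W" for x y
    using h[THEN conjunct2, THEN conjunct2, THEN conjunct2, THEN conjunct1] that by blast
  show "rip x x \<in> \<real>\<^sub>\<ge>\<^sub>0" if "x \<in> W" for x
    using h[THEN conjunct2, THEN conjunct2, THEN conjunct2, THEN conjunct2, THEN conjunct1] that by blast
qed

lemma W_nrm: "W.nrm = rep_norm R"
  by (simp add: fun_eq_iff W.nrm_def rep_norm_def)

lemma W_definite: "v \<in> W \<Longrightarrow> W.nrm v = 0 \<Longrightarrow> v = 0"
proof -
  assume v: "v \<in> W" "W.nrm v = 0"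
  have "\<forall>v\<in>W. rip v v = 0 \<longrightarrow> v = 0"
    using hilbert[unfolded hilbert_rep_space_def, THEN conjunct2, THEN conjunct2, THEN conjunct2,
        THEN conjunct2, THEN conjunct2] by (rule conjunct1)
  then show "v = 0" using v W.ip_self[of v] by simp
qed

lemma W_complete:
  assumes "\<And>n::nat. X n \<in> W" "\<forall>e>0. \<exists>M. \<forall>m\<ge>M. \<forall>n\<ge>M. W.nrm (X m - X n) < e"
  shows "\<exists>v\<in>W. (\<lambda>n. W.nrm (X n - v)) \<longlonglongrightarrow> 0"
proof -
  have "\<forall>X::nat \<Rightarrow> _. range X \<subseteq> W \<and> (\<forall>e>0. \<exists>M. \<forall>m\<ge>M. \<forall>n\<ge>M. W.nrm (X m - X n) < e) \<longrightarrow>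
      (\<exists>v\<in>W. (\<lambda>n. W.nrm (X n - v)) \<longlonglongrightarrow> 0)"
    using hilbert[unfolded hilbert_rep_space_def, THEN conjunct2, THEN conjunct2, THEN conjunct2,
        THEN conjunct2, THEN conjunct2, THEN conjunct2] unfolding W_nrm .
  moreover have "range X \<subseteq> W" using assms(1) by blast
  ultimately show ?thesis using assms(2) by simp
qed

lemma \<Omega>_in: "\<Omega> \<in> W"
  using cyclic by (simp only: cyclic_representation_def)

lemma \<pi>_in: "a \<in> A \<Longrightarrow> b \<in> B \<Longrightarrow> v \<in> W \<Longrightarrow> \<pi> a b v \<in> W"
  using cyclic[unfolded cyclic_representation_def, THEN conjunct2, THEN conjunct1] by blast

lemma \<pi>_id: "v \<in> W \<Longrightarrow> \<pi> id id v = v"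
  and \<pi>_comp: "a \<in> A \<Longrightarrow> a' \<in> A \<Longrightarrow> b \<in> B \<Longrightarrow> b' \<in> B \<Longrightarrow> v \<in> W \<Longrightarrow>
    \<pi> (a \<circ> a') (b \<circ> b') v = \<pi> a b (\<pi> a' b' v)"
  and \<pi>_adjoint: "a \<in> A \<Longrightarrow> b \<in> B \<Longrightarrow> v \<in> W \<Longrightarrow> w \<in> W \<Longrightarrow>
    rip (\<pi> a b v) w = rip v (\<pi> (cadjoint a) (cadjoint b) w)"
  using cyclic[unfolded cyclic_representation_def, THEN conjunct2, THEN conjunct2, THEN conjunct1]
  by blast+

lemma \<pi>_\<omega>: "a \<in> A \<Longrightarrow> b \<in> B \<Longrightarrow> rip \<Omega> (\<pi> a b \<Omega>) = \<omega> a b"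
  using cyclic[unfolded cyclic_representation_def, THEN conjunct2, THEN conjunct2, THEN conjunct2]
  by simp

lemma \<pi>_inner:
  assumes "a \<in> A" "b \<in> B" "a' \<in> A" "b' \<in> B"
  shows "rip (\<pi> a b \<Omega>) (\<pi> a' b' \<Omega>) = \<omega> (cadjoint a \<circ> a') (cadjoint b \<circ> b')"
  using assms by (simp add: \<pi>_adjoint \<pi>_in \<Omega>_in \<pi>_comp[symmetric] \<pi>_\<omega> A_closed B_closed)

definition right_vec :: "'g op \<Rightarrow> 'g rep_vec" where "right_vec b = \<pi> id b \<Omega>"

lemma right_vec_in [simp]: "b \<in> B \<Longrightarrow> right_vec b \<in> W"
  by (simp add: right_vec_def \<pi>_in \<Omega>_in A_closed)

lemma right_vec_inner: "b \<in> B \<Longrightarrow> c \<in> B \<Longrightarrow> rip (right_vec b) (right_vec c) = cinner (b \<Lambda>) (c \<Lambda>)"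
  by (simp add: right_vec_def \<pi>_inner A_closed marginal B_closed cadjoint_right[OF B_bounded])

lemma right_vec_dist: "b \<in> B \<Longrightarrow> c \<in> B \<Longrightarrow> W.nrm (right_vec b - right_vec c) = norm (b \<Lambda> - c \<Lambda>)"
proof -
  assume bc: "b \<in> B" "c \<in> B"
  then have "rip (right_vec b - right_vec c) (right_vec b - right_vec c) = cinner (b \<Lambda> - c \<Lambda>) (b \<Lambda> - c \<Lambda>)"
    by (simp add: W.ip_diff_left W.ip_diff_right right_vec_inner cinner_diff_left cinner_diff_right)
  then show ?thesis by (simp add: W.nrm_def cinner_self del: of_real_power)
qed

lemma W_limit_unique:
  assumes X: "\<And>n::nat. X n \<in> W" and v: "v \<in> W" "(\<lambda>n. W.nrm (X n - v)) \<longlonglongrightarrow> 0"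
    and w: "w \<in> W" "(\<lambda>n. W.nrm (X n - w)) \<longlonglongrightarrow> 0"
  shows "v = w"
proof -
  have "W.nrm (v - w) \<le> W.nrm (X n - v) + W.nrm (X n - w)" for n
    using W.nrm_triangle3[OF v(1) X[of n] w(1)] W.nrm_minus_commute[OF v(1) X[of n]] by simp
  moreover have "(\<lambda>n. W.nrm (X n - v) + W.nrm (X n - w)) \<longlonglongrightarrow> 0 + 0" by (intro tendsto_add v w)
  ultimately have "W.nrm (v - w) \<le> 0 + 0" by (intro LIMSEQ_le_const) auto
  moreover have "0 \<le> W.nrm (v - w)" using v w by (intro W.nrm_nonneg) auto
  ultimately have "W.nrm (v - w) = 0" by simp
  then have "v - w = 0" using v w by (intro W_definite) auto
  then show ?thesis by simp
qed

text \<open>The map \<open>b \<Lambda> \<mapsto> right_vec b\<close> is isometric, hence sends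
  Cauchy sequences to Cauchy sequences. Quantifying over all approximating sequences makes the
  extension independent of the one that was used.\<close>

lemma right_extension_exists:
  "\<exists>v\<in>W. \<forall>s. (\<forall>n::nat. s n \<in> B) \<longrightarrow> ((\<lambda>n. s n \<Lambda>) \<longlonglongrightarrow> x) \<longrightarrow> (\<lambda>n. W.nrm (right_vec (s n) - v)) \<longlonglongrightarrow> 0"
proof -
  obtain s where s: "\<And>n::nat. s n \<in> B" "(\<lambda>n. s n \<Lambda>) \<longlonglongrightarrow> x" using dense_sequence by blast
  have "Cauchy (\<lambda>n. s n \<Lambda>)" using s(2) by (rule LIMSEQ_imp_Cauchy)
  then have "\<forall>e>0. \<exists>M. \<forall>m\<ge>M. \<forall>n\<ge>M. W.nrm (right_vec (s m) - right_vec (s n)) < e"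
    by (simp add: right_vec_dist s(1) Cauchy_iff)
  then obtain v where v: "v \<in> W" "(\<lambda>n. W.nrm (right_vec (s n) - v)) \<longlonglongrightarrow> 0"
    using W_complete[of "\<lambda>n. right_vec (s n)"] s(1) by auto
  have "(\<lambda>n. W.nrm (right_vec (t n) - v)) \<longlonglongrightarrow> 0" if t: "\<forall>n. t n \<in> B" "(\<lambda>n. t n \<Lambda>) \<longlonglongrightarrow> x" for t
  proof (rule Lim_null_comparison)
    have "norm (W.nrm (right_vec (t n) - v)) \<le> norm (t n \<Lambda> - s n \<Lambda>) + W.nrm (right_vec (s n) - v)" for n
      using W.nrm_triangle3[of "right_vec (t n)" "right_vec (s n)" v] t(1) s(1) v(1)
      by (simp add: right_vec_dist)
    then show "\<forall>\<^sub>F n in sequentially. norm (W.nrm (right_vec (t n) - v))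
        \<le> norm (t n \<Lambda> - s n \<Lambda>) + W.nrm (right_vec (s n) - v)" by simp
    have "(\<lambda>n. norm (t n \<Lambda> - s n \<Lambda>) + W.nrm (right_vec (s n) - v)) \<longlonglongrightarrow> norm (x - x) + 0"
      by (intro tendsto_add tendsto_norm tendsto_diff t s v)
    then show "(\<lambda>n. norm (t n \<Lambda> - s n \<Lambda>) + W.nrm (right_vec (s n) - v)) \<longlonglongrightarrow> 0" by simp
  qed
  with v(1) show ?thesis by blast
qed

definition u :: "'g \<Rightarrow> 'g rep_vec" where
  "u x = (SOME v. v \<in> W \<and> (\<forall>s. (\<forall>n::nat. s n \<in> B) \<longrightarrow> ((\<lambda>n. s n \<Lambda>) \<longlonglongrightarrow> x) \<longrightarrow>
     (\<lambda>n. W.nrm (right_vec (s n) - v)) \<longlonglongrightarrow> 0))"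

lemma u_in [simp]: "u x \<in> W"
  and u_limit: "(\<And>n. s n \<in> B) \<Longrightarrow> (\<lambda>n. s n \<Lambda>) \<longlonglongrightarrow> x \<Longrightarrow> (\<lambda>n. W.nrm (right_vec (s n) - u x)) \<longlonglongrightarrow> 0"
proof -
  have P: "u x \<in> W \<and> (\<forall>s. (\<forall>n::nat. s n \<in> B) \<longrightarrow> ((\<lambda>n. s n \<Lambda>) \<longlonglongrightarrow> x) \<longrightarrow>
     (\<lambda>n. W.nrm (right_vec (s n) - u x)) \<longlonglongrightarrow> 0)"
    using someI_ex[OF right_extension_exists[of x, unfolded Bex_def]] unfolding u_def .
  show "u x \<in> W" using P by blast
  show "(\<And>n. s n \<in> B) \<Longrightarrow> (\<lambda>n. s n \<Lambda>) \<longlonglongrightarrow> x \<Longrightarrow> (\<lambda>n. W.nrm (right_vec (s n) - u x)) \<longlonglongrightarrow> 0"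
    using P by blast
qed

lemma u_inner: "rip (u x) (u y) = cinner x y"
proof -
  obtain s where s: "\<And>n::nat. s n \<in> B" "(\<lambda>n. s n \<Lambda>) \<longlonglongrightarrow> x" using dense_sequence by blast
  obtain t where t: "\<And>n::nat. t n \<in> B" "(\<lambda>n. t n \<Lambda>) \<longlonglongrightarrow> y" using dense_sequence by blast
  have "(\<lambda>n. rip (right_vec (s n)) (right_vec (t n))) \<longlonglongrightarrow> rip (u x) (u y)"
    by (rule W.tendsto_ip[OF right_vec_in[OF s(1)] u_in u_limit[OF s] right_vec_in[OF t(1)] u_in u_limit[OF t]])
  moreover have "(\<lambda>n. rip (right_vec (s n)) (right_vec (t n))) \<longlonglongrightarrow> cinner x y"
    using tendsto_cinner[OF s(2) t(2)] by (simp add: right_vec_inner s(1) t(1))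
  ultimately show ?thesis by (rule LIMSEQ_unique)
qed

lemma W_ip_zero: "v \<in> W \<Longrightarrow> rip v v = 0 \<Longrightarrow> v = 0"
  using W_definite by (simp add: W.nrm_def)

text \<open>Linearity follows from the preservation of products: the squared norm of the defect
  expands into products in the original space, where they cancel.\<close>

lemma u_add: "u (x + y) = u x + u y"
proof -
  have "rip (u (x + y) - (u x + u y)) (u (x + y) - (u x + u y)) = 0"
    by (simp add: W.ip_diff_left W.ip_diff_right W.ip_add_left W.ip_add_right u_inner
        cinner_add_left cinner_add_right)
  then have "u (x + y) - (u x + u y) = 0" by (intro W_ip_zero) auto
  then show ?thesis by simp
qed

lemma u_scaleC: "u (c *\<^sub>C x) = c *\<^sub>C u x"
proof -
  have "rip (u (c *\<^sub>C x) - c *\<^sub>C u x) (u (c *\<^sub>C x) - c *\<^sub>C u x) = 0"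
    by (simp add: W.ip_diff_left W.ip_diff_right W.ip_scaleC_left W.ip_scaleC_right u_inner
        cinner_scaleC_left cinner_scaleC_right)
  then have "u (c *\<^sub>C x) - c *\<^sub>C u x = 0" by (intro W_ip_zero) auto
  then show ?thesis by simp
qed

lemma u_right_vec: "b \<in> B \<Longrightarrow> u (b \<Lambda>) = right_vec b"
proof (rule W_limit_unique[where X = "\<lambda>_. right_vec b"])
  assume b: "b \<in> B"
  show "(\<lambda>_. W.nrm (right_vec b - u (b \<Lambda>))) \<longlonglongrightarrow> 0" by (rule u_limit) (simp_all add: b)
qed (simp_all add: W.nrm_def W.ip_zero_left)

lemma u_inj: "inj u"
proof (rule injI)
  fix x y assume "u x = u y"
  then have "cinner x z = cinner y z" for z by (metis u_inner)
  then show "x = y" by (rule cinner_eqI)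
qed

lemma H_right_eq: "H_right A R = range u"
proof
  show "H_right A R \<subseteq> range u"
  proof
    fix v assume "v \<in> H_right A R"
    then obtain X where X: "v \<in> W" "\<And>n::nat. X n \<in> {\<pi> id b \<Omega> |b. b \<in> B}" "(\<lambda>n. W.nrm (X n - v)) \<longlonglongrightarrow> 0"
      unfolding H_right_def rep_closure_def B_commutant[symmetric] W_nrm[symmetric] by blast
    then have "\<forall>n. \<exists>b. b \<in> B \<and> X n = right_vec b" by (fastforce simp: right_vec_def)
    then obtain b where b: "\<And>n. b n \<in> B" "\<And>n. X n = right_vec (b n)" by metis
    have Xin: "X n \<in> W" for n using b by simp
    have "Cauchy (\<lambda>n. b n \<Lambda>)"
    proof (rule CauchyI)
      fix e :: real assume e: "e > 0"
      obtain N where N: "\<forall>n\<ge>N. norm (W.nrm (X n - v) - 0) < e / 2"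
        using LIMSEQ_D[OF X(3), of "e / 2"] e by auto
      have "norm (b m \<Lambda> - b n \<Lambda>) < e" if "m \<ge> N" "n \<ge> N" for m n
      proof -
        have "norm (b m \<Lambda> - b n \<Lambda>) = W.nrm (X m - X n)" by (simp add: b right_vec_dist)
        also have "\<dots> \<le> W.nrm (X m - v) + W.nrm (X n - v)"
          using W.nrm_triangle3[OF Xin[of m] X(1) Xin[of n]] W.nrm_minus_commute[OF X(1) Xin[of n]] by simp
        finally show ?thesis using N[rule_format, OF that(1)] N[rule_format, OF that(2)] by simp
      qed
      then show "\<exists>M. \<forall>m\<ge>M. \<forall>n\<ge>M. norm (b m \<Lambda> - b n \<Lambda>) < e" by blast
    qed
    then obtain x where x: "(\<lambda>n. b n \<Lambda>) \<longlonglongrightarrow> x" using Cauchy_convergent_iff convergent_def by blast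
    have "v = u x"
      by (rule W_limit_unique[OF Xin X(1) X(3) u_in]) (use u_limit[OF b(1) x] in \<open>simp only: b(2)\<close>)
    then show "v \<in> range u" by blast
  qed
  show "range u \<subseteq> H_right A R"
  proof
    fix v assume "v \<in> range u"
    then obtain x where v: "v = u x" by blast
    obtain s where s: "\<And>n::nat. s n \<in> B" "(\<lambda>n. s n \<Lambda>) \<longlonglongrightarrow> x" using dense_sequence by blast
    have "range (\<lambda>n. right_vec (s n)) \<subseteq> {\<pi> id b \<Omega> |b. b \<in> B}" using s(1) by (auto simp: right_vec_def)
    then show "v \<in> H_right A R"
      unfolding H_right_def rep_closure_def B_commutant[symmetric] W_nrm[symmetric] v
      using u_in u_limit[OF s] by blast
  qed
qed

text \<open>Any competitor agrees with \<open>u\<close> on the vectors \<open>b \<Lambda>\<close>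
  and preserves products, so its value at \<open>x\<close> is a limit of the same sequence of right
  vectors.\<close>

lemma u_right_eq: "u_right A \<Lambda> R = u"
  unfolding u_right_def
proof (rule the_equality)
  show "bij_betw u UNIV (H_right A R) \<and> Vector_Spaces.linear scaleC scaleC u \<and>
      (\<forall>x y. rip (u x) (u y) = cinner x y) \<and> (\<forall>a'\<in>commutant A. u (a' \<Lambda>) = \<pi> id a' \<Omega>)"
  proof (intro conjI allI ballI)
    show "bij_betw u UNIV (H_right A R)" using u_inj H_right_eq by (simp add: bij_betw_def)
    show "Vector_Spaces.linear scaleC scaleC u" by unfold_locales (auto simp: u_add u_scaleC)
    show "rip (u x) (u y) = cinner x y" for x y by (rule u_inner)
    show "u (a' \<Lambda>) = \<pi> id a' \<Omega>" if "a' \<in> commutant A" for a'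
      using that u_right_vec[of a'] by (simp add: B_commutant right_vec_def)
  qed
  fix u' assume u': "bij_betw u' UNIV (H_right A R) \<and> Vector_Spaces.linear scaleC scaleC u' \<and>
      (\<forall>x y. rip (u' x) (u' y) = cinner x y) \<and> (\<forall>a'\<in>commutant A. u' (a' \<Lambda>) = \<pi> id a' \<Omega>)"
  have u'_in: "u' x \<in> W" for x
  proof -
    have "u' x \<in> H_right A R" using u' by (auto simp: bij_betw_def)
    then show ?thesis by (simp add: H_right_def rep_closure_def)
  qed
  show "u' = u"
  proof
    fix x
    obtain s where s: "\<And>n::nat. s n \<in> B" "(\<lambda>n. s n \<Lambda>) \<longlonglongrightarrow> x" using dense_sequence by blast
    have "W.nrm (right_vec (s n) - u' x) = norm (s n \<Lambda> - x)" for n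
    proof -
      have rv: "right_vec (s n) = u' (s n \<Lambda>)" using u' s(1) by (simp add: right_vec_def B_commutant)
      have "rip (right_vec (s n) - u' x) (right_vec (s n) - u' x) = cinner (s n \<Lambda> - x) (s n \<Lambda> - x)"
        unfolding rv using u' u'_in
        by (simp add: W.ip_diff_left W.ip_diff_right cinner_diff_left cinner_diff_right)
      then show ?thesis by (simp add: W.nrm_def cinner_self del: of_real_power)
    qed
    moreover have "(\<lambda>n. norm (s n \<Lambda> - x)) \<longlonglongrightarrow> 0"
      using s(2) by (simp add: LIM_zero tendsto_norm_zero)
    ultimately show "u' x = u x"
      by (intro W_limit_unique[where X = "\<lambda>n. right_vec (s n)"]) (simp_all add: u'_in s u_limit[OF s])
  qed
qed

text \<open>The projection of the left vector of \<open>a\<close> onto \<open>H_right\<close> is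
  thus the copy of \<open>cp a \<Lambda>\<close>. Through this the coupling enters the cost.\<close>

lemma left_vec_u: "a \<in> A \<Longrightarrow> rip (\<pi> a id \<Omega>) (u y) = cinner (cp a \<Lambda>) y"
proof -
  assume a: "a \<in> A"
  obtain s where s: "\<And>n::nat. s n \<in> B" "(\<lambda>n. s n \<Lambda>) \<longlonglongrightarrow> y" using dense_sequence by blast
  have v: "\<pi> a id \<Omega> \<in> W" using a by (simp add: \<pi>_in \<Omega>_in B_closed)
  have "rip (\<pi> a id \<Omega>) (right_vec (s n)) = cinner (cp a \<Lambda>) (s n \<Lambda>)" for n
  proof -
    have "rip (\<pi> a id \<Omega>) (right_vec (s n)) = \<omega> (cadjoint a) (s n)"
      using a s(1) by (simp add: right_vec_def \<pi>_inner A_closed B_closed)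
    also have "\<dots> = cinner \<Lambda> (cadjoint (cp a) (s n \<Lambda>))"
      using a s(1) by (simp add: cp_plan[symmetric] cp_cadjoint A_closed)
    finally show ?thesis using cadjoint_right[OF A_bounded[OF cp_in[OF a]]] by simp
  qed
  moreover have "(\<lambda>n. cinner (cp a \<Lambda>) (s n \<Lambda>)) \<longlonglongrightarrow> cinner (cp a \<Lambda>) y"
    by (intro tendsto_cinner tendsto_const s)
  moreover have "(\<lambda>n. rip (\<pi> a id \<Omega>) (right_vec (s n))) \<longlonglongrightarrow> rip (\<pi> a id \<Omega>) (u y)"
    by (rule W.tendsto_ip[OF v v _ right_vec_in[OF s(1)] u_in u_limit[OF s]])
      (simp add: W.nrm_def W.ip_zero_left)
  ultimately show ?thesis using LIMSEQ_unique by simp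
qed

lemma cost_term:
  assumes a: "a \<in> A"
  shows "(rep_norm R (pi_left A R a \<Omega> - pi_right A \<Lambda> R a \<Omega>))\<^sup>2 =
    Re (\<omega> (cadjoint a \<circ> a) id) + (norm (a \<Lambda>))\<^sup>2 - 2 * Re (cinner (cp a \<Lambda>) (a \<Lambda>))"
proof -
  have \<Omega>u: "\<Omega> = u \<Lambda>" using u_right_vec[OF B_closed(1)] by (simp add: right_vec_def \<pi>_id \<Omega>_in)
  \<comment> \<open>\<open>restrict\<close> yields \<open>undefined\<close> outside its set, so
    \<open>pi_left\<close> can be evaluated at \<open>\<Omega>\<close> only after membership is
    known.\<close>
  have "\<Omega> \<in> H_left A R"
  proof -
    have "\<Omega> = \<pi> id id \<Omega>" by (simp add: \<pi>_id \<Omega>_in)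
    then have "range (\<lambda>_::nat. \<Omega>) \<subseteq> {\<pi> a id \<Omega> |a. a \<in> A}" using A_closed(1) by blast
    moreover have "(\<lambda>_::nat. W.nrm (\<Omega> - \<Omega>)) \<longlonglongrightarrow> 0" by (simp add: W.nrm_def W.ip_zero_left)
    ultimately show ?thesis
      unfolding H_left_def rep_closure_def W_nrm[symmetric] using \<Omega>_in by blast
  qed
  then have left: "pi_left A R a \<Omega> = \<pi> a id \<Omega>" by (simp add: pi_left_def)
  have right: "pi_right A \<Lambda> R a \<Omega> = u (a \<Lambda>)"
    using \<Omega>u by (simp add: pi_right_def u_right_eq H_right_eq inv_f_f[OF u_inj])
  have v: "\<pi> a id \<Omega> \<in> W" using a by (simp add: \<pi>_in \<Omega>_in B_closed)
  have "rip (\<pi> a id \<Omega> - u (a \<Lambda>)) (\<pi> a id \<Omega> - u (a \<Lambda>)) =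
      \<omega> (cadjoint a \<circ> a) id + cinner (a \<Lambda>) (a \<Lambda>) - cinner (cp a \<Lambda>) (a \<Lambda>) - cnj (cinner (cp a \<Lambda>) (a \<Lambda>))"
    using v a W.ip_commute[OF v u_in, of "a \<Lambda>"]
    by (simp add: W.ip_diff_left W.ip_diff_right \<pi>_inner B_closed u_inner left_vec_u)
  then have "Re (rip (\<pi> a id \<Omega> - u (a \<Lambda>)) (\<pi> a id \<Omega> - u (a \<Lambda>))) =
      Re (\<omega> (cadjoint a \<circ> a) id) + (norm (a \<Lambda>))\<^sup>2 - 2 * Re (cinner (cp a \<Lambda>) (a \<Lambda>))"
    by (simp add: cinner_self del: of_real_power)
  then show ?thesis
    unfolding left right W_nrm[symmetric] using v by (simp add: W.nrm_power2)
qed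

end

text \<open>The GNS construction witnesses that a cyclic representation exists; therefore the chosen
  one is cyclic, and \<open>cost_term\<close> applies to it.\<close>

lemma (in right_plan) transport_cost_eq:
  assumes "B = commutant A" and k: "\<And>l. l \<in> {1..n} \<Longrightarrow> k l \<in> A"
  shows "transport_cost A \<Lambda> n k \<omega> =
    (\<Sum>l=1..n. Re (\<omega> (cadjoint (k l) \<circ> k l) id) + (norm (k l \<Lambda>))\<^sup>2 - 2 * Re (cinner (cp (k l) \<Lambda>) (k l \<Lambda>)))"
proof -
  define R where "R = (SOME R. cyclic_representation A (commutant A) \<omega> R)"
  have "cyclic_representation A B \<omega> R"
    unfolding R_def assms(1)[symmetric] using cyclic_representation_gns by (rule someI)
  then interpret plan_rep A B \<omega> \<Lambda> R by unfold_locales (rule assms(1))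
  show ?thesis
    unfolding transport_cost_def Let_def R_def[symmetric]
    by (intro sum.cong refl cost_term k)
qed

section \<open>The triangle inequality\<close>

text \<open>The three terms are squared norms of differences of \<open>(p, \<alpha>, 0)\<close>, \<open>(y, 0, 0)\<close> and \<open>(q, 0, \<beta>)\<close>, where
  \<open>\<alpha>\<^sup>2 = \<parallel>x\<parallel>\<^sup>2 - \<parallel>p\<parallel>\<^sup>2\<close> and \<open>\<beta>\<^sup>2 = \<parallel>z\<parallel>\<^sup>2 - \<parallel>q\<parallel>\<^sup>2\<close>.\<close>

lemma sqrt_cost_triangle:
  fixes x y z p q :: "'g::complex_hilbert_space"
  assumes px: "norm p \<le> norm x" and qz: "norm q \<le> norm z"
  defines "I1 \<equiv> (norm x)\<^sup>2 + (norm y)\<^sup>2 - 2 * Re (cinner p y)"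
    and "I2 \<equiv> (norm y)\<^sup>2 + (norm z)\<^sup>2 - 2 * Re (cinner y q)"
    and "I3 \<equiv> (norm x)\<^sup>2 + (norm z)\<^sup>2 - 2 * Re (cinner p q)"
  shows "0 \<le> I1 \<and> 0 \<le> I2 \<and> 0 \<le> I3 \<and> sqrt I3 \<le> sqrt I1 + sqrt I2"
proof -
  define \<alpha> where "\<alpha> = (norm x)\<^sup>2 - (norm p)\<^sup>2"
  define \<beta> where "\<beta> = (norm z)\<^sup>2 - (norm q)\<^sup>2"
  define a where "a = norm (p - y)"
  define b where "b = norm (y - q)"
  have \<alpha>: "0 \<le> \<alpha>" and \<beta>: "0 \<le> \<beta>" using px qz by (simp_all add: \<alpha>_def \<beta>_def power_mono)
  have sq: "(norm (v - w))\<^sup>2 = (norm v)\<^sup>2 + (norm w)\<^sup>2 - 2 * Re (cinner v w)" for v w :: 'g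
    by (simp add: power2_norm_eq_inner inner_diff inner_commute flip: inner_eq_Re_cinner)
  have I1: "I1 = a\<^sup>2 + \<alpha>" and I2: "I2 = b\<^sup>2 + \<beta>"
    by (simp_all add: I1_def I2_def a_def b_def \<alpha>_def \<beta>_def sq)
  have I3: "I3 = (norm (p - q))\<^sup>2 + \<alpha> + \<beta>" by (simp add: I3_def \<alpha>_def \<beta>_def sq)
  have pos: "0 \<le> I1" "0 \<le> I2" "0 \<le> I3" using \<alpha> \<beta> by (simp_all add: I1 I2 I3)
  have ab: "0 \<le> a" "0 \<le> b" by (simp_all add: a_def b_def)
  have "norm (p - q) \<le> a + b" unfolding a_def b_def using norm_triangle_ineq[of "p - y" "y - q"] by simp
  then have "(norm (p - q))\<^sup>2 \<le> (a + b)\<^sup>2" by (intro power_mono) auto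
  moreover have "a * b \<le> sqrt I1 * sqrt I2"
    using \<alpha> \<beta> ab by (intro mult_mono real_le_rsqrt) (simp_all add: I1 I2)
  ultimately have "I3 \<le> (sqrt I1 + sqrt I2)\<^sup>2"
    using pos by (simp add: power2_sum I1 I2 I3)
  then have "sqrt I3 \<le> sqrt I1 + sqrt I2" using pos by (intro real_le_lsqrt) auto
  with pos show ?thesis by blast
qed

text \<open>Minkowski's inequality for the square roots of the individual costs.\<close>

lemma sqrt_sum_triangle:
  fixes f g h :: "'i \<Rightarrow> real"
  assumes nonneg: "\<And>i. i \<in> I \<Longrightarrow> 0 \<le> f i" "\<And>i. i \<in> I \<Longrightarrow> 0 \<le> g i" "\<And>i. i \<in> I \<Longrightarrow> 0 \<le> h i"
    and le: "\<And>i. i \<in> I \<Longrightarrow> sqrt (h i) \<le> sqrt (f i) + sqrt (g i)"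
  shows "sqrt (sum h I) \<le> sqrt (sum f I) + sqrt (sum g I)"
proof -
  have L2: "L2_set (\<lambda>i. sqrt (f i)) I = sqrt (sum f I)" if "\<And>i. i \<in> I \<Longrightarrow> 0 \<le> f i" for f
    unfolding L2_set_def using that by simp
  have "L2_set (\<lambda>i. sqrt (h i)) I \<le> L2_set (\<lambda>i. sqrt (f i) + sqrt (g i)) I"
    by (rule L2_set_mono) (use le nonneg in auto)
  also have "\<dots> \<le> L2_set (\<lambda>i. sqrt (f i)) I + L2_set (\<lambda>i. sqrt (g i)) I"
    by (rule L2_set_triangle_ineq)
  finally show ?thesis using nonneg by (simp add: L2)
qed

text \<open>\<open>\<Lambda>\<^sub>0\<close>, \<open>\<Lambda>\<close> and \<open>\<Lambda>'\<close>
  stand for the first, middle and last state. The plan \<open>\<phi>\<close> is read in two ways: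
  with its factors exchanged and \<open>\<Lambda>\<close> for the gluing, with
  \<open>\<Lambda>'\<close> for its own cost.\<close>

lemma (in plan_pair) glue_cost:
  assumes \<phi>: "right_plan A B \<phi> \<Lambda>'" and left: "\<And>a. a \<in> A \<Longrightarrow> \<omega> a id = cinner \<Lambda>\<^sub>0 (a \<Lambda>\<^sub>0)"
    and k: "\<And>l. l \<in> {1..n} \<Longrightarrow> k l \<in> A"
  shows "sqrt (transport_cost A \<Lambda>' n k glue) \<le> sqrt (transport_cost A \<Lambda> n k \<omega>) + sqrt (transport_cost A \<Lambda>' n k \<phi>)"
proof -
  interpret F: right_plan A B \<phi> \<Lambda>' by (rule \<phi>)
  have B: "B = commutant A" by (rule R.A_commutant)
  interpret G: right_plan A B glue \<Lambda>'
    by unfold_locales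
      (rule L.vA L.vB tensor_state_glue L.A_commutant F.dense | simp add: glue_id_left F.marginal)+
  have G_cp: "G.cp a = F.cp (L.cp a)" if "a \<in> A" for a
    using that by (intro G.cp_unique[symmetric]) (simp_all add: F.cp_in L.cp_in F.cp_plan glue_left)
  have norm_L: "Re (\<omega> (cadjoint a \<circ> a) id) = (norm (a \<Lambda>\<^sub>0))\<^sup>2"
    and norm_F: "Re (\<phi> (cadjoint a \<circ> a) id) = (norm (a \<Lambda>))\<^sup>2" if "a \<in> A" for a
    using that R.marginal[of "cadjoint a \<circ> a"]
    by (simp_all add: left L.A_closed cadjoint_right[OF L.A_bounded, symmetric] cinner_self del: of_real_power)
  have "sqrt (\<Sum>l=1..n. (norm (k l \<Lambda>\<^sub>0))\<^sup>2 + (norm (k l \<Lambda>'))\<^sup>2 - 2 * Re (cinner (G.cp (k l) \<Lambda>') (k l \<Lambda>'))) \<le>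
      sqrt (\<Sum>l=1..n. (norm (k l \<Lambda>\<^sub>0))\<^sup>2 + (norm (k l \<Lambda>))\<^sup>2 - 2 * Re (cinner (L.cp (k l) \<Lambda>) (k l \<Lambda>))) +
      sqrt (\<Sum>l=1..n. (norm (k l \<Lambda>))\<^sup>2 + (norm (k l \<Lambda>'))\<^sup>2 - 2 * Re (cinner (F.cp (k l) \<Lambda>') (k l \<Lambda>')))"
    (is "sqrt (sum ?h _) \<le> sqrt (sum ?f _) + sqrt (sum ?g _)")
  proof -
    have "0 \<le> ?f l \<and> 0 \<le> ?g l \<and> 0 \<le> ?h l \<and> sqrt (?h l) \<le> sqrt (?f l) + sqrt (?g l)" if l: "l \<in> {1..n}" for l
    proof -
      have kl: "k l \<in> A" using l by (rule k)
      have contr: "norm (F.cp a \<Lambda>') \<le> norm (a \<Lambda>)" if "a \<in> A" for a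
        by (rule power2_le_imp_le) (use F.cp_vector_norm[OF that] norm_F[OF that] in simp_all)
      \<comment> \<open>\<open>q\<close> is the adjoint of the contraction
        \<open>a \<Lambda> \<mapsto> F.cp a \<Lambda>'\<close> applied to
        \<open>k l \<Lambda>'\<close>. It moves the coupling terms of \<open>\<phi>\<close> and
        \<open>glue\<close> to products with vectors \<open>a \<Lambda>\<close> over the middle
        state, where the coupling term of \<open>\<omega>\<close> already lives.\<close>
      have "\<exists>q. norm q \<le> norm (k l \<Lambda>') \<and> (\<forall>a\<in>A. cinner q (a \<Lambda>) = cinner (k l \<Lambda>') (F.cp a \<Lambda>'))"
      proof (rule riesz_parametrized[OF vna_csubspace[OF L.vA]])
        fix a assume a: "a \<in> A"
        have "cmod (cinner (k l \<Lambda>') (F.cp a \<Lambda>')) \<le> norm (k l \<Lambda>') * norm (F.cp a \<Lambda>')" by (rule cmod_cinner_le)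
        also have "\<dots> \<le> norm (k l \<Lambda>') * norm (a \<Lambda>)" by (intro mult_left_mono contr a) simp
        finally show "cmod (cinner (k l \<Lambda>') (F.cp a \<Lambda>')) \<le> norm (k l \<Lambda>') * norm (a \<Lambda>)" .
      qed (simp_all add: scaleC_fun_def[THEN fun_cong] F.cp_add F.cp_scaleC cinner_add_right cinner_scaleC_right)
      then obtain q where q: "norm q \<le> norm (k l \<Lambda>')" "\<And>a. a \<in> A \<Longrightarrow> cinner q (a \<Lambda>) = cinner (k l \<Lambda>') (F.cp a \<Lambda>')"
        by blast
      have q': "cinner (F.cp a \<Lambda>') (k l \<Lambda>') = cinner (a \<Lambda>) q" if "a \<in> A" for a
        using q(2)[OF that] by (metis cinner_commute)
      have p: "norm (L.cp (k l) \<Lambda>) \<le> norm (k l \<Lambda>\<^sub>0)"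
        by (rule power2_le_imp_le) (use L.cp_vector_norm[OF kl] norm_L[OF kl] in simp_all)
      show ?thesis
        using sqrt_cost_triangle[OF p q(1), where y = "k l \<Lambda>"] kl by (simp add: G_cp q' L.cp_in)
    qed
    then show ?thesis by (intro sqrt_sum_triangle) auto
  qed
  moreover have "transport_cost A \<Lambda> n k \<omega> =
      (\<Sum>l=1..n. (norm (k l \<Lambda>\<^sub>0))\<^sup>2 + (norm (k l \<Lambda>))\<^sup>2 - 2 * Re (cinner (L.cp (k l) \<Lambda>) (k l \<Lambda>)))"
    by (subst L.transport_cost_eq[OF B]) (simp_all add: norm_L k cong: sum.cong_simp)
  moreover have "transport_cost A \<Lambda>' n k \<phi> =
      (\<Sum>l=1..n. (norm (k l \<Lambda>))\<^sup>2 + (norm (k l \<Lambda>'))\<^sup>2 - 2 * Re (cinner (F.cp (k l) \<Lambda>') (k l \<Lambda>')))"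
    by (subst F.transport_cost_eq[OF B]) (simp_all add: norm_F k cong: sum.cong_simp)
  moreover have "transport_cost A \<Lambda>' n k glue =
      (\<Sum>l=1..n. (norm (k l \<Lambda>\<^sub>0))\<^sup>2 + (norm (k l \<Lambda>'))\<^sup>2 - 2 * Re (cinner (G.cp (k l) \<Lambda>') (k l \<Lambda>')))"
    by (subst G.transport_cost_eq[OF B])
      (simp_all add: norm_L glue_id_right L.A_closed k cong: sum.cong_simp)
  ultimately show ?thesis by simp
qed

lemma transport_cost_nonneg: "0 \<le> transport_cost A \<Lambda> n k \<omega>"
  by (simp add: transport_cost_def Let_def sum_nonneg)

theorem proposition4p3:
  fixes A :: "'g::complex_hilbert_space op set"
    and J :: "'g op" and P :: "'g set"
    and \<Lambda> :: "('g op \<Rightarrow> complex) \<Rightarrow> 'g"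
    and \<sigma> :: "('g op \<Rightarrow> complex) \<Rightarrow> real \<Rightarrow> 'g op \<Rightarrow> 'g op"
    and n :: nat and k :: "nat \<Rightarrow> 'g op"
    and \<mu> \<nu> \<xi> :: "'g op \<Rightarrow> complex"
  assumes "von_neumann_algebra A" and "sigma_finite_algebra A"
    and "standard_form A J P"
    and "\<And>\<rho>. \<rho> \<in> \<FF> A \<Longrightarrow> cyclic_separating A (\<Lambda> \<rho>) \<and> (\<forall>a\<in>A. \<rho> a = cinner (\<Lambda> \<rho>) (a (\<Lambda> \<rho>)))"
    and "\<And>\<rho>. \<rho> \<in> \<FF> A \<Longrightarrow> is_modular_group A (\<Lambda> \<rho>) (\<sigma> \<rho>)"
    and "\<And>l. l \<in> {1..n} \<Longrightarrow> k l \<in> A"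
    and "\<mu> \<in> \<FF> A" and "\<nu> \<in> \<FF> A" and "\<xi> \<in> \<FF> A"
  shows "W2 A \<Lambda> \<sigma> n k \<mu> \<xi> \<le> W2 A \<Lambda> \<sigma> n k \<mu> \<nu> + W2 A \<Lambda> \<sigma> n k \<nu> \<xi>"
proof -
  note vA = assms(1) and modular = assms(5) and k = assms(6)
  define B where "B = commutant A"
  have vB: "von_neumann_algebra B" unfolding B_def by (rule von_neumann_algebra_commutant[OF vA])
  have AB: "A = commutant B" unfolding B_def by (simp add: vna_bicommutant[OF vA])
  note id = vna_id[OF vA] vna_id[OF vB]
  have cs: "cyclic_separating A (\<Lambda> \<rho>)" and vec: "a \<in> A \<Longrightarrow> \<rho> a = cinner (\<Lambda> \<rho>) (a (\<Lambda> \<rho>))"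
    if "\<rho> \<in> \<FF> A" for \<rho> a
    using assms(4)[OF that] by auto
  have dense_B: "closure ((\<lambda>b. b (\<Lambda> \<rho>)) ` B) = UNIV" if "\<rho> \<in> \<FF> A" for \<rho>
    unfolding B_def by (rule separating_imp_cyclic_commutant[OF vA cs[OF that]])
  have dense_A: "closure ((\<lambda>a. a (\<Lambda> \<rho>)) ` A) = UNIV" if "\<rho> \<in> \<FF> A" for \<rho>
    using cs[OF that] by (simp add: cyclic_separating_def)
  have unit: "cinner (\<Lambda> \<rho>) (\<Lambda> \<rho>) = 1" if "\<rho> \<in> \<FF> A" for \<rho>
    using vec[OF that id(1)] that by (simp add: faithful_normal_states_def state_on_def)
  note mod = modular_group_dual[OF vA cs modular, folded B_def]
  let ?T = "modular_transport_plans A \<Lambda> \<sigma>"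
  have plan: "right_plan A B \<omega> (\<Lambda> \<tau>)" "right_plan B A (\<lambda>b a. \<omega> a b) (\<Lambda> \<rho>)"
    "\<And>a. a \<in> A \<Longrightarrow> \<omega> a id = cinner (\<Lambda> \<rho>) (a (\<Lambda> \<rho>))"
    "\<And>a b t. a \<in> A \<Longrightarrow> b \<in> B \<Longrightarrow> \<omega> (\<sigma> \<rho> t a) b = \<omega> a (dual_map A (\<Lambda> \<tau>) (\<sigma> \<tau> t) b)"
    if \<omega>: "\<omega> \<in> ?T \<rho> \<tau>" and \<rho>: "\<rho> \<in> \<FF> A" and \<tau>: "\<tau> \<in> \<FF> A" for \<omega> \<rho> \<tau>
  proof -
    have ts: "tensor_state A B \<omega>" and l: "\<forall>a\<in>A. \<omega> a id = \<rho> a"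
      and r: "\<forall>b\<in>B. \<omega> id b = cinner (\<Lambda> \<tau>) (b (\<Lambda> \<tau>))"
      using \<omega> by (auto simp: modular_transport_plans_def transport_plans_def commutant_state_def B_def)
    interpret T: tensor_functional A B \<omega> by unfold_locales (rule vA vB ts)+
    show l': "\<omega> a id = cinner (\<Lambda> \<rho>) (a (\<Lambda> \<rho>))" if "a \<in> A" for a using l vec[OF \<rho>] that by simp
    show "right_plan A B \<omega> (\<Lambda> \<tau>)" by unfold_locales (simp_all add: AB[symmetric] dense_B[OF \<tau>] r)
    interpret S: tensor_functional B A "\<lambda>b a. \<omega> a b" by (rule T.swap)
    show "right_plan B A (\<lambda>b a. \<omega> a b) (\<Lambda> \<rho>)" by unfold_locales (simp_all add: B_def dense_A[OF \<rho>] l')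
    show "\<omega> (\<sigma> \<rho> t a) b = \<omega> a (dual_map A (\<Lambda> \<tau>) (\<sigma> \<tau> t) b)" if "a \<in> A" "b \<in> B" for a b t
      using \<omega> that by (simp add: modular_transport_plans_def B_def)
  qed
  \<comment> \<open>A real infimum can be bounded from below through its members only over a
    nonempty set. The product of two states invariant under their modular groups is a modular
    plan.\<close>
  have nonempty: "?T \<rho> \<tau> \<noteq> {}" if \<rho>: "\<rho> \<in> \<FF> A" and \<tau>: "\<tau> \<in> \<FF> A" for \<rho> \<tau>
  proof -
    let ?\<omega> = "\<lambda>a b. cinner (\<Lambda> \<rho>) (a (\<Lambda> \<rho>)) * cinner (\<Lambda> \<tau>) (b (\<Lambda> \<tau>))"
    have "cinner (\<Lambda> \<tau>) (dual_map A (\<Lambda> \<tau>) (\<sigma> \<tau> t) b (\<Lambda> \<tau>)) = cinner (\<Lambda> \<tau>) (b (\<Lambda> \<tau>))" if "b \<in> B" for b t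
    proof -
      \<comment> \<open>With the unit fixed, the duality relation at \<open>id\<close> says that the
        vector state on the commutant is invariant under the dual group.\<close>
      have "\<sigma> \<tau> t id = id"
        using modular[OF \<tau>] id(1) imaginary_powers_unitary(3) unfolding is_modular_group_def
        by (fastforce simp: fun_eq_iff)
      then show ?thesis using mod(4)[OF \<tau> \<tau> that id(1), of t] by simp
    qed
    then have "?\<omega> \<in> ?T \<rho> \<tau>"
      using tensor_state_product[OF vA vB unit[OF \<rho>] unit[OF \<tau>]] mod(2)[OF \<rho> \<rho>]
      by (simp add: modular_transport_plans_def transport_plans_def commutant_state_def B_def
          vec[OF \<rho>] unit[OF \<rho>] unit[OF \<tau>])
    then show ?thesis by blast
  qed
  have bdd: "bdd_below ((\<lambda>\<omega>. sqrt (transport_cost A v n k \<omega>)) ` X)" for v X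
    by (rule bdd_belowI2[where m = 0]) (simp add: transport_cost_nonneg)
  have step: "W2 A \<Lambda> \<sigma> n k \<mu> \<xi> \<le> sqrt (transport_cost A (\<Lambda> \<nu>) n k \<omega>) + sqrt (transport_cost A (\<Lambda> \<xi>) n k \<phi>)"
    if \<omega>: "\<omega> \<in> ?T \<mu> \<nu>" and \<phi>: "\<phi> \<in> ?T \<nu> \<xi>" for \<omega> \<phi>
  proof -
    note \<omega>_plan = plan[OF \<omega> assms(7,8)] and \<phi>_plan = plan[OF \<phi> assms(8,9)]
    interpret plan_pair A B \<omega> \<phi> "\<Lambda> \<nu>" unfolding plan_pair_def using \<omega>_plan(1) \<phi>_plan(2) by blast
    \<comment> \<open>Both sides have the same products with \<open>b (\<Lambda> \<nu>)\<close>: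
      modularity of \<open>\<omega>\<close> carries the group to \<open>b\<close>, and duality at
      \<open>\<nu>\<close> carries it back onto \<open>L.cp a\<close>.\<close>
    have cp_\<sigma>: "L.cp (\<sigma> \<mu> t a) = \<sigma> \<nu> t (L.cp a)" if a: "a \<in> A" for t a
    proof (rule L.cp_unique[symmetric])
      show "\<sigma> \<mu> t a \<in> A" "\<sigma> \<nu> t (L.cp a) \<in> A"
        using a assms(7,8) by (auto intro: mod(1) L.cp_in)
      fix b assume b: "b \<in> B"
      have "cinner (\<Lambda> \<nu>) (\<sigma> \<nu> t (L.cp a) (b (\<Lambda> \<nu>))) = \<omega> a (dual_map A (\<Lambda> \<nu>) (\<sigma> \<nu> t) b)"
        using mod(4)[OF assms(8,8) b L.cp_in[OF a], of t] L.cp_plan[OF a mod(3)[OF assms(8,8) b]] by simp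
      then show "cinner (\<Lambda> \<nu>) (\<sigma> \<nu> t (L.cp a) (b (\<Lambda> \<nu>))) = \<omega> (\<sigma> \<mu> t a) b"
        using \<omega>_plan(4)[OF a b] by simp
    qed
    have "glue (\<sigma> \<mu> t a) b = glue a (dual_map A (\<Lambda> \<xi>) (\<sigma> \<xi> t) b)" if a: "a \<in> A" and b: "b \<in> B" for a b t
      using glue_left[OF mod(1)[OF assms(7,7) a] b] glue_left[OF a mod(3)[OF assms(9,9) b]]
        \<phi>_plan(4)[OF L.cp_in[OF a] b] by (simp add: cp_\<sigma>[OF a])
    moreover have "glue a id = \<mu> a" if "a \<in> A" for a
      using glue_id_right[OF that] \<omega>_plan(3)[OF that] vec[OF assms(7) that] by simp
    moreover have "glue id b = cinner (\<Lambda> \<xi>) (b (\<Lambda> \<xi>))" if "b \<in> B" for b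
      using glue_id_left[OF that] right_plan.marginal[OF \<phi>_plan(1) that] by simp
    ultimately have "glue \<in> ?T \<mu> \<xi>"
      using tensor_state_glue
      by (simp add: modular_transport_plans_def transport_plans_def commutant_state_def B_def)
    then have "W2 A \<Lambda> \<sigma> n k \<mu> \<xi> \<le> sqrt (transport_cost A (\<Lambda> \<xi>) n k glue)"
      unfolding W2_def by (intro cINF_lower bdd)
    also have "\<dots> \<le> sqrt (transport_cost A (\<Lambda> \<nu>) n k \<omega>) + sqrt (transport_cost A (\<Lambda> \<xi>) n k \<phi>)"
      by (rule glue_cost[OF \<phi>_plan(1) \<omega>_plan(3) k])
    finally show ?thesis .
  qed
  \<comment> \<open>The bound for a pair of plans is separated into two infima: with
    \<open>\<phi>\<close> fixed it is minimized over \<open>\<omega>\<close>, afterwards over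
    \<open>\<phi>\<close>.\<close>
  have "W2 A \<Lambda> \<sigma> n k \<mu> \<xi> - sqrt (transport_cost A (\<Lambda> \<xi>) n k \<phi>) \<le> W2 A \<Lambda> \<sigma> n k \<mu> \<nu>" if "\<phi> \<in> ?T \<nu> \<xi>" for \<phi>
    unfolding W2_def[of _ _ _ _ _ \<mu> \<nu>]
    using step[OF _ that] nonempty[OF assms(7,8)] by (intro cINF_greatest) (simp_all add: algebra_simps)
  then have "W2 A \<Lambda> \<sigma> n k \<mu> \<xi> - W2 A \<Lambda> \<sigma> n k \<mu> \<nu> \<le> W2 A \<Lambda> \<sigma> n k \<nu> \<xi>"
    unfolding W2_def[of _ _ _ _ _ \<nu> \<xi>]
    using nonempty[OF assms(8,9)] by (intro cINF_greatest) (simp_all add: algebra_simps)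
  then show ?thesis by simp
qed

end
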